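(* Over Bishop-style constructive mathematics (BISH), the following two statements are equivalent: (i) Markov's principle (MP): for each binary sequence $(a_n)_{n\geqslant 1}$, if it is impossible that $a_n=0$ for all $n$, then there exists $n$ with $a_n=1$. (ii) Every decreasing sequence of nonnegative real numbers that is negatively convergent to $0$ actually converges to $0$.
   Context: BISH (Bishop-style constructive mathematics) means mathematics carried out with intuitionistic logic, as presented in the books of Bishop, Bishop and Bridges, and Bridges and Vîţă, within a constructive set- or type-theoretic framework (such as constructive set theory or Martin-Löf type theory). The law of excluded middle, LPO and MP are not assumed. A sequence $(x_n)_{n\geqslant1}$ is decreasing if $x_{n+1}\leqslant x_n$ for all $n$. Definition. A sequence $(x_n)_{n\geqslant1}$ of real numbers is negatively convergent to $0$ if for each $\varepsilon>0$ it is impossible that $|x_n|>\varepsilon$ for infinitely many $n$. Here "$|x_n|>\varepsilon$ for infinitely many $n$" means that there is a strictly increasing sequence $(n_k)_{k\geqslant1}$ of positive integers with $|x_{n_k}|>\varepsilon$ for all $k$. *)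

theory Defs
  imports Main
begin

text \<open>
  The statement is a metatheorem: an equivalence derivable by constructive means.  It cannot be
  rendered by a HOL equivalence, since HOL is classical and both sides hold there.  Hence the object
  logic is embedded deeply.  It is the extensional theory E-HA\<open>\<^sup>\<omega>\<close> of intuitionistic arithmetic in all
  finite types, presented by natural deduction with typed lambda terms and a recursor.  The theory
  is contained in the usual constructive set theories and, with setoid equality, in Martin-Loef
  type theory.  It contains neither excluded middle nor a choice principle.  A set \<open>T\<close> of sentences
  on the left of \<open>\<^bold>\<turnstile>\<close> is a set of additional axioms, such as the countable or dependent choice
  that some accounts of constructive mathematics include; the empty set gives the bare theory.
\<close>


subsection \<open>Types, terms and formulas\<close>

datatype ty =
    NatT
  | FunT ty ty  (infixr \<open>\<^bold>\<rightarrow>\<close> 65)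
  | ProdT ty ty  (infixr \<open>\<^bold>\<times>\<close> 70)

text \<open>
  Terms and formulas are locally nameless: \<open>Bound i\<close> is a de Bruijn index and \<open>Par x \<sigma>\<close> is a free
  variable, which carries its type.  \<open>Rec a f n\<close> is primitive recursion, with base value \<open>a\<close> and step
  function \<open>f\<close> of type \<open>NatT \<^bold>\<rightarrow> \<sigma> \<^bold>\<rightarrow> \<sigma>\<close>, where \<open>\<sigma>\<close> is any type.
\<close>

datatype tm =
    Bound nat
  | Par string ty
  | Lam ty tm
  | App tm tm  (infixl \<open>\<^bold>\<cdot>\<close> 90)
  | Tup tm tm
  | Proj1 tm
  | Proj2 tm
  | Zero
  | Succ tm
  | Rec tm tm tm

datatype fm =
    Eq tm tm  (infix \<open>\<^bold>=\<close> 50)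
  | Bot
  | Conj fm fm  (infixr \<open>\<^bold>\<and>\<close> 35)
  | Disj fm fm  (infixr \<open>\<^bold>\<or>\<close> 30)
  | Imp fm fm  (infixr \<open>\<^bold>\<longrightarrow>\<close> 25)
  | All ty fm
  | Ex ty fm

definition Neg :: "fm \<Rightarrow> fm"  (\<open>\<^bold>\<not> _\<close> [40] 40) where
  "Neg \<phi> = (\<phi> \<^bold>\<longrightarrow> Bot)"

definition Iff :: "fm \<Rightarrow> fm \<Rightarrow> fm"  (infixr \<open>\<^bold>\<longleftrightarrow>\<close> 25) where
  "Iff \<phi> \<psi> = ((\<phi> \<^bold>\<longrightarrow> \<psi>) \<^bold>\<and> (\<psi> \<^bold>\<longrightarrow> \<phi>))"

inductive has_type :: "ty list \<Rightarrow> tm \<Rightarrow> ty \<Rightarrow> bool" where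
  "i < length \<Gamma> \<Longrightarrow> has_type \<Gamma> (Bound i) (\<Gamma> ! i)"
| "has_type \<Gamma> (Par x \<sigma>) \<sigma>"
| "has_type (\<sigma> # \<Gamma>) t \<tau> \<Longrightarrow> has_type \<Gamma> (Lam \<sigma> t) (\<sigma> \<^bold>\<rightarrow> \<tau>)"
| "has_type \<Gamma> t (\<sigma> \<^bold>\<rightarrow> \<tau>) \<Longrightarrow> has_type \<Gamma> u \<sigma> \<Longrightarrow> has_type \<Gamma> (t \<^bold>\<cdot> u) \<tau>"
| "has_type \<Gamma> t \<sigma> \<Longrightarrow> has_type \<Gamma> u \<tau> \<Longrightarrow> has_type \<Gamma> (Tup t u) (\<sigma> \<^bold>\<times> \<tau>)"
| "has_type \<Gamma> t (\<sigma> \<^bold>\<times> \<tau>) \<Longrightarrow> has_type \<Gamma> (Proj1 t) \<sigma>"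
| "has_type \<Gamma> t (\<sigma> \<^bold>\<times> \<tau>) \<Longrightarrow> has_type \<Gamma> (Proj2 t) \<tau>"
| "has_type \<Gamma> Zero NatT"
| "has_type \<Gamma> t NatT \<Longrightarrow> has_type \<Gamma> (Succ t) NatT"
| "has_type \<Gamma> a \<sigma> \<Longrightarrow> has_type \<Gamma> f (NatT \<^bold>\<rightarrow> \<sigma> \<^bold>\<rightarrow> \<sigma>) \<Longrightarrow> has_type \<Gamma> n NatT
    \<Longrightarrow> has_type \<Gamma> (Rec a f n) \<sigma>"

primrec wf_fm :: "ty list \<Rightarrow> fm \<Rightarrow> bool" where
  "wf_fm \<Gamma> (t \<^bold>= u) \<longleftrightarrow> (\<exists>\<sigma>. has_type \<Gamma> t \<sigma> \<and> has_type \<Gamma> u \<sigma>)"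
| "wf_fm \<Gamma> Bot \<longleftrightarrow> True"
| "wf_fm \<Gamma> (\<phi> \<^bold>\<and> \<psi>) \<longleftrightarrow> wf_fm \<Gamma> \<phi> \<and> wf_fm \<Gamma> \<psi>"
| "wf_fm \<Gamma> (\<phi> \<^bold>\<or> \<psi>) \<longleftrightarrow> wf_fm \<Gamma> \<phi> \<and> wf_fm \<Gamma> \<psi>"
| "wf_fm \<Gamma> (\<phi> \<^bold>\<longrightarrow> \<psi>) \<longleftrightarrow> wf_fm \<Gamma> \<phi> \<and> wf_fm \<Gamma> \<psi>"
| "wf_fm \<Gamma> (All \<sigma> \<phi>) \<longleftrightarrow> wf_fm (\<sigma> # \<Gamma>) \<phi>"
| "wf_fm \<Gamma> (Ex \<sigma> \<phi>) \<longleftrightarrow> wf_fm (\<sigma> # \<Gamma>) \<phi>"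

primrec pars_tm :: "tm \<Rightarrow> (string \<times> ty) set" where
  "pars_tm (Bound i) = {}"
| "pars_tm (Par x \<sigma>) = {(x, \<sigma>)}"
| "pars_tm (Lam \<sigma> t) = pars_tm t"
| "pars_tm (t \<^bold>\<cdot> u) = pars_tm t \<union> pars_tm u"
| "pars_tm (Tup t u) = pars_tm t \<union> pars_tm u"
| "pars_tm (Proj1 t) = pars_tm t"
| "pars_tm (Proj2 t) = pars_tm t"
| "pars_tm Zero = {}"
| "pars_tm (Succ t) = pars_tm t"
| "pars_tm (Rec a f n) = pars_tm a \<union> pars_tm f \<union> pars_tm n"

primrec pars :: "fm \<Rightarrow> (string \<times> ty) set" where
  "pars (t \<^bold>= u) = pars_tm t \<union> pars_tm u"
| "pars Bot = {}"
| "pars (\<phi> \<^bold>\<and> \<psi>) = pars \<phi> \<union> pars \<psi>"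
| "pars (\<phi> \<^bold>\<or> \<psi>) = pars \<phi> \<union> pars \<psi>"
| "pars (\<phi> \<^bold>\<longrightarrow> \<psi>) = pars \<phi> \<union> pars \<psi>"
| "pars (All \<sigma> \<phi>) = pars \<phi>"
| "pars (Ex \<sigma> \<phi>) = pars \<phi>"

definition sentence :: "fm \<Rightarrow> bool" where
  "sentence \<phi> \<longleftrightarrow> wf_fm [] \<phi> \<and> pars \<phi> = {}"

text \<open>
  \<open>inst k u\<close> replaces index \<open>k\<close> by \<open>u\<close>.  No lifting takes place: the rules below apply it only to
  terms \<open>u\<close> without dangling indices and to bodies in which \<open>k\<close> is the only dangling index.
  \<open>bind k x \<sigma>\<close> is the inverse operation; it turns a free variable into index \<open>k\<close>.
\<close>

primrec inst_tm :: "nat \<Rightarrow> tm \<Rightarrow> tm \<Rightarrow> tm" where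
  "inst_tm k u (Bound i) = (if i = k then u else Bound i)"
| "inst_tm k u (Par x \<sigma>) = Par x \<sigma>"
| "inst_tm k u (Lam \<sigma> t) = Lam \<sigma> (inst_tm (Suc k) u t)"
| "inst_tm k u (s \<^bold>\<cdot> t) = inst_tm k u s \<^bold>\<cdot> inst_tm k u t"
| "inst_tm k u (Tup s t) = Tup (inst_tm k u s) (inst_tm k u t)"
| "inst_tm k u (Proj1 t) = Proj1 (inst_tm k u t)"
| "inst_tm k u (Proj2 t) = Proj2 (inst_tm k u t)"
| "inst_tm k u Zero = Zero"
| "inst_tm k u (Succ t) = Succ (inst_tm k u t)"
| "inst_tm k u (Rec a f n) = Rec (inst_tm k u a) (inst_tm k u f) (inst_tm k u n)"

primrec inst :: "nat \<Rightarrow> tm \<Rightarrow> fm \<Rightarrow> fm" where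
  "inst k u (s \<^bold>= t) = (inst_tm k u s \<^bold>= inst_tm k u t)"
| "inst k u Bot = Bot"
| "inst k u (\<phi> \<^bold>\<and> \<psi>) = (inst k u \<phi> \<^bold>\<and> inst k u \<psi>)"
| "inst k u (\<phi> \<^bold>\<or> \<psi>) = (inst k u \<phi> \<^bold>\<or> inst k u \<psi>)"
| "inst k u (\<phi> \<^bold>\<longrightarrow> \<psi>) = (inst k u \<phi> \<^bold>\<longrightarrow> inst k u \<psi>)"
| "inst k u (All \<sigma> \<phi>) = All \<sigma> (inst (Suc k) u \<phi>)"
| "inst k u (Ex \<sigma> \<phi>) = Ex \<sigma> (inst (Suc k) u \<phi>)"

primrec bind_tm :: "nat \<Rightarrow> string \<Rightarrow> ty \<Rightarrow> tm \<Rightarrow> tm" where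
  "bind_tm k x \<sigma> (Bound i) = Bound i"
| "bind_tm k x \<sigma> (Par y \<tau>) = (if y = x \<and> \<tau> = \<sigma> then Bound k else Par y \<tau>)"
| "bind_tm k x \<sigma> (Lam \<tau> t) = Lam \<tau> (bind_tm (Suc k) x \<sigma> t)"
| "bind_tm k x \<sigma> (s \<^bold>\<cdot> t) = bind_tm k x \<sigma> s \<^bold>\<cdot> bind_tm k x \<sigma> t"
| "bind_tm k x \<sigma> (Tup s t) = Tup (bind_tm k x \<sigma> s) (bind_tm k x \<sigma> t)"
| "bind_tm k x \<sigma> (Proj1 t) = Proj1 (bind_tm k x \<sigma> t)"
| "bind_tm k x \<sigma> (Proj2 t) = Proj2 (bind_tm k x \<sigma> t)"
| "bind_tm k x \<sigma> Zero = Zero"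
| "bind_tm k x \<sigma> (Succ t) = Succ (bind_tm k x \<sigma> t)"
| "bind_tm k x \<sigma> (Rec a f n) = Rec (bind_tm k x \<sigma> a) (bind_tm k x \<sigma> f) (bind_tm k x \<sigma> n)"

primrec bind :: "nat \<Rightarrow> string \<Rightarrow> ty \<Rightarrow> fm \<Rightarrow> fm" where
  "bind k x \<sigma> (s \<^bold>= t) = (bind_tm k x \<sigma> s \<^bold>= bind_tm k x \<sigma> t)"
| "bind k x \<sigma> Bot = Bot"
| "bind k x \<sigma> (\<phi> \<^bold>\<and> \<psi>) = (bind k x \<sigma> \<phi> \<^bold>\<and> bind k x \<sigma> \<psi>)"
| "bind k x \<sigma> (\<phi> \<^bold>\<or> \<psi>) = (bind k x \<sigma> \<phi> \<^bold>\<or> bind k x \<sigma> \<psi>)"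
| "bind k x \<sigma> (\<phi> \<^bold>\<longrightarrow> \<psi>) = (bind k x \<sigma> \<phi> \<^bold>\<longrightarrow> bind k x \<sigma> \<psi>)"
| "bind k x \<sigma> (All \<tau> \<phi>) = All \<tau> (bind (Suc k) x \<sigma> \<phi>)"
| "bind k x \<sigma> (Ex \<tau> \<phi>) = Ex \<tau> (bind (Suc k) x \<sigma> \<phi>)"

text \<open>
  Quantification over a named variable, written \<open>all ''x'' \<sigma> (\<lambda>x. \<phi> x)\<close>.  Nested uses must have
  different names, since \<open>\<phi>\<close> receives the free variable \<open>Par ''x'' \<sigma>\<close> before it is bound.
\<close>

definition all :: "string \<Rightarrow> ty \<Rightarrow> (tm \<Rightarrow> fm) \<Rightarrow> fm" where
  "all x \<sigma> \<phi> = All \<sigma> (bind 0 x \<sigma> (\<phi> (Par x \<sigma>)))"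

definition ex :: "string \<Rightarrow> ty \<Rightarrow> (tm \<Rightarrow> fm) \<Rightarrow> fm" where
  "ex x \<sigma> \<phi> = Ex \<sigma> (bind 0 x \<sigma> (\<phi> (Par x \<sigma>)))"


subsection \<open>Intuitionistic derivability\<close>

definition fresh :: "string \<Rightarrow> ty \<Rightarrow> fm set \<Rightarrow> bool" where
  "fresh x \<sigma> H \<longleftrightarrow> (\<forall>\<phi>\<in>H. (x, \<sigma>) \<notin> pars \<phi>)"

inductive derives :: "fm set \<Rightarrow> fm \<Rightarrow> bool"  (infix \<open>\<^bold>\<turnstile>\<close> 20) where
  hyp: "\<phi> \<in> H \<Longrightarrow> wf_fm [] \<phi> \<Longrightarrow> H \<^bold>\<turnstile> \<phi>"
| impI: "insert \<phi> H \<^bold>\<turnstile> \<psi> \<Longrightarrow> wf_fm [] \<phi> \<Longrightarrow> H \<^bold>\<turnstile> \<phi> \<^bold>\<longrightarrow> \<psi>"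
| impE: "H \<^bold>\<turnstile> \<phi> \<^bold>\<longrightarrow> \<psi> \<Longrightarrow> H \<^bold>\<turnstile> \<phi> \<Longrightarrow> H \<^bold>\<turnstile> \<psi>"
| conjI: "H \<^bold>\<turnstile> \<phi> \<Longrightarrow> H \<^bold>\<turnstile> \<psi> \<Longrightarrow> H \<^bold>\<turnstile> \<phi> \<^bold>\<and> \<psi>"
| conjE1: "H \<^bold>\<turnstile> \<phi> \<^bold>\<and> \<psi> \<Longrightarrow> H \<^bold>\<turnstile> \<phi>"
| conjE2: "H \<^bold>\<turnstile> \<phi> \<^bold>\<and> \<psi> \<Longrightarrow> H \<^bold>\<turnstile> \<psi>"
| disjI1: "H \<^bold>\<turnstile> \<phi> \<Longrightarrow> wf_fm [] \<psi> \<Longrightarrow> H \<^bold>\<turnstile> \<phi> \<^bold>\<or> \<psi>"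
| disjI2: "H \<^bold>\<turnstile> \<psi> \<Longrightarrow> wf_fm [] \<phi> \<Longrightarrow> H \<^bold>\<turnstile> \<phi> \<^bold>\<or> \<psi>"
| disjE: "H \<^bold>\<turnstile> \<phi> \<^bold>\<or> \<psi> \<Longrightarrow> insert \<phi> H \<^bold>\<turnstile> \<chi> \<Longrightarrow> insert \<psi> H \<^bold>\<turnstile> \<chi> \<Longrightarrow> H \<^bold>\<turnstile> \<chi>"
| botE: "H \<^bold>\<turnstile> Bot \<Longrightarrow> wf_fm [] \<phi> \<Longrightarrow> H \<^bold>\<turnstile> \<phi>"
| allI: "H \<^bold>\<turnstile> inst 0 (Par x \<sigma>) \<phi> \<Longrightarrow> fresh x \<sigma> (insert \<phi> H) \<Longrightarrow> wf_fm [\<sigma>] \<phi> \<Longrightarrow> H \<^bold>\<turnstile> All \<sigma> \<phi>"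
| allE: "H \<^bold>\<turnstile> All \<sigma> \<phi> \<Longrightarrow> has_type [] t \<sigma> \<Longrightarrow> H \<^bold>\<turnstile> inst 0 t \<phi>"
| exI: "H \<^bold>\<turnstile> inst 0 t \<phi> \<Longrightarrow> has_type [] t \<sigma> \<Longrightarrow> wf_fm [\<sigma>] \<phi> \<Longrightarrow> H \<^bold>\<turnstile> Ex \<sigma> \<phi>"
| exE: "H \<^bold>\<turnstile> Ex \<sigma> \<phi> \<Longrightarrow> insert (inst 0 (Par x \<sigma>) \<phi>) H \<^bold>\<turnstile> \<psi> \<Longrightarrow> fresh x \<sigma> (insert \<phi> (insert \<psi> H))
    \<Longrightarrow> H \<^bold>\<turnstile> \<psi>"
| eq_refl: "has_type [] t \<sigma> \<Longrightarrow> H \<^bold>\<turnstile> t \<^bold>= t"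
| eq_subst: "H \<^bold>\<turnstile> t \<^bold>= u \<Longrightarrow> H \<^bold>\<turnstile> inst 0 t \<phi> \<Longrightarrow> has_type [] t \<sigma> \<Longrightarrow> wf_fm [\<sigma>] \<phi> \<Longrightarrow> H \<^bold>\<turnstile> inst 0 u \<phi>"
| beta: "has_type [\<sigma>] t \<tau> \<Longrightarrow> has_type [] u \<sigma> \<Longrightarrow> H \<^bold>\<turnstile> Lam \<sigma> t \<^bold>\<cdot> u \<^bold>= inst_tm 0 u t"
| ext: "H \<^bold>\<turnstile> All \<sigma> (f \<^bold>\<cdot> Bound 0 \<^bold>= g \<^bold>\<cdot> Bound 0) \<Longrightarrow> has_type [] f (\<sigma> \<^bold>\<rightarrow> \<tau>)
    \<Longrightarrow> has_type [] g (\<sigma> \<^bold>\<rightarrow> \<tau>) \<Longrightarrow> H \<^bold>\<turnstile> f \<^bold>= g"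
| proj1: "has_type [] t \<sigma> \<Longrightarrow> has_type [] u \<tau> \<Longrightarrow> H \<^bold>\<turnstile> Proj1 (Tup t u) \<^bold>= t"
| proj2: "has_type [] t \<sigma> \<Longrightarrow> has_type [] u \<tau> \<Longrightarrow> H \<^bold>\<turnstile> Proj2 (Tup t u) \<^bold>= u"
| surj_pair: "has_type [] t (\<sigma> \<^bold>\<times> \<tau>) \<Longrightarrow> H \<^bold>\<turnstile> Tup (Proj1 t) (Proj2 t) \<^bold>= t"
| rec_zero: "has_type [] a \<sigma> \<Longrightarrow> has_type [] f (NatT \<^bold>\<rightarrow> \<sigma> \<^bold>\<rightarrow> \<sigma>) \<Longrightarrow> H \<^bold>\<turnstile> Rec a f Zero \<^bold>= a"
| rec_succ: "has_type [] a \<sigma> \<Longrightarrow> has_type [] f (NatT \<^bold>\<rightarrow> \<sigma> \<^bold>\<rightarrow> \<sigma>) \<Longrightarrow> has_type [] n NatT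
    \<Longrightarrow> H \<^bold>\<turnstile> Rec a f (Succ n) \<^bold>= f \<^bold>\<cdot> n \<^bold>\<cdot> Rec a f n"
| succ_inj: "H \<^bold>\<turnstile> Succ m \<^bold>= Succ n \<Longrightarrow> H \<^bold>\<turnstile> m \<^bold>= n"
| succ_not_zero: "H \<^bold>\<turnstile> Succ n \<^bold>= Zero \<Longrightarrow> H \<^bold>\<turnstile> Bot"
| nat_ind: "H \<^bold>\<turnstile> inst 0 Zero \<phi> \<Longrightarrow>
    insert (inst 0 (Par x NatT) \<phi>) H \<^bold>\<turnstile> inst 0 (Succ (Par x NatT)) \<phi> \<Longrightarrow>
    fresh x NatT (insert \<phi> H) \<Longrightarrow> wf_fm [NatT] \<phi> \<Longrightarrow> H \<^bold>\<turnstile> All NatT \<phi>"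


subsection \<open>Natural numbers\<close>

definition add :: "tm \<Rightarrow> tm \<Rightarrow> tm"  (infixl \<open>\<^bold>+\<close> 65) where
  "add s t = Lam NatT (Lam NatT
     (Rec (Bound 1) (Lam NatT (Lam NatT (Succ (Bound 0)))) (Bound 0))) \<^bold>\<cdot> s \<^bold>\<cdot> t"

definition mult :: "tm \<Rightarrow> tm \<Rightarrow> tm"  (infixl \<open>\<^bold>*\<close> 70) where
  "mult s t = Lam NatT (Lam NatT
     (Rec Zero (Lam NatT (Lam NatT (Bound 0 \<^bold>+ Bound 3))) (Bound 0))) \<^bold>\<cdot> s \<^bold>\<cdot> t"

definition pred :: "tm \<Rightarrow> tm" where
  "pred t = Lam NatT (Rec Zero (Lam NatT (Lam NatT (Bound 1))) (Bound 0)) \<^bold>\<cdot> t"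

text \<open>Truncated subtraction.\<close>

definition monus :: "tm \<Rightarrow> tm \<Rightarrow> tm"  (infixl \<open>\<^bold>-\<close> 65) where
  "monus s t = Lam NatT (Lam NatT
     (Rec (Bound 1) (Lam NatT (Lam NatT (pred (Bound 0)))) (Bound 0))) \<^bold>\<cdot> s \<^bold>\<cdot> t"

definition le :: "tm \<Rightarrow> tm \<Rightarrow> fm"  (infix \<open>\<^bold>\<le>\<close> 50) where
  "le s t = (s \<^bold>- t \<^bold>= Zero)"

definition lt :: "tm \<Rightarrow> tm \<Rightarrow> fm"  (infix \<open>\<^bold><\<close> 50) where
  "lt s t = (Succ s \<^bold>\<le> t)"


subsection \<open>Rational numbers\<close>

text \<open>
  The triple \<open>(a, (b, c))\<close> stands for the rational number \<open>(a - b) / (c + 1)\<close>.  Different triples may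
  stand for the same number; the order below does not distinguish them.
\<close>

definition RatT :: ty where
  "RatT = NatT \<^bold>\<times> NatT \<^bold>\<times> NatT"

definition pnum :: "tm \<Rightarrow> tm" where "pnum p = Proj1 p"
definition nnum :: "tm \<Rightarrow> tm" where "nnum p = Proj1 (Proj2 p)"
definition dpred :: "tm \<Rightarrow> tm" where "dpred p = Proj2 (Proj2 p)"
definition den :: "tm \<Rightarrow> tm" where "den p = Succ (dpred p)"

definition q_le :: "tm \<Rightarrow> tm \<Rightarrow> fm" where
  "q_le p q = (pnum p \<^bold>* den q \<^bold>+ nnum q \<^bold>* den p \<^bold>\<le> pnum q \<^bold>* den p \<^bold>+ nnum p \<^bold>* den q)"

definition q_lt :: "tm \<Rightarrow> tm \<Rightarrow> fm" where
  "q_lt p q = (pnum p \<^bold>* den q \<^bold>+ nnum q \<^bold>* den p \<^bold>< pnum q \<^bold>* den p \<^bold>+ nnum p \<^bold>* den q)"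

definition q_zero :: tm where
  "q_zero = Tup Zero (Tup Zero Zero)"

text \<open>The last component satisfies \<open>(c + 1) * c' + c + 1 = (c + 1) * (c' + 1)\<close>.\<close>

definition q_add :: "tm \<Rightarrow> tm \<Rightarrow> tm" where
  "q_add p q = Tup (pnum p \<^bold>* den q \<^bold>+ pnum q \<^bold>* den p)
     (Tup (nnum p \<^bold>* den q \<^bold>+ nnum q \<^bold>* den p) (den p \<^bold>* dpred q \<^bold>+ dpred p))"

definition q_neg :: "tm \<Rightarrow> tm" where
  "q_neg p = Tup (nnum p) (Tup (pnum p) (dpred p))"

definition q_sub :: "tm \<Rightarrow> tm \<Rightarrow> tm" where
  "q_sub p q = q_add p (q_neg q)"

definition q_abs :: "tm \<Rightarrow> tm" where
  "q_abs p = Tup ((pnum p \<^bold>- nnum p) \<^bold>+ (nnum p \<^bold>- pnum p)) (Tup Zero (dpred p))"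

text \<open>The rational number \<open>1 / (k + 1)\<close>.\<close>

definition q_inv :: "tm \<Rightarrow> tm" where
  "q_inv k = Tup (Succ Zero) (Tup Zero k)"


subsection \<open>Real numbers\<close>

text \<open>
  Real numbers are Bishop's regular sequences of rational numbers, \<open>|x\<^sub>m - x\<^sub>n| \<le> 1/m + 1/n\<close> for all
  positive integers \<open>m\<close>, \<open>n\<close>.  Here and below a sequence \<open>(s\<^sub>n)\<close> indexed by the positive integers
  is a function on \<open>NatT\<close> whose value at \<open>k\<close> is the term with index \<open>n = k + 1\<close>.

  The formulas in this subsection place their arguments under quantifiers without lifting, so the
  arguments must have no dangling indices.
\<close>

definition RealT :: ty where
  "RealT = NatT \<^bold>\<rightarrow> RatT"

definition is_real :: "tm \<Rightarrow> fm" where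
  "is_real x = All NatT (All NatT (q_le (q_abs (q_sub (x \<^bold>\<cdot> Bound 1) (x \<^bold>\<cdot> Bound 0)))
     (q_add (q_inv (Bound 1)) (q_inv (Bound 0)))))"

text \<open>\<open>x\<close> is positive if \<open>x\<^sub>n > 1/n\<close> for some \<open>n\<close>, and nonnegative if \<open>x\<^sub>n \<ge> -1/n\<close> for all \<open>n\<close>.\<close>

definition r_pos :: "tm \<Rightarrow> fm" where
  "r_pos x = Ex NatT (q_lt (q_inv (Bound 0)) (x \<^bold>\<cdot> Bound 0))"

definition r_nonneg :: "tm \<Rightarrow> fm" where
  "r_nonneg x = All NatT (q_le (q_neg (q_inv (Bound 0))) (x \<^bold>\<cdot> Bound 0))"

definition r_zero :: tm where
  "r_zero = Lam NatT q_zero"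

text \<open>
  \<open>(x - y)\<^sub>n = x\<^sub>2\<^sub>n - y\<^sub>2\<^sub>n\<close>.  If \<open>k\<close> represents the index \<open>n = k + 1\<close> then \<open>2 * k + 1\<close> represents \<open>2 * n\<close>.
\<close>

definition r_sub :: "tm \<Rightarrow> tm \<Rightarrow> tm" where
  "r_sub x y = Lam RealT (Lam RealT (Lam NatT
     (q_sub (Bound 2 \<^bold>\<cdot> Succ (Bound 0 \<^bold>+ Bound 0)) (Bound 1 \<^bold>\<cdot> Succ (Bound 0 \<^bold>+ Bound 0))))) \<^bold>\<cdot> x \<^bold>\<cdot> y"

definition r_abs :: "tm \<Rightarrow> tm" where
  "r_abs x = Lam RealT (Lam NatT (q_abs (Bound 1 \<^bold>\<cdot> Bound 0))) \<^bold>\<cdot> x"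

definition r_lt :: "tm \<Rightarrow> tm \<Rightarrow> fm" where
  "r_lt x y = r_pos (r_sub y x)"

definition r_le :: "tm \<Rightarrow> tm \<Rightarrow> fm" where
  "r_le x y = r_nonneg (r_sub y x)"


subsection \<open>Sequences of real numbers and the two principles\<close>

definition SeqT :: ty where
  "SeqT = NatT \<^bold>\<rightarrow> RealT"

definition is_real_seq :: "tm \<Rightarrow> fm" where
  "is_real_seq x = all ''n'' NatT (\<lambda>n. is_real (x \<^bold>\<cdot> n))"

definition decreasing :: "tm \<Rightarrow> fm" where
  "decreasing x = all ''n'' NatT (\<lambda>n. r_le (x \<^bold>\<cdot> Succ n) (x \<^bold>\<cdot> n))"

definition nonneg_seq :: "tm \<Rightarrow> fm" where
  "nonneg_seq x = all ''n'' NatT (\<lambda>n. r_nonneg (x \<^bold>\<cdot> n))"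

definition strictly_increasing :: "tm \<Rightarrow> fm" where
  "strictly_increasing \<nu> = all ''j'' NatT (\<lambda>j. \<nu> \<^bold>\<cdot> j \<^bold>< \<nu> \<^bold>\<cdot> Succ j)"

definition infinitely_often_gt :: "tm \<Rightarrow> tm \<Rightarrow> fm" where
  "infinitely_often_gt x \<epsilon> = ex ''nu'' (NatT \<^bold>\<rightarrow> NatT) (\<lambda>\<nu>.
     strictly_increasing \<nu> \<^bold>\<and> all ''k'' NatT (\<lambda>k. r_lt \<epsilon> (r_abs (x \<^bold>\<cdot> (\<nu> \<^bold>\<cdot> k)))))"

definition negatively_convergent_zero :: "tm \<Rightarrow> fm" where
  "negatively_convergent_zero x = all ''eps'' RealT (\<lambda>\<epsilon>.
     is_real \<epsilon> \<^bold>\<longrightarrow> r_pos \<epsilon> \<^bold>\<longrightarrow> \<^bold>\<not> infinitely_often_gt x \<epsilon>)"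

definition converges_to :: "tm \<Rightarrow> tm \<Rightarrow> fm" where
  "converges_to x l = all ''eps'' RealT (\<lambda>\<epsilon>. is_real \<epsilon> \<^bold>\<longrightarrow> r_pos \<epsilon> \<^bold>\<longrightarrow>
     ex ''N'' NatT (\<lambda>N. all ''n'' NatT (\<lambda>n. N \<^bold>\<le> n \<^bold>\<longrightarrow> r_le (r_abs (r_sub (x \<^bold>\<cdot> n) l)) \<epsilon>)))"

definition binary :: "tm \<Rightarrow> fm" where
  "binary a = all ''n'' NatT (\<lambda>n. a \<^bold>\<cdot> n \<^bold>= Zero \<^bold>\<or> a \<^bold>\<cdot> n \<^bold>= Succ Zero)"

definition Markov_principle :: fm where
  "Markov_principle = all ''a'' (NatT \<^bold>\<rightarrow> NatT) (\<lambda>a. binary a \<^bold>\<longrightarrow>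
     \<^bold>\<not> all ''n'' NatT (\<lambda>n. a \<^bold>\<cdot> n \<^bold>= Zero) \<^bold>\<longrightarrow> ex ''n'' NatT (\<lambda>n. a \<^bold>\<cdot> n \<^bold>= Succ Zero))"

definition Decreasing_convergence :: fm where
  "Decreasing_convergence = all ''x'' SeqT (\<lambda>x.
     is_real_seq x \<^bold>\<longrightarrow> nonneg_seq x \<^bold>\<longrightarrow> decreasing x \<^bold>\<longrightarrow> negatively_convergent_zero x \<^bold>\<longrightarrow>
     converges_to x r_zero)"

inductive_simps has_type_simps:
  "has_type \<Gamma> (Bound i) \<tau>"
  "has_type \<Gamma> (Par x \<sigma>) \<tau>"
  "has_type \<Gamma> (Lam \<sigma> t) \<tau>"
  "has_type \<Gamma> (t \<^bold>\<cdot> u) \<tau>"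
  "has_type \<Gamma> (Tup t u) \<tau>"
  "has_type \<Gamma> (Proj1 t) \<tau>"
  "has_type \<Gamma> (Proj2 t) \<tau>"
  "has_type \<Gamma> Zero \<tau>"
  "has_type \<Gamma> (Succ t) \<tau>"
  "has_type \<Gamma> (Rec a f n) \<tau>"

lemmas nat_defs = add_def mult_def pred_def monus_def le_def lt_def

lemmas rat_defs = RatT_def pnum_def nnum_def dpred_def den_def q_le_def q_lt_def q_zero_def
  q_add_def q_neg_def q_sub_def q_abs_def q_inv_def

lemmas real_defs = RealT_def is_real_def r_pos_def r_nonneg_def r_zero_def r_sub_def r_abs_def
  r_lt_def r_le_def

lemmas seq_defs = SeqT_def is_real_seq_def decreasing_def nonneg_seq_def strictly_increasing_def
  infinitely_often_gt_def negatively_convergent_zero_def converges_to_def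

lemma bind_tm_arith:
  "bind_tm k x \<sigma> (s \<^bold>+ t) = bind_tm k x \<sigma> s \<^bold>+ bind_tm k x \<sigma> t"
  "bind_tm k x \<sigma> (s \<^bold>* t) = bind_tm k x \<sigma> s \<^bold>* bind_tm k x \<sigma> t"
  "bind_tm k x \<sigma> (s \<^bold>- t) = bind_tm k x \<sigma> s \<^bold>- bind_tm k x \<sigma> t"
  by (simp_all add: nat_defs)

lemma pars_tm_arith:
  "pars_tm (s \<^bold>+ t) = pars_tm s \<union> pars_tm t"
  "pars_tm (s \<^bold>* t) = pars_tm s \<union> pars_tm t"
  "pars_tm (s \<^bold>- t) = pars_tm s \<union> pars_tm t"
  by (simp_all add: nat_defs)

lemma has_type_arith:
  "has_type \<Gamma> (s \<^bold>+ t) \<tau> \<longleftrightarrow> \<tau> = NatT \<and> has_type \<Gamma> s NatT \<and> has_type \<Gamma> t NatT"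
  "has_type \<Gamma> (s \<^bold>* t) \<tau> \<longleftrightarrow> \<tau> = NatT \<and> has_type \<Gamma> s NatT \<and> has_type \<Gamma> t NatT"
  "has_type \<Gamma> (s \<^bold>- t) \<tau> \<longleftrightarrow> \<tau> = NatT \<and> has_type \<Gamma> s NatT \<and> has_type \<Gamma> t NatT"
  by (auto simp: nat_defs has_type_simps)

lemma sentence_Markov_principle: "sentence Markov_principle"
  by (simp add: sentence_def Markov_principle_def binary_def all_def ex_def Neg_def has_type_simps)

lemma sentence_Decreasing_convergence: "sentence Decreasing_convergence"
  by (simp add: sentence_def Decreasing_convergence_def seq_defs real_defs rat_defs le_def lt_def
      all_def ex_def Neg_def has_type_simps has_type_arith bind_tm_arith pars_tm_arith)

end

theory Submission
  imports Defs
begin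

text \<open>
  Indices are those of the definitions: the number \<open>k\<close> stands for the positive integer \<open>k + 1\<close>.  So
  \<open>Inv k\<close> below is the rational \<open>1 / (k + 1)\<close>, and \<open>dbl k = 2 * k + 1\<close> satisfies \<open>Inv k = 2 * Inv (dbl k)\<close>.

  From Markov's principle to convergence.  Let \<open>x\<close> be decreasing, nonnegative and negatively
  convergent to 0, and let \<open>\<epsilon>\<close> be a positive real.  Positivity gives an index \<open>l\<close> for which the
  rational \<open>c = \<epsilon>\<^sub>l - Inv l\<close> is positive, and regularity makes \<open>c\<close> a lower bound of \<open>\<epsilon>\<close>.  Fix one index
  \<open>m\<close> whose precision is fine compared with \<open>c\<close>.  The comparison of the rational \<open>x\<^sub>n\<^sub>m + Inv m\<close> with \<open>c\<close> is
  decidable, so a term of the theory defines a binary sequence with \<open>a\<^sub>n = 1\<close> if and only if \<open>x\<^sub>n\<^sub>m + Inv m \<le> c\<close>;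
  as \<open>m\<close> is the same for all \<open>n\<close>, no choice is involved.  If all \<open>a\<^sub>n\<close> were 0, then all \<open>\<bar>x\<^sub>n\<bar>\<close> would exceed
  a fixed positive rational, against negative convergence for the identity as the subsequence.
  Hence Markov's principle yields \<open>n\<close> with \<open>x\<^sub>n \<le> c\<close> (\<open>Markov_small_term\<close>).  Monotonicity keeps
  later terms below \<open>c\<close> (\<open>decreasing_bound\<close>), and therefore below \<open>\<epsilon>\<close>.

  From convergence to Markov's principle.  Given a binary sequence \<open>a\<close>, let \<open>x\<^sub>n\<close> be 1 as long as no
  1 has occurred among the \<open>a\<^sub>i\<close> with \<open>i < n\<close>, and 0 afterwards.  If \<open>x\<close> exceeded a positive number
  along a subsequence, then it would be 1 throughout, so \<open>a\<close> would vanish; when this is impossible,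
  \<open>x\<close> is negatively convergent (\<open>flag_seq_neg_conv\<close>).  Convergence then gives \<open>m\<close> with \<open>x\<^sub>m < 1\<close>, that is
  \<open>x\<^sub>m = 0\<close>, and a bounded search finds a 1 (\<open>flag_zero_imp_one\<close>).

  The derivations are not written out rule by rule.  First, derivability from a growing set of
  hypotheses behaves like forcing in a Kripke model whose worlds are the sets of hypotheses:
  implication and universal quantification are characterised by conditions on all extensions
  (\<open>imp_iff\<close>, \<open>all_iff\<close>), while disjunction and existence have elimination rules.  What makes
  this work is weakening (\<open>weaken\<close>).  Secondly, terms modulo provable equality form algebraic
  structures in which the simplifier can calculate: number terms form a commutative semiring and
  rational terms an abelian group.  In each world the rationals that are provably nonnegative form a
  cone in this group.  An inequality then follows from others as soon as it is a sum of them, which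
  is an identity in an abelian group.
\<close>

section \<open>Typing as a function\<close>

text \<open>
  The typing relation is functional, and a computable form lets the simplifier discharge all typing
  conditions: the type of a compound term is evaluated from the types of its variables.
\<close>

primrec ty_of :: "tm \<Rightarrow> ty list \<Rightarrow> ty option" where
  "ty_of (Bound i) \<Gamma> = (if i < length \<Gamma> then Some (\<Gamma> ! i) else None)"
| "ty_of (Par x \<sigma>) \<Gamma> = Some \<sigma>"
| "ty_of (Lam \<sigma> t) \<Gamma> = (case ty_of t (\<sigma> # \<Gamma>) of Some \<tau> \<Rightarrow> Some (\<sigma> \<^bold>\<rightarrow> \<tau>) | None \<Rightarrow> None)"
| "ty_of (t \<^bold>\<cdot> u) \<Gamma> = (case ty_of t \<Gamma> of
      Some (\<sigma> \<^bold>\<rightarrow> \<tau>) \<Rightarrow> (if ty_of u \<Gamma> = Some \<sigma> then Some \<tau> else None) | _ \<Rightarrow> None)"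
| "ty_of (Tup t u) \<Gamma> = (case ty_of t \<Gamma> of
      Some \<sigma> \<Rightarrow> (case ty_of u \<Gamma> of Some \<tau> \<Rightarrow> Some (\<sigma> \<^bold>\<times> \<tau>) | None \<Rightarrow> None) | None \<Rightarrow> None)"
| "ty_of (Proj1 t) \<Gamma> = (case ty_of t \<Gamma> of Some (\<sigma> \<^bold>\<times> \<tau>) \<Rightarrow> Some \<sigma> | _ \<Rightarrow> None)"
| "ty_of (Proj2 t) \<Gamma> = (case ty_of t \<Gamma> of Some (\<sigma> \<^bold>\<times> \<tau>) \<Rightarrow> Some \<tau> | _ \<Rightarrow> None)"
| "ty_of Zero \<Gamma> = Some NatT"
| "ty_of (Succ t) \<Gamma> = (if ty_of t \<Gamma> = Some NatT then Some NatT else None)"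
| "ty_of (Rec a f n) \<Gamma> = (case ty_of a \<Gamma> of
      Some \<sigma> \<Rightarrow> (if ty_of f \<Gamma> = Some (NatT \<^bold>\<rightarrow> \<sigma> \<^bold>\<rightarrow> \<sigma>) \<and> ty_of n \<Gamma> = Some NatT then Some \<sigma> else None)
    | None \<Rightarrow> None)"

lemma has_type_iff: "has_type \<Gamma> t \<sigma> \<longleftrightarrow> ty_of t \<Gamma> = Some \<sigma>"
proof
  show "has_type \<Gamma> t \<sigma> \<Longrightarrow> ty_of t \<Gamma> = Some \<sigma>"
    by (induction rule: has_type.induct) auto
  show "ty_of t \<Gamma> = Some \<sigma> \<Longrightarrow> has_type \<Gamma> t \<sigma>"
    by (induction t arbitrary: \<Gamma> \<sigma>)
      (fastforce split: option.splits if_splits ty.splits intro: has_type.intros)+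
qed

lemma ty_of_append: "ty_of t \<Gamma> = Some \<sigma> \<Longrightarrow> ty_of t (\<Gamma> @ \<Delta>) = Some \<sigma>"
proof (induction t arbitrary: \<Gamma> \<sigma>)
  case (Lam \<tau> t)
  then show ?case
    by (auto split: option.splits) (metis append_Cons option.distinct(1) option.inject)+
qed (auto simp: nth_append split: option.splits if_splits ty.splits | fastforce)+

lemma ty_of_Cons [simp]: "ty_of t [] = Some \<sigma> \<Longrightarrow> ty_of t (\<tau> # \<Gamma>) = Some \<sigma>"
  using ty_of_append[of t "[]" \<sigma> "\<tau> # \<Gamma>"] by simp

lemma inst_tm_ty_of: "ty_of t \<Gamma> = Some \<sigma> \<Longrightarrow> length \<Gamma> \<le> k \<Longrightarrow> inst_tm k u t = t"
  by (induction t arbitrary: \<Gamma> \<sigma> k) (force split: option.splits if_splits ty.splits)+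

text \<open>
  Typed in the empty context, a term has no dangling index for an instantiation to hit.
\<close>

lemma inst_tm_closed [simp]: "ty_of t [] \<noteq> None \<Longrightarrow> inst_tm k u t = t"
  using inst_tm_ty_of[of t "[]"] by auto

section \<open>Renaming of parameters and weakening\<close>

text \<open>
  A derivation cannot simply be repeated under more hypotheses, because these may mention its
  eigenvariables.  Weakening is therefore proved together with arbitrary, not necessarily injective,
  renamings of parameters: they let each eigenvariable move out of the way.
\<close>

primrec ren_tm :: "(string \<times> ty \<Rightarrow> string) \<Rightarrow> tm \<Rightarrow> tm" where
  "ren_tm \<rho> (Bound i) = Bound i"
| "ren_tm \<rho> (Par x \<sigma>) = Par (\<rho> (x, \<sigma>)) \<sigma>"
| "ren_tm \<rho> (Lam \<sigma> t) = Lam \<sigma> (ren_tm \<rho> t)"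
| "ren_tm \<rho> (s \<^bold>\<cdot> t) = ren_tm \<rho> s \<^bold>\<cdot> ren_tm \<rho> t"
| "ren_tm \<rho> (Tup s t) = Tup (ren_tm \<rho> s) (ren_tm \<rho> t)"
| "ren_tm \<rho> (Proj1 t) = Proj1 (ren_tm \<rho> t)"
| "ren_tm \<rho> (Proj2 t) = Proj2 (ren_tm \<rho> t)"
| "ren_tm \<rho> Zero = Zero"
| "ren_tm \<rho> (Succ t) = Succ (ren_tm \<rho> t)"
| "ren_tm \<rho> (Rec a f n) = Rec (ren_tm \<rho> a) (ren_tm \<rho> f) (ren_tm \<rho> n)"

primrec ren :: "(string \<times> ty \<Rightarrow> string) \<Rightarrow> fm \<Rightarrow> fm" where
  "ren \<rho> (s \<^bold>= t) = (ren_tm \<rho> s \<^bold>= ren_tm \<rho> t)"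
| "ren \<rho> Bot = Bot"
| "ren \<rho> (\<phi> \<^bold>\<and> \<psi>) = (ren \<rho> \<phi> \<^bold>\<and> ren \<rho> \<psi>)"
| "ren \<rho> (\<phi> \<^bold>\<or> \<psi>) = (ren \<rho> \<phi> \<^bold>\<or> ren \<rho> \<psi>)"
| "ren \<rho> (\<phi> \<^bold>\<longrightarrow> \<psi>) = (ren \<rho> \<phi> \<^bold>\<longrightarrow> ren \<rho> \<psi>)"
| "ren \<rho> (All \<tau> \<phi>) = All \<tau> (ren \<rho> \<phi>)"
| "ren \<rho> (Ex \<tau> \<phi>) = Ex \<tau> (ren \<rho> \<phi>)"

lemma ren_inst_tm [simp]: "ren_tm \<rho> (inst_tm k u t) = inst_tm k (ren_tm \<rho> u) (ren_tm \<rho> t)"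
  by (induction t arbitrary: k) auto

lemma ren_inst [simp]: "ren \<rho> (inst k u \<phi>) = inst k (ren_tm \<rho> u) (ren \<rho> \<phi>)"
  by (induction \<phi> arbitrary: k) auto

lemma ty_of_ren [simp]: "ty_of (ren_tm \<rho> t) \<Gamma> = ty_of t \<Gamma>"
  by (induction t arbitrary: \<Gamma>) (auto split: option.splits ty.splits)

lemma wf_fm_ren [simp]: "wf_fm \<Gamma> (ren \<rho> \<phi>) = wf_fm \<Gamma> \<phi>"
  by (induction \<phi> arbitrary: \<Gamma>) (auto simp: has_type_iff)

lemma ren_tm_cong: "(\<And>p. p \<in> pars_tm t \<Longrightarrow> \<rho> p = \<rho>' p) \<Longrightarrow> ren_tm \<rho> t = ren_tm \<rho>' t"
  by (induction t) auto

lemma ren_cong: "(\<And>p. p \<in> pars \<phi> \<Longrightarrow> \<rho> p = \<rho>' p) \<Longrightarrow> ren \<rho> \<phi> = ren \<rho>' \<phi>"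
  by (induction \<phi>) (auto intro: ren_tm_cong)

lemma ren_upd: "(x, \<sigma>) \<notin> pars \<phi> \<Longrightarrow> ren (\<rho>((x, \<sigma>) := y)) \<phi> = ren \<rho> \<phi>"
  by (intro ren_cong) auto

lemma ren_tm_id [simp]: "ren_tm fst t = t"
  by (induction t) auto

lemma ren_id [simp]: "ren fst \<phi> = \<phi>"
  by (induction \<phi>) auto

lemma finite_pars_tm [simp]: "finite (pars_tm t)"
  by (induction t) auto

lemma finite_pars [simp]: "finite (pars \<phi>)"
  by (induction \<phi>) auto

text \<open>
  Finitely many parameters ensure that fresh ones exist; sets of sentences and their finite
  extensions have this property.
\<close>

definition good :: "fm set \<Rightarrow> bool" where
  "good H \<longleftrightarrow> finite (\<Union>\<phi>\<in>H. pars \<phi>)"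

lemma good_insert [simp]: "good (insert \<phi> H) = good H"
  by (simp add: good_def)

lemma good_empty [simp]: "good {}"
  by (simp add: good_def)

lemma good_fresh:
  assumes "good H"
  shows "\<exists>x. fresh x \<sigma> H"
proof -
  have "{x. \<exists>\<phi>\<in>H. (x, \<sigma>) \<in> pars \<phi>} \<subseteq> fst ` (\<Union>\<phi>\<in>H. pars \<phi>)"
    using image_iff by fastforce
  then have "finite {x. \<exists>\<phi>\<in>H. (x, \<sigma>) \<in> pars \<phi>}"
    using assms unfolding good_def by (rule finite_subset[OF _ finite_imageI])
  moreover have "infinite (UNIV :: string set)"
    by (rule infinite_UNIV_listI)
  ultimately obtain x where "x \<notin> {x. \<exists>\<phi>\<in>H. (x, \<sigma>) \<in> pars \<phi>}"
    using ex_new_if_finite by blast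
  then show ?thesis by (auto simp: fresh_def)
qed

lemma fresh_insert [simp]: "fresh x \<sigma> (insert \<phi> H) \<longleftrightarrow> (x, \<sigma>) \<notin> pars \<phi> \<and> fresh x \<sigma> H"
  by (auto simp: fresh_def)

lemma ren_image_fresh:
  "fresh x \<sigma> H \<Longrightarrow> ren (\<rho>((x, \<sigma>) := y)) ` H = ren \<rho> ` H"
  by (intro image_cong ren_upd) (auto simp: fresh_def)

text \<open>
  In the rules with an eigenvariable \<open>x\<close>, the renaming is changed at \<open>x\<close> to a name that is fresh for
  the new hypotheses; the other formulas of the rule do not notice the change.
\<close>

lemma derives_ren:
  "H \<^bold>\<turnstile> \<phi> \<Longrightarrow> ren \<rho> ` H \<subseteq> K \<Longrightarrow> good K \<Longrightarrow> K \<^bold>\<turnstile> ren \<rho> \<phi>"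
proof (induction arbitrary: \<rho> K rule: derives.induct)
  case (hyp \<phi> H)
  then show ?case by (auto intro!: derives.hyp)
next
  case (impI \<phi> H \<psi>)
  have "insert (ren \<rho> \<phi>) K \<^bold>\<turnstile> ren \<rho> \<psi>"
    using impI.prems by (intro impI.IH) auto
  then show ?case using impI.hyps by (auto intro: derives.impI)
next
  case (impE H \<phi> \<psi>)
  then show ?case by (metis derives.impE ren.simps(5))
next
  case (conjI H \<phi> \<psi>)
  then show ?case by (simp add: derives.conjI)
next
  case (conjE1 H \<phi> \<psi>)
  then show ?case by (metis derives.conjE1 ren.simps(3))
next
  case (conjE2 H \<phi> \<psi>)
  then show ?case by (metis derives.conjE2 ren.simps(3))
next
  case (disjI1 H \<phi> \<psi>)
  then show ?case by (simp add: derives.disjI1)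
next
  case (disjI2 H \<psi> \<phi>)
  then show ?case by (simp add: derives.disjI2)
next
  case (disjE H \<phi> \<psi> \<chi>)
  have "K \<^bold>\<turnstile> ren \<rho> \<phi> \<^bold>\<or> ren \<rho> \<psi>" using disjE.IH(1)[OF disjE.prems] by simp
  moreover have "insert (ren \<rho> \<phi>) K \<^bold>\<turnstile> ren \<rho> \<chi>"
    using disjE.prems by (intro disjE.IH(2)) auto
  moreover have "insert (ren \<rho> \<psi>) K \<^bold>\<turnstile> ren \<rho> \<chi>"
    using disjE.prems by (intro disjE.IH(3)) auto
  ultimately show ?case by (rule derives.disjE)
next
  case (botE H \<phi>)
  then show ?case by (metis derives.botE ren.simps(2) wf_fm_ren)
next
  case (allI H x \<sigma> \<phi>)
  obtain y where y: "fresh y \<sigma> (insert (ren \<rho> \<phi>) K)"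
    using good_fresh[of "insert (ren \<rho> \<phi>) K" \<sigma>] allI.prems by auto
  have "K \<^bold>\<turnstile> ren (\<rho>((x, \<sigma>) := y)) (inst 0 (Par x \<sigma>) \<phi>)"
    using allI.prems allI.hyps by (intro allI.IH) (simp_all add: ren_image_fresh del: fun_upd_apply)
  then have "K \<^bold>\<turnstile> inst 0 (Par y \<sigma>) (ren \<rho> \<phi>)"
    using allI.hyps by (simp add: ren_upd)
  then show ?case using y allI.hyps by (auto intro: derives.allI)
next
  case (allE H \<sigma> \<phi> t)
  have "K \<^bold>\<turnstile> All \<sigma> (ren \<rho> \<phi>)" using allE.IH[OF allE.prems] by simp
  then show ?case using allE.hyps by (auto simp: has_type_iff intro: derives.allE)
next
  case (exI H t \<phi> \<sigma>)
  have "K \<^bold>\<turnstile> inst 0 (ren_tm \<rho> t) (ren \<rho> \<phi>)" using exI.IH[OF exI.prems] by simp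
  then show ?case using exI.hyps by (auto simp: has_type_iff intro: derives.exI)
next
  case (exE H \<sigma> \<phi> x \<psi>)
  obtain y where y: "fresh y \<sigma> (insert (ren \<rho> \<phi>) (insert (ren \<rho> \<psi>) K))"
    using good_fresh[of "insert (ren \<rho> \<phi>) (insert (ren \<rho> \<psi>) K)" \<sigma>] exE.prems by auto
  have e: "K \<^bold>\<turnstile> Ex \<sigma> (ren \<rho> \<phi>)" using exE.IH(1)[OF exE.prems] by simp
  have "insert (inst 0 (Par y \<sigma>) (ren \<rho> \<phi>)) K \<^bold>\<turnstile> ren (\<rho>((x, \<sigma>) := y)) \<psi>"
  proof (rule exE.IH(2))
    show "ren (\<rho>((x, \<sigma>) := y)) ` insert (inst 0 (Par x \<sigma>) \<phi>) H
        \<subseteq> insert (inst 0 (Par y \<sigma>) (ren \<rho> \<phi>)) K"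
      using exE.prems exE.hyps by (auto simp: ren_upd ren_image_fresh fresh_def)
  qed (use exE.prems in simp)
  then have "insert (inst 0 (Par y \<sigma>) (ren \<rho> \<phi>)) K \<^bold>\<turnstile> ren \<rho> \<psi>"
    using exE.hyps by (simp add: ren_upd)
  then show ?case using derives.exE[OF e] y by blast
next
  case (eq_refl t \<sigma> H)
  then show ?case by (auto simp: has_type_iff intro: derives.eq_refl)
next
  case (eq_subst H t u \<phi> \<sigma>)
  have "K \<^bold>\<turnstile> ren_tm \<rho> t \<^bold>= ren_tm \<rho> u" using eq_subst.IH(1)[OF eq_subst.prems] by simp
  moreover have "K \<^bold>\<turnstile> inst 0 (ren_tm \<rho> t) (ren \<rho> \<phi>)" using eq_subst.IH(2)[OF eq_subst.prems] by simp
  ultimately show ?case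
    using eq_subst.hyps derives.eq_subst[of K "ren_tm \<rho> t" "ren_tm \<rho> u" "ren \<rho> \<phi>" \<sigma>] by (simp add: has_type_iff)
next
  case (beta \<sigma> t \<tau> u H)
  then show ?case
    using derives.beta[of \<sigma> "ren_tm \<rho> t" \<tau> "ren_tm \<rho> u" K] by (simp add: has_type_iff)
next
  case (ext H \<sigma> f g \<tau>)
  then show ?case
    using derives.ext[of K \<sigma> "ren_tm \<rho> f" "ren_tm \<rho> g" \<tau>] by (simp add: has_type_iff)
next
  case (nat_ind H \<phi> x)
  obtain y where y: "fresh y NatT (insert (ren \<rho> \<phi>) K)"
    using good_fresh[of "insert (ren \<rho> \<phi>) K" NatT] nat_ind.prems by auto
  have "K \<^bold>\<turnstile> inst 0 Zero (ren \<rho> \<phi>)" using nat_ind.IH(1)[OF nat_ind.prems] by simp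
  moreover
  have "insert (inst 0 (Par y NatT) (ren \<rho> \<phi>)) K
      \<^bold>\<turnstile> ren (\<rho>((x, NatT) := y)) (inst 0 (Succ (Par x NatT)) \<phi>)"
  proof (rule nat_ind.IH(2))
    show "ren (\<rho>((x, NatT) := y)) ` insert (inst 0 (Par x NatT) \<phi>) H
        \<subseteq> insert (inst 0 (Par y NatT) (ren \<rho> \<phi>)) K"
      using nat_ind.prems nat_ind.hyps by (auto simp: ren_upd ren_image_fresh fresh_def)
  qed (use nat_ind.prems in simp)
  then have "insert (inst 0 (Par y NatT) (ren \<rho> \<phi>)) K
      \<^bold>\<turnstile> inst 0 (Succ (Par y NatT)) (ren \<rho> \<phi>)"
    using nat_ind.hyps by (simp add: ren_upd)
  ultimately show ?case using y nat_ind.hyps by (auto intro: derives.nat_ind)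
next
  case (surj_pair t \<sigma> \<tau> H)
  then show ?case
    using derives.surj_pair[of "ren_tm \<rho> t" \<sigma> \<tau> K] by (simp add: has_type_iff)
next
  case (proj1 t \<sigma> u \<tau> H)
  then show ?case
    using derives.proj1[of "ren_tm \<rho> t" \<sigma> "ren_tm \<rho> u" \<tau> K] by (simp add: has_type_iff)
next
  case (proj2 t \<sigma> u \<tau> H)
  then show ?case
    using derives.proj2[of "ren_tm \<rho> t" \<sigma> "ren_tm \<rho> u" \<tau> K] by (simp add: has_type_iff)
next
  case (rec_zero a \<sigma> f H)
  then show ?case
    using derives.rec_zero[of "ren_tm \<rho> a" \<sigma> "ren_tm \<rho> f" K] by (simp add: has_type_iff)
next
  case (rec_succ a \<sigma> f n H)
  then show ?case
    using derives.rec_succ[of "ren_tm \<rho> a" \<sigma> "ren_tm \<rho> f" "ren_tm \<rho> n" K] by (simp add: has_type_iff)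
next
  case (succ_inj H m n)
  then show ?case by (metis derives.succ_inj ren.simps(1) ren_tm.simps(9))
next
  case (succ_not_zero H n)
  then show ?case by (metis derives.succ_not_zero ren.simps(1,2) ren_tm.simps(8,9))
qed

section \<open>Derivability as forcing\<close>

text \<open>
  The accessibility relation of the Kripke model: its worlds are sets of hypotheses.
\<close>

definition ext_of :: "fm set \<Rightarrow> fm set \<Rightarrow> bool"  (infix \<open>\<preceq>\<close> 50) where
  "H \<preceq> K \<longleftrightarrow> H \<subseteq> K \<and> good K"

lemma ext_ofD [dest]: "H \<preceq> K \<Longrightarrow> good K"
  by (simp add: ext_of_def)

lemma ext_of_refl [simp]: "H \<preceq> H \<longleftrightarrow> good H"
  by (simp add: ext_of_def)

lemma ext_of_trans: "H \<preceq> K \<Longrightarrow> K \<preceq> L \<Longrightarrow> H \<preceq> L"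
  by (auto simp: ext_of_def)

lemma ext_of_empty [simp]: "{} \<preceq> H \<longleftrightarrow> good H"
  by (simp add: ext_of_def)

lemma ext_of_insert [simp]: "H \<preceq> insert \<phi> H \<longleftrightarrow> good H"
  by (auto simp: ext_of_def)

lemma weaken: "H \<^bold>\<turnstile> \<phi> \<Longrightarrow> H \<preceq> K \<Longrightarrow> K \<^bold>\<turnstile> \<phi>"
  using derives_ren[of H \<phi> fst K] by (simp add: ext_of_def)

abbreviation typed :: "tm \<Rightarrow> ty \<Rightarrow> bool"  (infix \<open>\<Colon>\<close> 50) where
  "t \<Colon> \<sigma> \<equiv> ty_of t [] = Some \<sigma>"

text \<open>
  For the direction from right to left, the world \<open>insert \<phi> H\<close> is the generic extension that derives
  the premise.
\<close>

lemma imp_iff: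
  assumes "good H" "wf_fm [] \<phi>"
  shows "(H \<^bold>\<turnstile> \<phi> \<^bold>\<longrightarrow> \<psi>) \<longleftrightarrow> (\<forall>K. H \<preceq> K \<longrightarrow> (K \<^bold>\<turnstile> \<phi>) \<longrightarrow> (K \<^bold>\<turnstile> \<psi>))"
proof
  assume "H \<^bold>\<turnstile> \<phi> \<^bold>\<longrightarrow> \<psi>"
  then show "\<forall>K. H \<preceq> K \<longrightarrow> (K \<^bold>\<turnstile> \<phi>) \<longrightarrow> (K \<^bold>\<turnstile> \<psi>)"
    using derives.impE[of _ \<phi> \<psi>] weaken[of H] by blast
next
  assume "\<forall>K. H \<preceq> K \<longrightarrow> (K \<^bold>\<turnstile> \<phi>) \<longrightarrow> (K \<^bold>\<turnstile> \<psi>)"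
  then have "insert \<phi> H \<^bold>\<turnstile> \<psi>"
    using assms by (metis derives.hyp ext_of_insert insertI1)
  then show "H \<^bold>\<turnstile> \<phi> \<^bold>\<longrightarrow> \<psi>" using assms by (auto intro: derives.impI)
qed

lemma imp2_iff:
  assumes "good H" "wf_fm [] \<phi>" "wf_fm [] \<psi>"
  shows "(H \<^bold>\<turnstile> \<phi> \<^bold>\<longrightarrow> \<psi> \<^bold>\<longrightarrow> \<chi>) \<longleftrightarrow> (\<forall>K. H \<preceq> K \<longrightarrow> (K \<^bold>\<turnstile> \<phi>) \<longrightarrow> (K \<^bold>\<turnstile> \<psi>) \<longrightarrow> (K \<^bold>\<turnstile> \<chi>))"
proof
  assume "H \<^bold>\<turnstile> \<phi> \<^bold>\<longrightarrow> \<psi> \<^bold>\<longrightarrow> \<chi>"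
  then show "\<forall>K. H \<preceq> K \<longrightarrow> (K \<^bold>\<turnstile> \<phi>) \<longrightarrow> (K \<^bold>\<turnstile> \<psi>) \<longrightarrow> (K \<^bold>\<turnstile> \<chi>)"
    using weaken[of H] derives.impE[of _ \<phi> "\<psi> \<^bold>\<longrightarrow> \<chi>"] derives.impE[of _ \<psi> \<chi>] by blast
next
  assume *: "\<forall>K. H \<preceq> K \<longrightarrow> (K \<^bold>\<turnstile> \<phi>) \<longrightarrow> (K \<^bold>\<turnstile> \<psi>) \<longrightarrow> (K \<^bold>\<turnstile> \<chi>)"
  have "K \<^bold>\<turnstile> \<psi> \<^bold>\<longrightarrow> \<chi>" if K: "H \<preceq> K" "K \<^bold>\<turnstile> \<phi>" for K
  proof -
    have "L \<^bold>\<turnstile> \<chi>" if L: "K \<preceq> L" "L \<^bold>\<turnstile> \<psi>" for L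
      using * ext_of_trans[OF K(1) L(1)] weaken[OF K(2) L(1)] L(2) by blast
    then show ?thesis using ext_ofD[OF K(1)] assms by (simp add: imp_iff)
  qed
  then show "H \<^bold>\<turnstile> \<phi> \<^bold>\<longrightarrow> \<psi> \<^bold>\<longrightarrow> \<chi>" using assms by (simp add: imp_iff)
qed

lemma imp3_iff:
  assumes "good H" "wf_fm [] \<phi>" "wf_fm [] \<psi>" "wf_fm [] \<chi>"
  shows "(H \<^bold>\<turnstile> \<phi> \<^bold>\<longrightarrow> \<psi> \<^bold>\<longrightarrow> \<chi> \<^bold>\<longrightarrow> \<theta>) \<longleftrightarrow>
    (\<forall>K. H \<preceq> K \<longrightarrow> (K \<^bold>\<turnstile> \<phi>) \<longrightarrow> (K \<^bold>\<turnstile> \<psi>) \<longrightarrow> (K \<^bold>\<turnstile> \<chi>) \<longrightarrow> (K \<^bold>\<turnstile> \<theta>))"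
proof -
  have "(H \<^bold>\<turnstile> \<phi> \<^bold>\<longrightarrow> \<psi> \<^bold>\<longrightarrow> \<chi> \<^bold>\<longrightarrow> \<theta>) \<longleftrightarrow>
      (\<forall>K. H \<preceq> K \<longrightarrow> (K \<^bold>\<turnstile> \<phi>) \<longrightarrow> (\<forall>L. K \<preceq> L \<longrightarrow> (L \<^bold>\<turnstile> \<psi>) \<longrightarrow> (L \<^bold>\<turnstile> \<chi>) \<longrightarrow> (L \<^bold>\<turnstile> \<theta>)))"
    using assms imp2_iff[OF ext_ofD[of H] assms(3,4)] by (simp add: imp_iff)
  also have "\<dots> \<longleftrightarrow> (\<forall>K. H \<preceq> K \<longrightarrow> (K \<^bold>\<turnstile> \<phi>) \<longrightarrow> (K \<^bold>\<turnstile> \<psi>) \<longrightarrow> (K \<^bold>\<turnstile> \<chi>) \<longrightarrow> (K \<^bold>\<turnstile> \<theta>))"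
    using ext_of_trans[of H] weaken[of _ \<phi>] ext_ofD[of H] ext_of_refl by blast
  finally show ?thesis .
qed

text \<open>
  A fresh parameter serves as the generic element.
\<close>

lemma all_iff:
  assumes "good H" "wf_fm [\<sigma>] \<phi>"
  shows "(H \<^bold>\<turnstile> All \<sigma> \<phi>) \<longleftrightarrow> (\<forall>t. t \<Colon> \<sigma> \<longrightarrow> (H \<^bold>\<turnstile> inst 0 t \<phi>))"
proof
  assume "H \<^bold>\<turnstile> All \<sigma> \<phi>"
  then show "\<forall>t. t \<Colon> \<sigma> \<longrightarrow> (H \<^bold>\<turnstile> inst 0 t \<phi>)"
    by (auto intro: derives.allE simp: has_type_iff)
next
  assume a: "\<forall>t. t \<Colon> \<sigma> \<longrightarrow> (H \<^bold>\<turnstile> inst 0 t \<phi>)"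
  obtain x where "fresh x \<sigma> (insert \<phi> H)" using good_fresh[of "insert \<phi> H"] assms by auto
  then show "H \<^bold>\<turnstile> All \<sigma> \<phi>" using assms a by (auto intro: derives.allI)
qed

lemma ty_of_inst:
  "ty_of c (\<Delta> @ [\<sigma>]) = Some \<tau> \<Longrightarrow> t \<Colon> \<sigma> \<Longrightarrow> ty_of (inst_tm (length \<Delta>) t c) \<Delta> = Some \<tau>"
proof (induction c arbitrary: \<Delta> \<tau>)
  case (Bound i)
  then show ?case
    using ty_of_append[of t "[]" \<sigma> \<Delta>] by (auto simp: nth_append split: if_splits)
next
  case (Lam \<tau>' c)
  from Lam.prems Lam.IH[of "\<tau>' # \<Delta>"] show ?case by (auto split: option.splits)
qed (auto split: option.splits if_splits ty.splits | fastforce)+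

lemma wf_inst_gen:
  "wf_fm (\<Delta> @ [\<sigma>]) \<phi> \<Longrightarrow> t \<Colon> \<sigma> \<Longrightarrow> wf_fm \<Delta> (inst (length \<Delta>) t \<phi>)"
proof (induction \<phi> arbitrary: \<Delta>)
  case (All \<tau> \<phi>)
  from All.prems All.IH[of "\<tau> # \<Delta>"] show ?case by simp
next
  case (Ex \<tau> \<phi>)
  from Ex.prems Ex.IH[of "\<tau> # \<Delta>"] show ?case by simp
qed (auto simp: has_type_iff intro: ty_of_inst)

lemma wf_inst: "wf_fm [\<sigma>] \<phi> \<Longrightarrow> t \<Colon> \<sigma> \<Longrightarrow> wf_fm [] (inst 0 t \<phi>)"
  using wf_inst_gen[of "[]"] by simp

text \<open>
  Here and in the rules below, a hypothesis or eigenvariable of a derivation becomes an arbitrary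
  world \<open>K\<close> above \<open>H\<close> and an arbitrary term, so that facts already derived carry over by weakening.
\<close>

lemma ex_elim:
  assumes e: "H \<^bold>\<turnstile> Ex \<sigma> \<phi>" and g: "good H" and w: "wf_fm [] (Ex \<sigma> \<phi>)"
    and step: "\<And>K t. H \<preceq> K \<Longrightarrow> t \<Colon> \<sigma> \<Longrightarrow> K \<^bold>\<turnstile> inst 0 t \<phi> \<Longrightarrow> K \<^bold>\<turnstile> \<psi>"
  shows "H \<^bold>\<turnstile> \<psi>"
proof -
  obtain x where x: "fresh x \<sigma> (insert \<phi> (insert \<psi> H))"
    using good_fresh[of "insert \<phi> (insert \<psi> H)"] g by auto
  have "insert (inst 0 (Par x \<sigma>) \<phi>) H \<^bold>\<turnstile> \<psi>"
    using g w by (intro step[of _ "Par x \<sigma>"] derives.hyp) (simp_all add: wf_inst)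
  then show ?thesis using derives.exE[OF e] x by blast
qed

lemma disj_elim:
  assumes d: "H \<^bold>\<turnstile> \<phi> \<^bold>\<or> \<psi>" and g: "good H" and w: "wf_fm [] (\<phi> \<^bold>\<or> \<psi>)"
    and 1: "\<And>K. H \<preceq> K \<Longrightarrow> K \<^bold>\<turnstile> \<phi> \<Longrightarrow> K \<^bold>\<turnstile> \<chi>" and 2: "\<And>K. H \<preceq> K \<Longrightarrow> K \<^bold>\<turnstile> \<psi> \<Longrightarrow> K \<^bold>\<turnstile> \<chi>"
  shows "H \<^bold>\<turnstile> \<chi>"
proof (rule derives.disjE[OF d])
  show "insert \<phi> H \<^bold>\<turnstile> \<chi>" using g w by (intro 1 derives.hyp) simp_all
  show "insert \<psi> H \<^bold>\<turnstile> \<chi>" using g w by (intro 2 derives.hyp) simp_all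
qed

lemma conj_iff: "(H \<^bold>\<turnstile> \<phi> \<^bold>\<and> \<psi>) \<longleftrightarrow> (H \<^bold>\<turnstile> \<phi>) \<and> (H \<^bold>\<turnstile> \<psi>)"
  using derives.conjI[of H \<phi> \<psi>] derives.conjE1[of H \<phi> \<psi>] derives.conjE2[of H \<phi> \<psi>] by blast

lemma ex_intro: "H \<^bold>\<turnstile> inst 0 t \<phi> \<Longrightarrow> t \<Colon> \<sigma> \<Longrightarrow> wf_fm [\<sigma>] \<phi> \<Longrightarrow> H \<^bold>\<turnstile> Ex \<sigma> \<phi>"
  by (auto intro: derives.exI simp: has_type_iff)

lemma derives_nat_induct:
  assumes g: "good H" and w: "wf_fm [NatT] \<phi>" and u: "u \<Colon> NatT"
    and zero: "H \<^bold>\<turnstile> inst 0 Zero \<phi>"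
    and step: "\<And>K t. H \<preceq> K \<Longrightarrow> t \<Colon> NatT \<Longrightarrow> K \<^bold>\<turnstile> inst 0 t \<phi> \<Longrightarrow> K \<^bold>\<turnstile> inst 0 (Succ t) \<phi>"
  shows "H \<^bold>\<turnstile> inst 0 u \<phi>"
proof -
  obtain x where x: "fresh x NatT (insert \<phi> H)"
    using good_fresh[of "insert \<phi> H"] g by auto
  have "insert (inst 0 (Par x NatT) \<phi>) H \<^bold>\<turnstile> inst 0 (Succ (Par x NatT)) \<phi>"
    using g w by (intro step derives.hyp) (simp_all add: wf_inst)
  then have "H \<^bold>\<turnstile> All NatT \<phi>" using derives.nat_ind[OF zero] x w by blast
  then show ?thesis using u derives.allE[of H NatT \<phi> u] by (simp add: has_type_iff)
qed

lemma derives_subst: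
  assumes "H \<^bold>\<turnstile> t \<^bold>= u" "H \<^bold>\<turnstile> inst 0 t \<phi>" "t \<Colon> \<sigma>" "wf_fm [\<sigma>] \<phi>"
  shows "H \<^bold>\<turnstile> inst 0 u \<phi>"
  using assms derives.eq_subst by (auto simp: has_type_iff)

lemma derives_refl: "t \<Colon> \<sigma> \<Longrightarrow> H \<^bold>\<turnstile> t \<^bold>= t"
  by (auto intro: derives.eq_refl simp: has_type_iff)

lemma derives_sym: "H \<^bold>\<turnstile> t \<^bold>= u \<Longrightarrow> t \<Colon> \<sigma> \<Longrightarrow> H \<^bold>\<turnstile> u \<^bold>= t"
  using derives_subst[of H t u "Bound 0 \<^bold>= t" \<sigma>] by (simp add: derives_refl has_type_iff)

lemma derives_trans: "H \<^bold>\<turnstile> s \<^bold>= t \<Longrightarrow> H \<^bold>\<turnstile> t \<^bold>= u \<Longrightarrow> s \<Colon> \<sigma> \<Longrightarrow> t \<Colon> \<sigma> \<Longrightarrow> H \<^bold>\<turnstile> s \<^bold>= u"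
  using derives_subst[of H t u "s \<^bold>= Bound 0" \<sigma>] by (simp add: has_type_iff)

text \<open>
  A context is a term \<open>c\<close> whose index 0 marks the hole.
\<close>

lemma cong_ctx:
  assumes "H \<^bold>\<turnstile> t \<^bold>= u" "t \<Colon> \<sigma>" "ty_of c [\<sigma>] = Some \<tau>"
  shows "H \<^bold>\<turnstile> inst_tm 0 t c \<^bold>= inst_tm 0 u c"
proof -
  have c: "inst_tm 0 t c \<Colon> \<tau>" using ty_of_inst[of c "[]" \<sigma> \<tau> t] assms by simp
  then show ?thesis
    using derives_subst[of H t u "inst_tm 0 t c \<^bold>= c" \<sigma>] assms by (auto simp: derives_refl has_type_iff)
qed

section \<open>Number terms up to provable equality\<close>

declare has_type_iff [simp]

lemma ty_of_arith [simp]: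
  "ty_of (s \<^bold>+ t) \<Gamma> = (if ty_of s \<Gamma> = Some NatT \<and> ty_of t \<Gamma> = Some NatT then Some NatT else None)"
  "ty_of (s \<^bold>* t) \<Gamma> = (if ty_of s \<Gamma> = Some NatT \<and> ty_of t \<Gamma> = Some NatT then Some NatT else None)"
  "ty_of (s \<^bold>- t) \<Gamma> = (if ty_of s \<Gamma> = Some NatT \<and> ty_of t \<Gamma> = Some NatT then Some NatT else None)"
  "ty_of (pred t) \<Gamma> = (if ty_of t \<Gamma> = Some NatT then Some NatT else None)"
  by (simp_all add: nat_defs)

lemma inst_arith [simp]:
  "inst_tm k u (s \<^bold>+ t) = inst_tm k u s \<^bold>+ inst_tm k u t"
  "inst_tm k u (s \<^bold>* t) = inst_tm k u s \<^bold>* inst_tm k u t"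
  "inst_tm k u (s \<^bold>- t) = inst_tm k u s \<^bold>- inst_tm k u t"
  "inst_tm k u (pred t) = pred (inst_tm k u t)"
  by (simp_all add: nat_defs)

lemma wf_fm_le [simp]:
  "wf_fm \<Gamma> (s \<^bold>\<le> t) \<longleftrightarrow> ty_of s \<Gamma> = Some NatT \<and> ty_of t \<Gamma> = Some NatT"
  "wf_fm \<Gamma> (s \<^bold>< t) \<longleftrightarrow> ty_of s \<Gamma> = Some NatT \<and> ty_of t \<Gamma> = Some NatT"
  by (auto simp: le_def lt_def)

lemma inst_le [simp]:
  "inst k u (s \<^bold>\<le> t) = (inst_tm k u s \<^bold>\<le> inst_tm k u t)"
  "inst k u (s \<^bold>< t) = (inst_tm k u s \<^bold>< inst_tm k u t)"
  by (simp_all add: le_def lt_def)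

lemma beta1:
  assumes "ty_of b [\<sigma>] = Some \<tau>" "s \<Colon> \<sigma>"
  shows "H \<^bold>\<turnstile> Lam \<sigma> b \<^bold>\<cdot> s \<^bold>= inst_tm 0 s b"
  using assms by (auto intro: derives.beta)

lemma cong_app:
  assumes "H \<^bold>\<turnstile> f \<^bold>= g" "f \<Colon> \<sigma> \<^bold>\<rightarrow> \<tau>" "g \<Colon> \<sigma> \<^bold>\<rightarrow> \<tau>" "t \<Colon> \<sigma>"
  shows "H \<^bold>\<turnstile> f \<^bold>\<cdot> t \<^bold>= g \<^bold>\<cdot> t"
  using cong_ctx[of H f g "\<sigma> \<^bold>\<rightarrow> \<tau>" "Bound 0 \<^bold>\<cdot> t" \<tau>] assms by simp

lemma beta2:
  assumes "ty_of b [\<tau>, \<sigma>] = Some \<rho>" "s \<Colon> \<sigma>" "t \<Colon> \<tau>"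
  shows "H \<^bold>\<turnstile> Lam \<sigma> (Lam \<tau> b) \<^bold>\<cdot> s \<^bold>\<cdot> t \<^bold>= inst_tm 0 t (inst_tm 1 s b)"
proof -
  have b: "ty_of (inst_tm 1 s b) [\<tau>] = Some \<rho>"
    using ty_of_inst[of b "[\<tau>]" \<sigma> \<rho> s] assms by simp
  have "H \<^bold>\<turnstile> Lam \<sigma> (Lam \<tau> b) \<^bold>\<cdot> s \<^bold>= Lam \<tau> (inst_tm 1 s b)"
    using beta1[of "Lam \<tau> b" \<sigma> "\<tau> \<^bold>\<rightarrow> \<rho>" s H] assms by simp
  then have "H \<^bold>\<turnstile> Lam \<sigma> (Lam \<tau> b) \<^bold>\<cdot> s \<^bold>\<cdot> t \<^bold>= Lam \<tau> (inst_tm 1 s b) \<^bold>\<cdot> t"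
    using assms b by (intro cong_app[of _ _ _ \<tau> \<rho>]) simp_all
  then show ?thesis
    using beta1[of "inst_tm 1 s b" \<tau> \<rho> t H] assms b by (elim derives_trans[of _ _ _ _ \<rho>]) simp_all
qed

text \<open>
  Provable equality without hypotheses.  All identities obtained in the quotient hold in
  every world by weakening.
\<close>

definition eqN :: "tm \<Rightarrow> tm \<Rightarrow> bool" where
  "eqN s t \<longleftrightarrow> s \<Colon> NatT \<and> t \<Colon> NatT \<and> ({} \<^bold>\<turnstile> s \<^bold>= t)"

lemma eqN_cong1:
  assumes "eqN s t" "ty_of c [NatT] = Some NatT"
  shows "eqN (inst_tm 0 s c) (inst_tm 0 t c)"
  using assms cong_ctx[of "{}" s t NatT c NatT] ty_of_inst[of c "[]" NatT NatT]
  by (simp add: eqN_def)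

lemma part_equivp_eqN: "part_equivp eqN"
proof (rule part_equivpI)
  have "eqN Zero Zero" by (simp add: eqN_def derives_refl[of _ NatT])
  then show "\<exists>x. eqN x x" ..
  show "symp eqN" by (auto intro!: sympI simp: eqN_def intro: derives_sym)
  show "transp eqN" by (auto intro!: transpI simp: eqN_def intro: derives_trans)
qed

quotient_type nterm = tm / partial: eqN
  by (rule part_equivp_eqN)

lemma eqN_cong2:
  assumes "eqN s s'" "eqN t t'" 
    and "\<And>u. u \<Colon> NatT \<Longrightarrow> ty_of (c u) [NatT] = Some NatT \<and> ty_of (d u) [NatT] = Some NatT"
    and "\<And>u v. u \<Colon> NatT \<Longrightarrow> v \<Colon> NatT \<Longrightarrow> inst_tm 0 u (d v) = inst_tm 0 v (c u)"
  shows "eqN (inst_tm 0 s (d t)) (inst_tm 0 s' (d t'))"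
  using eqN_cong1[of t t' "c s"] eqN_cong1[of s s' "d t'"] assms by (auto simp: eqN_def intro: derives_trans)

instantiation nterm :: "{zero, one, plus, times, minus}"
begin

lift_definition zero_nterm :: nterm is Zero by (simp add: eqN_def derives_refl[of _ NatT])
lift_definition one_nterm :: nterm is "Succ Zero" by (simp add: eqN_def derives_refl[of _ NatT])
lift_definition plus_nterm :: "nterm \<Rightarrow> nterm \<Rightarrow> nterm" is add
  subgoal for s s' t t'
    using eqN_cong2[of s s' t t' "\<lambda>s. s \<^bold>+ Bound 0" "\<lambda>t. Bound 0 \<^bold>+ t"] by (auto simp: eqN_def)
  done
lift_definition times_nterm :: "nterm \<Rightarrow> nterm \<Rightarrow> nterm" is mult
  subgoal for s s' t t'
    using eqN_cong2[of s s' t t' "\<lambda>s. s \<^bold>* Bound 0" "\<lambda>t. Bound 0 \<^bold>* t"] by (auto simp: eqN_def)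
  done
lift_definition minus_nterm :: "nterm \<Rightarrow> nterm \<Rightarrow> nterm" is monus
  subgoal for s s' t t'
    using eqN_cong2[of s s' t t' "\<lambda>s. s \<^bold>- Bound 0" "\<lambda>t. Bound 0 \<^bold>- t"] by (auto simp: eqN_def)
  done

instance ..
end

lift_definition suc :: "nterm \<Rightarrow> nterm" is Succ
  subgoal for s t using eqN_cong1[of s t "Succ (Bound 0)"] by simp
  done
lift_definition prd :: "nterm \<Rightarrow> nterm" is pred
  subgoal for s t using eqN_cong1[of s t "pred (Bound 0)"] by simp
  done

abbreviation nv :: "tm \<Rightarrow> nterm" where "nv \<equiv> abs_nterm"

lemma eqN_refl [simp]: "eqN t t \<longleftrightarrow> t \<Colon> NatT"
  by (auto simp: eqN_def derives_refl[of _ NatT])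

lemma nv_eq_iff: "s \<Colon> NatT \<Longrightarrow> t \<Colon> NatT \<Longrightarrow> nv s = nv t \<longleftrightarrow> ({} \<^bold>\<turnstile> s \<^bold>= t)"
  using Quotient_rel[OF Quotient_nterm, of s t] by (simp add: eqN_def derives_refl[of _ NatT])

lemma nv_cases: obtains t where "t \<Colon> NatT" "a = nv t"
  by (metis Quotient_abs_rep[OF Quotient_nterm] Quotient_rep_reflp[OF Quotient_nterm] eqN_refl)

lemma nv_simps [simp]:
  "nv Zero = 0"
  "s \<Colon> NatT \<Longrightarrow> nv (Succ s) = suc (nv s)"
  "s \<Colon> NatT \<Longrightarrow> nv (pred s) = prd (nv s)"
  "s \<Colon> NatT \<Longrightarrow> t \<Colon> NatT \<Longrightarrow> nv (s \<^bold>+ t) = nv s + nv t"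
  "s \<Colon> NatT \<Longrightarrow> t \<Colon> NatT \<Longrightarrow> nv (s \<^bold>* t) = nv s * nv t"
  "s \<Colon> NatT \<Longrightarrow> t \<Colon> NatT \<Longrightarrow> nv (s \<^bold>- t) = nv s - nv t"
  by (simp_all add: zero_nterm_def suc.abs_eq prd.abs_eq plus_nterm.abs_eq times_nterm.abs_eq
      minus_nterm.abs_eq)

lemma one_suc: "1 = suc (0 :: nterm)"
  by transfer simp

lemma rec_suc:
  assumes "a \<Colon> NatT" "ty_of b [NatT, NatT] = Some NatT" "t \<Colon> NatT"
  defines "R \<equiv> Rec a (Lam NatT (Lam NatT b))"
  shows "H \<^bold>\<turnstile> R (Succ t) \<^bold>= inst_tm 0 (R t) (inst_tm 1 t b)"
proof -
  let ?F = "Lam NatT (Lam NatT b)"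
  have F: "?F \<Colon> NatT \<^bold>\<rightarrow> NatT \<^bold>\<rightarrow> NatT" and R: "R t \<Colon> NatT" using assms by simp_all
  have "H \<^bold>\<turnstile> R (Succ t) \<^bold>= ?F \<^bold>\<cdot> t \<^bold>\<cdot> R t"
    using assms unfolding R_def by (intro derives.rec_succ[of _ NatT]) simp_all
  moreover have "H \<^bold>\<turnstile> ?F \<^bold>\<cdot> t \<^bold>\<cdot> R t \<^bold>= inst_tm 0 (R t) (inst_tm 1 t b)"
    using assms R by (intro beta2[of _ _ _ NatT]) simp_all
  ultimately show ?thesis by (rule derives_trans[of _ _ _ _ NatT]) (use assms F R in simp_all)
qed

lemma rec_zero_closed: "a \<Colon> NatT \<Longrightarrow> ty_of b [NatT, NatT] = Some NatT \<Longrightarrow> H \<^bold>\<turnstile> Rec a (Lam NatT (Lam NatT b)) Zero \<^bold>= a"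
  by (intro derives.rec_zero[of _ NatT]) simp_all

lemma nv_add: "s \<Colon> NatT \<Longrightarrow> t \<Colon> NatT \<Longrightarrow> nv (s \<^bold>+ t) = nv (Rec s (Lam NatT (Lam NatT (Succ (Bound 0)))) t)"
  using beta2[of "Rec (Bound 1) (Lam NatT (Lam NatT (Succ (Bound 0)))) (Bound 0)" NatT NatT NatT s t "{}"]
  by (subst nv_eq_iff) (simp_all add: add_def)

lemma nv_mult: "s \<Colon> NatT \<Longrightarrow> t \<Colon> NatT \<Longrightarrow> nv (s \<^bold>* t) = nv (Rec Zero (Lam NatT (Lam NatT (Bound 0 \<^bold>+ s))) t)"
  using beta2[of "Rec Zero (Lam NatT (Lam NatT (Bound 0 \<^bold>+ Bound 3))) (Bound 0)" NatT NatT NatT s t "{}"]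
  by (subst nv_eq_iff) (simp_all add: mult_def)

lemma nv_monus: "s \<Colon> NatT \<Longrightarrow> t \<Colon> NatT \<Longrightarrow> nv (s \<^bold>- t) = nv (Rec s (Lam NatT (Lam NatT (pred (Bound 0)))) t)"
  using beta2[of "Rec (Bound 1) (Lam NatT (Lam NatT (pred (Bound 0)))) (Bound 0)" NatT NatT NatT s t "{}"]
  by (subst nv_eq_iff) (simp_all add: monus_def)

lemma nv_pred: "t \<Colon> NatT \<Longrightarrow> nv (pred t) = nv (Rec Zero (Lam NatT (Lam NatT (Bound 1))) t)"
  using beta1[of "Rec Zero (Lam NatT (Lam NatT (Bound 1))) (Bound 0)" NatT NatT t "{}"]
  by (subst nv_eq_iff) (simp_all add: pred_def)

lemma nv_rec:
  assumes "a \<Colon> NatT" "ty_of b [NatT, NatT] = Some NatT"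
  defines "R \<equiv> Rec a (Lam NatT (Lam NatT b))"
  shows "nv (R Zero) = nv a" "t \<Colon> NatT \<Longrightarrow> nv (R (Succ t)) = nv (inst_tm 0 (R t) (inst_tm 1 t b))"
proof -
  show "nv (R Zero) = nv a" using assms rec_zero_closed by (subst nv_eq_iff) simp_all
  assume t: "t \<Colon> NatT"
  have "ty_of (inst_tm 1 t b) [NatT] = Some NatT"
    using ty_of_inst[of b "[NatT]" NatT NatT t] assms t by simp
  then have "inst_tm 0 (R t) (inst_tm 1 t b) \<Colon> NatT"
    using ty_of_inst[of "inst_tm 1 t b" "[]" NatT NatT "R t"] assms t by simp
  then show "nv (R (Succ t)) = nv (inst_tm 0 (R t) (inst_tm 1 t b))"
    using assms t rec_suc[of a b t "{}"] by (subst nv_eq_iff) simp_all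
qed

text \<open>
  The defining recursions, obtained from the conversion rules for \<open>Lam\<close> and \<open>Rec\<close>.
\<close>

lemma nterm_rec [simp]:
  fixes a b :: nterm
  shows "a + 0 = a" "a + suc b = suc (a + b)" "a * 0 = 0" "a * suc b = a * b + a"
    "prd 0 = 0" "prd (suc b) = b" "a - 0 = a" "a - suc b = prd (a - b)"
proof -
  obtain s t where a: "a = nv s" "s \<Colon> NatT" and b: "b = nv t" "t \<Colon> NatT" by (metis nv_cases)
  show "a + 0 = a" "a + suc b = suc (a + b)"
    using nv_add[of s Zero] nv_add[of s "Succ t"] nv_add[of s t] nv_rec[of s "Succ (Bound 0)"] a b
    by (auto simp flip: nv_simps(1,2))
  show "a * 0 = 0" "a * suc b = a * b + a"
    using nv_mult[of s Zero] nv_mult[of s "Succ t"] nv_mult[of s t] nv_rec[of Zero "Bound 0 \<^bold>+ s"] a b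
    by auto
  show "a - 0 = a" "a - suc b = prd (a - b)"
    using nv_monus[of s Zero] nv_monus[of s "Succ t"] nv_monus[of s t] nv_rec[of s "pred (Bound 0)"] a b
    by auto
  show "prd 0 = 0" "prd (suc b) = b"
    using nv_pred[of Zero] nv_pred[of "Succ t"] nv_rec[of Zero "Bound 1"] b
    by auto
qed

text \<open>
  Two functions that satisfy the same primitive recursion are equal.  The recursion step is a context
  \<open>k\<close>, under which the internal induction hypothesis rewrites; so identities that need no hypotheses
  suffice as premises, and these are what the quotient expresses.
\<close>

lemma nv_uniq:
  assumes c: "ty_of c [NatT] = Some NatT" and d: "ty_of d [NatT] = Some NatT"
    and k: "ty_of k [NatT] = Some NatT" and t: "t \<Colon> NatT"
    and zero: "nv (inst_tm 0 Zero c) = nv (inst_tm 0 Zero d)"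
    and suc: "\<And>u. u \<Colon> NatT \<Longrightarrow> nv (inst_tm 0 (Succ u) c) = nv (inst_tm 0 (inst_tm 0 u c) k)"
      "\<And>u. u \<Colon> NatT \<Longrightarrow> nv (inst_tm 0 (Succ u) d) = nv (inst_tm 0 (inst_tm 0 u d) k)"
  shows "nv (inst_tm 0 t c) = nv (inst_tm 0 t d)"
proof -
  have ty: "inst_tm 0 u c \<Colon> NatT" "inst_tm 0 u d \<Colon> NatT" "inst_tm 0 u k \<Colon> NatT" if "u \<Colon> NatT" for u
    using ty_of_inst[of _ "[]" NatT NatT u] that c d k by auto
  have "{} \<^bold>\<turnstile> inst 0 t (c \<^bold>= d)"
  proof (rule derives_nat_induct)
    fix K u assume K: "{} \<preceq> K" and u: "u \<Colon> NatT" and ih: "K \<^bold>\<turnstile> inst 0 u (c \<^bold>= d)"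
    have 1: "{} \<^bold>\<turnstile> inst_tm 0 (Succ u) c \<^bold>= inst_tm 0 (inst_tm 0 u c) k"
      and 2: "{} \<^bold>\<turnstile> inst_tm 0 (Succ u) d \<^bold>= inst_tm 0 (inst_tm 0 u d) k"
      using suc[OF u] u by (simp_all add: nv_eq_iff ty)
    have 3: "K \<^bold>\<turnstile> inst_tm 0 (inst_tm 0 u c) k \<^bold>= inst_tm 0 (inst_tm 0 u d) k"
      using cong_ctx[of K "inst_tm 0 u c" "inst_tm 0 u d" NatT k NatT] ih k u ty by simp
    show "K \<^bold>\<turnstile> inst 0 (Succ u) (c \<^bold>= d)"
      using weaken[OF 1 K] weaken[OF 2 K] 3 u ty
      by (simp, meson ty derives_trans derives_sym ty_of.simps)
  qed (use assms ty in \<open>simp_all add: nv_eq_iff\<close>)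
  then show ?thesis using t ty by (simp add: nv_eq_iff)
qed

text \<open>
  The same principle with functions on the quotient, each represented by a context.  It replaces
  induction: the element \<open>b\<close> may contain parameters, so it need not be a numeral.
\<close>

lemma nterm_uniq:
  fixes f g :: "nterm \<Rightarrow> nterm"
  assumes "f 0 = g 0" "\<And>b. f (suc b) = k (f b)" "\<And>b. g (suc b) = k (g b)"
    and c: "ty_of c [NatT] = Some NatT" "\<And>u. u \<Colon> NatT \<Longrightarrow> nv (inst_tm 0 u c) = f (nv u)"
    and d: "ty_of d [NatT] = Some NatT" "\<And>u. u \<Colon> NatT \<Longrightarrow> nv (inst_tm 0 u d) = g (nv u)"
    and e: "ty_of e [NatT] = Some NatT" "\<And>u. u \<Colon> NatT \<Longrightarrow> nv (inst_tm 0 u e) = k (nv u)"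
  shows "f b = g b"
proof -
  obtain t where t: "b = nv t" "t \<Colon> NatT" by (metis nv_cases)
  have ty: "inst_tm 0 u c \<Colon> NatT" "inst_tm 0 u d \<Colon> NatT" if "u \<Colon> NatT" for u
    using ty_of_inst[of _ "[]" NatT NatT u] that c d by auto
  have "nv (inst_tm 0 t c) = nv (inst_tm 0 t d)"
    by (rule nv_uniq[where k = e]) (use assms t ty in simp_all)
  then show ?thesis using c d t by simp
qed

lemma nterm_add_0_left: "0 + b = (b :: nterm)"
  by (rule nterm_uniq[of "\<lambda>b. 0 + b" "\<lambda>b. b" suc "Zero \<^bold>+ Bound 0" "Bound 0" "Succ (Bound 0)"]) simp_all

lemma nterm_suc_add: "suc a + b = suc (a + b)"
proof -
  obtain s where a: "a = nv s" "s \<Colon> NatT" by (metis nv_cases)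
  show ?thesis
    by (rule nterm_uniq[of "\<lambda>b. suc a + b" "\<lambda>b. suc (a + b)" suc
          "Succ s \<^bold>+ Bound 0" "Succ (s \<^bold>+ Bound 0)" "Succ (Bound 0)"]) (simp_all add: a)
qed

lemma nterm_add_commute: "a + b = b + (a :: nterm)"
proof -
  obtain s where a: "a = nv s" "s \<Colon> NatT" by (metis nv_cases)
  show ?thesis
    by (rule nterm_uniq[of "\<lambda>b. a + b" "\<lambda>b. b + a" suc
          "s \<^bold>+ Bound 0" "Bound 0 \<^bold>+ s" "Succ (Bound 0)"])
      (simp_all add: a nterm_add_0_left nterm_suc_add)
qed

lemma nterm_add_assoc: "a + b + c = a + (b + c :: nterm)"
proof -
  obtain s t where a: "a = nv s" "s \<Colon> NatT" "b = nv t" "t \<Colon> NatT" by (metis nv_cases)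
  show ?thesis
    by (rule nterm_uniq[of "\<lambda>c. a + b + c" "\<lambda>c. a + (b + c)" suc
          "s \<^bold>+ t \<^bold>+ Bound 0" "s \<^bold>+ (t \<^bold>+ Bound 0)" "Succ (Bound 0)"])
      (simp_all add: a)
qed

instance nterm :: comm_monoid_add
  by standard (fact nterm_add_assoc nterm_add_commute nterm_add_0_left)+

lemma nterm_mult_0_left: "0 * b = (0 :: nterm)"
  by (rule nterm_uniq[of "\<lambda>b. 0 * b" "\<lambda>b. 0" "\<lambda>b. b" "Zero \<^bold>* Bound 0" "Zero" "Bound 0"]) simp_all

lemma nterm_suc_mult: "suc a * b = a * b + b"
proof -
  obtain s where a: "a = nv s" "s \<Colon> NatT" by (metis nv_cases)
  show ?thesis
    by (rule nterm_uniq[of "\<lambda>b. suc a * b" "\<lambda>b. a * b + b" "\<lambda>b. b + suc a"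
          "Succ s \<^bold>* Bound 0" "s \<^bold>* Bound 0 \<^bold>+ Bound 0" "Bound 0 \<^bold>+ Succ s"])
      (simp_all add: a ac_simps nterm_suc_add)
qed

lemma nterm_mult_commute: "a * b = b * (a :: nterm)"
proof -
  obtain s where a: "a = nv s" "s \<Colon> NatT" by (metis nv_cases)
  show ?thesis
    by (rule nterm_uniq[of "\<lambda>b. a * b" "\<lambda>b. b * a" "\<lambda>b. b + a"
          "s \<^bold>* Bound 0" "Bound 0 \<^bold>* s" "Bound 0 \<^bold>+ s"])
      (simp_all add: a nterm_mult_0_left nterm_suc_mult)
qed

lemma nterm_distrib: "a * (b + c) = a * b + a * (c :: nterm)"
proof -
  obtain s t where a: "a = nv s" "s \<Colon> NatT" "b = nv t" "t \<Colon> NatT" by (metis nv_cases)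
  show ?thesis
    by (rule nterm_uniq[of "\<lambda>c. a * (b + c)" "\<lambda>c. a * b + a * c" "\<lambda>c. c + a"
          "s \<^bold>* (t \<^bold>+ Bound 0)" "s \<^bold>* t \<^bold>+ s \<^bold>* Bound 0" "Bound 0 \<^bold>+ s"])
      (simp_all add: a ac_simps)
qed

lemma nterm_mult_assoc: "a * b * c = a * (b * c :: nterm)"
proof -
  obtain s t where a: "a = nv s" "s \<Colon> NatT" "b = nv t" "t \<Colon> NatT" by (metis nv_cases)
  show ?thesis
    by (rule nterm_uniq[of "\<lambda>c. a * b * c" "\<lambda>c. a * (b * c)" "\<lambda>c. c + a * b"
          "s \<^bold>* t \<^bold>* Bound 0" "s \<^bold>* (t \<^bold>* Bound 0)" "Bound 0 \<^bold>+ s \<^bold>* t"])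
      (simp_all add: a nterm_distrib)
qed

lemma nterm_suc_minus_suc: "prd (suc a - b) = a - b"
proof -
  obtain s where a: "a = nv s" "s \<Colon> NatT" by (metis nv_cases)
  show ?thesis
    by (rule nterm_uniq[of "\<lambda>b. prd (suc a - b)" "\<lambda>b. a - b" prd
          "pred (Succ s \<^bold>- Bound 0)" "s \<^bold>- Bound 0" "pred (Bound 0)"])
      (simp_all add: a)
qed

lemma nterm_0_minus: "0 - b = (0 :: nterm)"
  by (rule nterm_uniq[of "\<lambda>b. 0 - b" "\<lambda>b. 0" prd "Zero \<^bold>- Bound 0" Zero "pred (Bound 0)"]) simp_all

lemma nterm_add_minus: "a + b - a = (b :: nterm)"
proof -
  obtain t where b: "b = nv t" "t \<Colon> NatT" by (metis nv_cases)
  show ?thesis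
    by (rule nterm_uniq[of "\<lambda>a. a + b - a" "\<lambda>a. b" "\<lambda>c. c"
          "Bound 0 \<^bold>+ t \<^bold>- Bound 0" t "Bound 0"])
      (simp_all add: b nterm_suc_add nterm_suc_minus_suc)
qed

lemma nterm_minus_minus: "a - b - c = a - (b + c :: nterm)"
proof -
  obtain s t where a: "a = nv s" "s \<Colon> NatT" "b = nv t" "t \<Colon> NatT" by (metis nv_cases)
  show ?thesis
    by (rule nterm_uniq[of "\<lambda>c. a - b - c" "\<lambda>c. a - (b + c)" prd
          "s \<^bold>- t \<^bold>- Bound 0" "s \<^bold>- (t \<^bold>+ Bound 0)" "pred (Bound 0)"])
      (simp_all add: a)
qed

text \<open>
  The class \<open>comm_semiring_1\<close> would demand \<open>0 \<noteq> 1\<close>, which is the consistency of the theory;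
  \<open>suc 0\<close> is therefore made a unit by \<open>comm_monoid_mult\<close>.
\<close>

instance nterm :: "{comm_semiring_0, comm_monoid_mult, cancel_ab_semigroup_add}"
proof
  fix a b c :: nterm
  show "a + b - a = b" by (rule nterm_add_minus)
  show "a - b - c = a - (b + c)" by (rule nterm_minus_minus)
  show "a * b * c = a * (b * c)" by (rule nterm_mult_assoc)
  show "a * b = b * a" by (rule nterm_mult_commute)
  show "(a + b) * c = a * c + b * c" by (metis nterm_mult_commute nterm_distrib)
  show "0 * a = 0" "a * 0 = 0" by (simp_all add: nterm_mult_0_left)
  show "1 * a = a" by (simp add: one_suc nterm_suc_mult nterm_mult_0_left)
qed

instance nterm :: cancel_comm_monoid_add ..

lemma nterm_simps [simp]:
  fixes a b :: nterm
  shows "suc a + b = suc (a + b)" "suc a * b = a * b + b" "suc a - suc b = a - b" "prd (suc a - b) = a - b" "0 - b = 0" "a - a = 0"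
  by (simp_all add: nterm_suc_add nterm_suc_mult nterm_suc_minus_suc nterm_0_minus)

section \<open>Equality and order of numbers in a world\<close>

text \<open>
  Provable equality from the hypotheses \<open>H\<close> as a congruence on the quotient, so that calculations in
  the semiring can be combined with equations that hold in \<open>H\<close> only.
\<close>

definition heq :: "fm set \<Rightarrow> nterm \<Rightarrow> nterm \<Rightarrow> bool" where
  "heq H a b \<longleftrightarrow> good H \<and>
    (\<exists>s t. s \<Colon> NatT \<and> t \<Colon> NatT \<and> a = nv s \<and> b = nv t \<and> (H \<^bold>\<turnstile> s \<^bold>= t))"

lemma heq_iff:
  assumes "good H" "s \<Colon> NatT" "t \<Colon> NatT"
  shows "heq H (nv s) (nv t) \<longleftrightarrow> (H \<^bold>\<turnstile> s \<^bold>= t)"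
proof
  assume "heq H (nv s) (nv t)"
  then obtain s' t' where 1: "s' \<Colon> NatT" "t' \<Colon> NatT" "nv s = nv s'" "nv t' = nv t" "H \<^bold>\<turnstile> s' \<^bold>= t'"
    unfolding heq_def by metis
  then have "H \<^bold>\<turnstile> s \<^bold>= s'" "H \<^bold>\<turnstile> t' \<^bold>= t"
    using assms by (auto simp: nv_eq_iff intro: weaken)
  then show "H \<^bold>\<turnstile> s \<^bold>= t" using 1 assms by (meson derives_trans)
qed (use assms in \<open>auto simp: heq_def\<close>)

lemma heq_good: "heq H a b \<Longrightarrow> good H"
  by (simp add: heq_def)

lemma heq_refl [simp]: "heq H a a \<longleftrightarrow> good H"
proof -
  obtain s where "s \<Colon> NatT" "a = nv s" by (rule nv_cases)
  then show ?thesis using heq_good[of H a a] heq_iff[of H s s] derives_refl[of s NatT H] by blast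
qed

lemma heq_sym: "heq H a b \<Longrightarrow> heq H b a"
  unfolding heq_def by (metis derives_sym)

lemma heq_trans [trans]:
  assumes "heq H a b" "heq H b c"
  shows "heq H a c"
proof -
  obtain s t u where st: "s \<Colon> NatT" "t \<Colon> NatT" "u \<Colon> NatT" "a = nv s" "b = nv t" "c = nv u"
    by (meson nv_cases)
  then show ?thesis using assms heq_good[OF assms(1)] derives_trans[of H s t u NatT] by (simp add: heq_iff)
qed

lemma heq_mono: "heq H a b \<Longrightarrow> H \<preceq> K \<Longrightarrow> heq K a b"
  using weaken[of H _ K] ext_ofD[of H K] unfolding heq_def by blast

lemma heq_empty [simp]: "heq {} a b \<longleftrightarrow> a = b"
proof -
  obtain s t where "s \<Colon> NatT" "t \<Colon> NatT" "a = nv s" "b = nv t" by (meson nv_cases)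
  then show ?thesis by (simp add: heq_iff nv_eq_iff)
qed

lemma heq_cong:
  assumes "heq H a b" and c: "ty_of c [NatT] = Some NatT" "\<And>u. u \<Colon> NatT \<Longrightarrow> nv (inst_tm 0 u c) = f (nv u)"
  shows "heq H (f a) (f b)"
proof -
  obtain s t where st: "good H" "s \<Colon> NatT" "t \<Colon> NatT" "a = nv s" "b = nv t" "H \<^bold>\<turnstile> s \<^bold>= t"
    using assms(1) by (auto simp: heq_def)
  have "inst_tm 0 s c \<Colon> NatT" "inst_tm 0 t c \<Colon> NatT"
    using ty_of_inst[of c "[]" NatT NatT] c st by auto
  then have "heq H (nv (inst_tm 0 s c)) (nv (inst_tm 0 t c))"
    using st c(1) cong_ctx[of H s t NatT c NatT] by (simp add: heq_iff)
  then show ?thesis using st c(2)[of s] c(2)[of t] by simp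
qed

lemma heq_suc: "heq H a b \<Longrightarrow> heq H (suc a) (suc b)"
  by (rule heq_cong[of _ _ _ "Succ (Bound 0)"]) simp_all

lemma heq_add_right: "heq H a b \<Longrightarrow> heq H (a + c) (b + c)"
proof -
  assume "heq H a b"
  moreover obtain t where "t \<Colon> NatT" "c = nv t" by (rule nv_cases)
  ultimately show ?thesis by (elim heq_cong[of H a b "Bound 0 \<^bold>+ t"]) simp_all
qed

lemma heq_mult_right: "heq H a b \<Longrightarrow> heq H (a * c) (b * c)"
proof -
  assume "heq H a b"
  moreover obtain t where "t \<Colon> NatT" "c = nv t" by (rule nv_cases)
  ultimately show ?thesis by (elim heq_cong[of H a b "Bound 0 \<^bold>* t"]) simp_all
qed

lemma heq_minus_right: "heq H a b \<Longrightarrow> heq H (a - c) (b - c)"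
proof -
  assume "heq H a b"
  moreover obtain t where "t \<Colon> NatT" "c = nv t" by (rule nv_cases)
  ultimately show ?thesis by (elim heq_cong[of H a b "Bound 0 \<^bold>- t"]) simp_all
qed

lemma heq_minus_left: "heq H a b \<Longrightarrow> heq H (c - a) (c - b)"
proof -
  assume "heq H a b"
  moreover obtain t where "t \<Colon> NatT" "c = nv t" by (rule nv_cases)
  ultimately show ?thesis by (elim heq_cong[of H a b "t \<^bold>- Bound 0"]) simp_all
qed

lemma heq_add: "heq H a b \<Longrightarrow> heq H c d \<Longrightarrow> heq H (a + c) (b + d)"
  by (metis heq_add_right heq_trans add.commute)

lemma heq_suc_zero: "heq H (suc a) 0 \<Longrightarrow> H \<^bold>\<turnstile> Bot"
proof -
  assume 1: "heq H (suc a) 0"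
  obtain s where "s \<Colon> NatT" "a = nv s" by (rule nv_cases)
  then have "H \<^bold>\<turnstile> Succ s \<^bold>= Zero" using 1 heq_iff[of H "Succ s" Zero] by (simp add: heq_good)
  then show ?thesis by (rule derives.succ_not_zero)
qed

definition hle :: "fm set \<Rightarrow> nterm \<Rightarrow> nterm \<Rightarrow> bool" where
  "hle H a b \<longleftrightarrow> heq H (a - b) 0"

lemma hle_iff: "good H \<Longrightarrow> s \<Colon> NatT \<Longrightarrow> t \<Colon> NatT \<Longrightarrow> hle H (nv s) (nv t) \<longleftrightarrow> (H \<^bold>\<turnstile> s \<^bold>\<le> t)"
  using heq_iff[of H "s \<^bold>- t" Zero] by (simp add: hle_def le_def)

lemma hlt_iff: "good H \<Longrightarrow> s \<Colon> NatT \<Longrightarrow> t \<Colon> NatT \<Longrightarrow> hle H (suc (nv s)) (nv t) \<longleftrightarrow> (H \<^bold>\<turnstile> s \<^bold>< t)"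
  using hle_iff[of H "Succ s" t] by (simp add: lt_def)

lemma hle_mono: "hle H a b \<Longrightarrow> H \<preceq> K \<Longrightarrow> hle K a b"
  by (simp add: hle_def heq_mono)

text \<open>
  Both sides are the maximum of \<open>a\<close> and \<open>b\<close>.  This connects truncated subtraction with addition: when
  \<open>a - b\<close> vanishes, \<open>b\<close> is \<open>a + (b - a)\<close>.
\<close>

lemma nterm_max_commute: "a + (b - a) = b + (a - b :: nterm)"
proof -
  obtain s t where st: "s \<Colon> NatT" "t \<Colon> NatT" "a = nv s" "b = nv t" by (meson nv_cases)
  have "{} \<^bold>\<turnstile> inst 0 s (All NatT (Bound 1 \<^bold>+ (Bound 0 \<^bold>- Bound 1) \<^bold>= Bound 0 \<^bold>+ (Bound 1 \<^bold>- Bound 0)))"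
  proof (rule derives_nat_induct)
    fix K u
    assume K: "{} \<preceq> K" and u: "u \<Colon> NatT" and
      "K \<^bold>\<turnstile> inst 0 u (All NatT (Bound 1 \<^bold>+ (Bound 0 \<^bold>- Bound 1) \<^bold>= Bound 0 \<^bold>+ (Bound 1 \<^bold>- Bound 0)))"
    then have ih: "heq K (nv u + (nv v - nv u)) (nv v + (nv u - nv v))" if "v \<Colon> NatT" for v
      using that heq_iff[of K "u \<^bold>+ (v \<^bold>- u)" "v \<^bold>+ (u \<^bold>- v)"] by (simp add: all_iff)
    have "K \<^bold>\<turnstile> inst 0 v (Succ u \<^bold>+ (Bound 0 \<^bold>- Succ u) \<^bold>= Bound 0 \<^bold>+ (Succ u \<^bold>- Bound 0))"
      if v: "v \<Colon> NatT" for v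
    proof (rule derives_nat_induct)
      show "K \<^bold>\<turnstile> inst 0 Zero (Succ u \<^bold>+ (Bound 0 \<^bold>- Succ u) \<^bold>= Bound 0 \<^bold>+ (Succ u \<^bold>- Bound 0))"
        using u K heq_iff[of K "Succ u \<^bold>+ (Zero \<^bold>- Succ u)" "Zero \<^bold>+ (Succ u \<^bold>- Zero)"] by simp
      fix L w assume L: "K \<preceq> L" and w: "w \<Colon> NatT"
      have "heq L (suc (nv u + (nv w - nv u))) (suc (nv w + (nv u - nv w)))"
        using ih[OF w] L by (intro heq_suc) (rule heq_mono)
      then show "L \<^bold>\<turnstile> inst 0 (Succ w) (Succ u \<^bold>+ (Bound 0 \<^bold>- Succ u) \<^bold>= Bound 0 \<^bold>+ (Succ u \<^bold>- Bound 0))"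
        using u w L heq_iff[of L "Succ u \<^bold>+ (Succ w \<^bold>- Succ u)" "Succ w \<^bold>+ (Succ u \<^bold>- Succ w)"] by auto
    qed (use u v K in auto)
    then show "K \<^bold>\<turnstile> inst 0 (Succ u) (All NatT (Bound 1 \<^bold>+ (Bound 0 \<^bold>- Bound 1) \<^bold>= Bound 0 \<^bold>+ (Bound 1 \<^bold>- Bound 0)))"
      using u K by (simp add: all_iff)
  qed (use st in \<open>simp_all add: all_iff flip: nv_eq_iff\<close>)
  then show ?thesis using st by (simp add: all_iff flip: nv_eq_iff)
qed

lemma heq_add_diff:
  assumes "hle H a b"
  shows "heq H (a + (b - a)) b"
proof -
  have "heq H (b + (a - b)) (b + 0)"
    using assms by (intro heq_add) (auto simp: hle_def dest: heq_good)
  then show ?thesis by (simp add: nterm_max_commute)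
qed

text \<open>
  The existential quantifier is that of the metalanguage: the difference is given by a term.  Thus an
  inequality in a world is an equation in it.
\<close>

lemma hle_iff_add: "hle H a b \<longleftrightarrow> (\<exists>d. heq H (a + d) b)"
proof
  assume "hle H a b"
  then show "\<exists>d. heq H (a + d) b" using heq_add_diff by blast
next
  assume "\<exists>d. heq H (a + d) b"
  then obtain d where "heq H (a + d) b" ..
  then have "heq H (a - (a + d)) (a - b)" by (rule heq_minus_left)
  then show "hle H a b" by (simp add: hle_def heq_sym flip: diff_diff_add)
qed

lemma hle_good: "hle H a b \<Longrightarrow> good H"
  by (simp add: hle_def heq_good)

lemma heq_imp_hle: "heq H a b \<Longrightarrow> hle H a b"
  by (metis hle_iff_add add_0_right)

lemma hle_refl [simp]: "hle H a a \<longleftrightarrow> good H"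
  using heq_imp_hle hle_good by fastforce

lemma hle_add_same [simp]: "hle H a (a + b) \<longleftrightarrow> good H"
  by (metis hle_iff_add heq_refl hle_good)

lemma hle_minus: "good H \<Longrightarrow> hle H (a - b) a"
  by (simp add: hle_def diff_diff_add add.commute[of b] flip: diff_diff_add[of a a b])

lemma hle_trans [trans]: "hle H a b \<Longrightarrow> hle H b c \<Longrightarrow> hle H a c"
  unfolding hle_iff_add by (metis heq_add_right heq_trans add.assoc)

lemma hle_add:
  assumes "hle H a b" "hle H c d"
  shows "hle H (a + c) (b + d)"
proof -
  obtain x y where "heq H (a + x) b" "heq H (c + y) d" using assms by (auto simp: hle_iff_add)
  then have "heq H ((a + x) + (c + y)) (b + d)" by (rule heq_add)
  then show ?thesis unfolding hle_iff_add by (intro HOL.exI[of _ "x + y"]) (simp add: ac_simps)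
qed

lemma hle_mult_right: "hle H a b \<Longrightarrow> hle H (a * c) (b * c)"
  unfolding hle_iff_add by (metis heq_mult_right distrib_right)

lemma hle_add_cancel: "hle H (a + c) (b + c) \<Longrightarrow> hle H a b"
proof -
  assume "hle H (a + c) (b + c)"
  then obtain d where "heq H (a + c + d) (b + c)" by (auto simp: hle_iff_add)
  then have "heq H (c + (a + d) - c) (c + b - c)" by (metis heq_minus_right add.assoc add.commute)
  then show ?thesis by (auto simp: hle_iff_add)
qed

lemma hlt_irrefl: "hle H (a + suc c) a \<Longrightarrow> H \<^bold>\<turnstile> Bot"
proof -
  assume "hle H (a + suc c) a"
  then have "hle H (suc c + a) (0 + a)" by (simp add: add.commute)
  then have "hle H (suc c) 0" by (rule hle_add_cancel)
  then show ?thesis using heq_suc_zero by (auto simp: hle_iff_add)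
qed

text \<open>
  Double induction, since both comparisons are unchanged when both arguments get a successor.
\<close>

lemma le_or_lt:
  assumes "good H" "s \<Colon> NatT" "t \<Colon> NatT"
  shows "H \<^bold>\<turnstile> s \<^bold>\<le> t \<^bold>\<or> t \<^bold>< s"
proof -
  let ?D = "\<lambda>s t. s \<^bold>\<le> t \<^bold>\<or> t \<^bold>< s"
  have "H \<^bold>\<turnstile> inst 0 s (All NatT (?D (Bound 1) (Bound 0)))"
  proof (rule derives_nat_induct)
    have "H \<^bold>\<turnstile> Zero \<^bold>\<le> v" if "v \<Colon> NatT" for v
      using assms that hle_iff[of H Zero v] by (simp add: hle_def)
    then show "H \<^bold>\<turnstile> inst 0 Zero (All NatT (?D (Bound 1) (Bound 0)))"
      using assms by (auto simp: all_iff intro: derives.disjI1)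
  next
    fix K u
    assume K: "H \<preceq> K" and u: "u \<Colon> NatT" and "K \<^bold>\<turnstile> inst 0 u (All NatT (?D (Bound 1) (Bound 0)))"
    then have ih: "K \<^bold>\<turnstile> ?D u v" if "v \<Colon> NatT" for v
      using that ext_ofD[OF K] by (simp add: all_iff)
    have "K \<^bold>\<turnstile> inst 0 v (?D (Succ u) (Bound 0))" if v: "v \<Colon> NatT" for v
    proof (rule derives_nat_induct)
      have "K \<^bold>\<turnstile> Zero \<^bold>< Succ u" using u K hlt_iff[of K Zero "Succ u"] by (auto simp: hle_def)
      then show "K \<^bold>\<turnstile> inst 0 Zero (?D (Succ u) (Bound 0))"
        using u by (auto intro: derives.disjI2)
      fix L w assume L: "K \<preceq> L" and w: "w \<Colon> NatT"
      show "L \<^bold>\<turnstile> inst 0 (Succ w) (?D (Succ u) (Bound 0))"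
      proof (rule disj_elim[OF weaken[OF ih[OF w] L]])
        fix M assume M: "L \<preceq> M" "M \<^bold>\<turnstile> u \<^bold>\<le> w"
        then have "hle M (suc (nv u)) (suc (nv w))"
          using hle_iff[of M u w] u w ext_ofD[OF M(1)] by (simp add: hle_def)
        then have "M \<^bold>\<turnstile> Succ u \<^bold>\<le> Succ w"
          using hle_iff[of M "Succ u" "Succ w"] u w ext_ofD[OF M(1)] by simp
        then show "M \<^bold>\<turnstile> inst 0 (Succ w) (?D (Succ u) (Bound 0))"
          using u w by (auto intro: derives.disjI1)
      next
        fix M assume M: "L \<preceq> M" "M \<^bold>\<turnstile> w \<^bold>< u"
        then have "hle M (suc (suc (nv w))) (suc (nv u))"
          using hlt_iff[of M w u] u w ext_ofD[OF M(1)] by (simp add: hle_def)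
        then have "M \<^bold>\<turnstile> Succ w \<^bold>< Succ u"
          using hlt_iff[of M "Succ w" "Succ u"] u w ext_ofD[OF M(1)] by simp
        then show "M \<^bold>\<turnstile> inst 0 (Succ w) (?D (Succ u) (Bound 0))"
          using u w by (auto intro: derives.disjI2)
      qed (use u w L in auto)
    qed (use u v K in auto)
    then show "K \<^bold>\<turnstile> inst 0 (Succ u) (All NatT (?D (Bound 1) (Bound 0)))"
      using u K by (auto simp: all_iff)
  qed (use assms in auto)
  then show ?thesis using assms by (simp add: all_iff)
qed

lemma hle_cases:
  assumes g: "good H"
    and "\<And>K. H \<preceq> K \<Longrightarrow> hle K a b \<Longrightarrow> K \<^bold>\<turnstile> \<phi>"
    and "\<And>K. H \<preceq> K \<Longrightarrow> hle K (suc b) a \<Longrightarrow> K \<^bold>\<turnstile> \<phi>"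
  shows "H \<^bold>\<turnstile> \<phi>"
proof -
  obtain s t where st: "s \<Colon> NatT" "t \<Colon> NatT" "a = nv s" "b = nv t" by (meson nv_cases)
  show ?thesis
  proof (rule disj_elim[OF le_or_lt[OF g st(1,2)] g])
    fix K assume K: "H \<preceq> K"
    then have k: "good K" by (rule ext_ofD)
    show "K \<^bold>\<turnstile> \<phi>" if "K \<^bold>\<turnstile> s \<^bold>\<le> t" using that assms(2)[OF K] st hle_iff[OF k] by simp
    show "K \<^bold>\<turnstile> \<phi>" if "K \<^bold>\<turnstile> t \<^bold>< s" using that assms(3)[OF K] st hlt_iff[OF k] by simp
  qed (use st in simp)
qed

text \<open>
  The order is decidable, hence stable under double negation.
\<close>

lemma hle_by_contra:
  assumes g: "good H" and b: "\<And>K. H \<preceq> K \<Longrightarrow> hle K (suc b) a \<Longrightarrow> K \<^bold>\<turnstile> Bot"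
  shows "hle H a b"
proof -
  obtain s t where st: "s \<Colon> NatT" "t \<Colon> NatT" "a = nv s" "b = nv t" by (meson nv_cases)
  have "H \<^bold>\<turnstile> s \<^bold>\<le> t"
  proof (rule hle_cases[OF g, of a b])
    fix K assume K: "H \<preceq> K"
    show "K \<^bold>\<turnstile> s \<^bold>\<le> t" if "hle K a b" using that K st by (auto simp: hle_iff)
    show "K \<^bold>\<turnstile> s \<^bold>\<le> t" if "hle K (suc b) a"
      by (rule derives.botE[OF b[OF K that]]) (simp add: st)
  qed
  then show ?thesis using g st by (simp add: hle_iff)
qed

lemma hle_mult_cancel:
  assumes "hle H (a * suc c) (b * suc c)"
  shows "hle H a b"
proof (rule hle_by_contra)
  fix K assume K: "H \<preceq> K" and "hle K (suc b) a"
  then have "hle K (suc b * suc c) (a * suc c)" by (intro hle_mult_right)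
  also have "hle K (a * suc c) (b * suc c)" using assms K by (rule hle_mono)
  finally have "hle K (b * suc c + suc c) (b * suc c)" by (simp add: ac_simps)
  then show "K \<^bold>\<turnstile> Bot" by (rule hlt_irrefl)
qed (use assms hle_good in simp)

lemma nterm_antisym:
  assumes "hle {} a b" "hle {} b a"
  shows "a = b"
proof -
  obtain d e where d: "a + d = b" and e: "b + e = a" using assms by (auto simp: hle_iff_add)
  then have "a + (d + e) = a + 0" by (metis add.assoc add_0_right)
  then have "d + e = 0" by simp
  then have "d = 0 - e" by (metis add_diff_cancel_right')
  then show ?thesis using d by simp
qed

lemma nterm_mult_cancel: "a * suc c = b * suc c \<Longrightarrow> a = b"
  by (intro nterm_antisym) (rule hle_mult_cancel[of _ _ c], simp)+

section \<open>Rational terms up to equality\<close>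

lemma ty_of_rat [simp]:
  "ty_of p \<Gamma> = Some RatT \<Longrightarrow> ty_of (pnum p) \<Gamma> = Some NatT"
  "ty_of p \<Gamma> = Some RatT \<Longrightarrow> ty_of (nnum p) \<Gamma> = Some NatT"
  "ty_of p \<Gamma> = Some RatT \<Longrightarrow> ty_of (dpred p) \<Gamma> = Some NatT"
  "ty_of p \<Gamma> = Some RatT \<Longrightarrow> ty_of (den p) \<Gamma> = Some NatT"
  "ty_of p \<Gamma> = Some RatT \<Longrightarrow> ty_of (q_neg p) \<Gamma> = Some RatT"
  "ty_of p \<Gamma> = Some RatT \<Longrightarrow> ty_of (q_abs p) \<Gamma> = Some RatT"
  "ty_of p \<Gamma> = Some RatT \<Longrightarrow> ty_of q \<Gamma> = Some RatT \<Longrightarrow> ty_of (q_add p q) \<Gamma> = Some RatT"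
  "ty_of p \<Gamma> = Some RatT \<Longrightarrow> ty_of q \<Gamma> = Some RatT \<Longrightarrow> ty_of (q_sub p q) \<Gamma> = Some RatT"
  "ty_of q_zero \<Gamma> = Some RatT"
  "ty_of k \<Gamma> = Some NatT \<Longrightarrow> ty_of (q_inv k) \<Gamma> = Some RatT"
  by (simp_all add: rat_defs)

lemma ty_of_triple [simp]:
  "ty_of a \<Gamma> = Some NatT \<Longrightarrow> ty_of b \<Gamma> = Some NatT \<Longrightarrow> ty_of c \<Gamma> = Some NatT \<Longrightarrow>
    ty_of (Tup a (Tup b c)) \<Gamma> = Some RatT"
  by (simp add: RatT_def)

text \<open>
  Triples of numbers are to be typed as \<open>RatT\<close>, without unfolding this type.
\<close>

declare ty_of.simps(5) [simp del]

lemma inst_rat [simp]: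
  "inst_tm k u (pnum p) = pnum (inst_tm k u p)"
  "inst_tm k u (nnum p) = nnum (inst_tm k u p)"
  "inst_tm k u (dpred p) = dpred (inst_tm k u p)"
  "inst_tm k u (den p) = den (inst_tm k u p)"
  "inst_tm k u (q_neg p) = q_neg (inst_tm k u p)"
  "inst_tm k u (q_abs p) = q_abs (inst_tm k u p)"
  "inst_tm k u (q_add p q) = q_add (inst_tm k u p) (inst_tm k u q)"
  "inst_tm k u (q_sub p q) = q_sub (inst_tm k u p) (inst_tm k u q)"
  "inst_tm k u q_zero = q_zero"
  "inst_tm k u (q_inv m) = q_inv (inst_tm k u m)"
  by (simp_all add: rat_defs)

lemma inst_q_le [simp]:
  "inst k u (q_le p q) = q_le (inst_tm k u p) (inst_tm k u q)"
  "inst k u (q_lt p q) = q_lt (inst_tm k u p) (inst_tm k u q)"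
  by (simp_all add: q_le_def q_lt_def)

lemma wf_fm_q_le [simp]:
  "ty_of p \<Gamma> = Some RatT \<Longrightarrow> ty_of q \<Gamma> = Some RatT \<Longrightarrow> wf_fm \<Gamma> (q_le p q)"
  "ty_of p \<Gamma> = Some RatT \<Longrightarrow> ty_of q \<Gamma> = Some RatT \<Longrightarrow> wf_fm \<Gamma> (q_lt p q)"
  by (simp_all add: q_le_def q_lt_def)

lemma nv_triple [simp]:
  assumes "a \<Colon> NatT" "b \<Colon> NatT" "c \<Colon> NatT"
  shows "nv (pnum (Tup a (Tup b c))) = nv a" "nv (nnum (Tup a (Tup b c))) = nv b"
    "nv (dpred (Tup a (Tup b c))) = nv c"
proof -
  have t: "Tup b c \<Colon> NatT \<^bold>\<times> NatT" "Tup a (Tup b c) \<Colon> NatT \<^bold>\<times> NatT \<^bold>\<times> NatT"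
    using assms by (simp_all add: ty_of.simps(5))
  have 1: "{} \<^bold>\<turnstile> Proj2 (Tup a (Tup b c)) \<^bold>= Tup b c"
    using assms t by (intro derives.proj2[of _ NatT _ "NatT \<^bold>\<times> NatT"]) simp_all
  have p: "Proj2 (Tup a (Tup b c)) \<Colon> NatT \<^bold>\<times> NatT" using t by simp
  show "nv (pnum (Tup a (Tup b c))) = nv a"
    using assms t derives.proj1[of a NatT "Tup b c" "NatT \<^bold>\<times> NatT" "{}"]
    by (subst nv_eq_iff) (simp_all add: pnum_def RatT_def)
  have "{} \<^bold>\<turnstile> Proj1 (Proj2 (Tup a (Tup b c))) \<^bold>= Proj1 (Tup b c)"
    using cong_ctx[OF 1 p, of "Proj1 (Bound 0)" NatT] by simp
  moreover have "{} \<^bold>\<turnstile> Proj1 (Tup b c) \<^bold>= b" using assms by (intro derives.proj1) simp_all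
  ultimately show "nv (nnum (Tup a (Tup b c))) = nv b"
    using assms p t derives_trans[of "{}" "Proj1 (Proj2 (Tup a (Tup b c)))" "Proj1 (Tup b c)" b NatT]
    by (subst nv_eq_iff) (simp_all add: nnum_def RatT_def)
  have "{} \<^bold>\<turnstile> Proj2 (Proj2 (Tup a (Tup b c))) \<^bold>= Proj2 (Tup b c)"
    using cong_ctx[OF 1 p, of "Proj2 (Bound 0)" NatT] by simp
  moreover have "{} \<^bold>\<turnstile> Proj2 (Tup b c) \<^bold>= c" using assms by (intro derives.proj2) simp_all
  ultimately show "nv (dpred (Tup a (Tup b c))) = nv c"
    using assms p t derives_trans[of "{}" "Proj2 (Proj2 (Tup a (Tup b c)))" "Proj2 (Tup b c)" c NatT]
    by (subst nv_eq_iff) (simp_all add: dpred_def RatT_def)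
qed

definition pos_part :: "tm \<Rightarrow> nterm" where "pos_part p = nv (pnum p)"
definition neg_part :: "tm \<Rightarrow> nterm" where "neg_part p = nv (nnum p)"
definition den_part :: "tm \<Rightarrow> nterm" where "den_part p = nv (den p)"

lemma den_part_suc: "p \<Colon> RatT \<Longrightarrow> den_part p = suc (nv (dpred p))"
  by (simp add: den_part_def den_def)

lemma parts_triple [simp]:
  assumes "a \<Colon> NatT" "b \<Colon> NatT" "c \<Colon> NatT"
  shows "pos_part (Tup a (Tup b c)) = nv a" "neg_part (Tup a (Tup b c)) = nv b"
    "den_part (Tup a (Tup b c)) = suc (nv c)"
  using assms by (simp_all add: pos_part_def neg_part_def den_part_suc)

lemma parts_rat [simp]:
  "pos_part q_zero = 0" "neg_part q_zero = 0" "den_part q_zero = 1"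
  "p \<Colon> RatT \<Longrightarrow> pos_part (q_neg p) = neg_part p"
  "p \<Colon> RatT \<Longrightarrow> neg_part (q_neg p) = pos_part p"
  "p \<Colon> RatT \<Longrightarrow> den_part (q_neg p) = den_part p"
  "p \<Colon> RatT \<Longrightarrow> pos_part (q_abs p) = (pos_part p - neg_part p) + (neg_part p - pos_part p)"
  "p \<Colon> RatT \<Longrightarrow> neg_part (q_abs p) = 0"
  "p \<Colon> RatT \<Longrightarrow> den_part (q_abs p) = den_part p"
  "k \<Colon> NatT \<Longrightarrow> pos_part (q_inv k) = 1"
  "k \<Colon> NatT \<Longrightarrow> neg_part (q_inv k) = 0"
  "k \<Colon> NatT \<Longrightarrow> den_part (q_inv k) = suc (nv k)"
  "p \<Colon> RatT \<Longrightarrow> q \<Colon> RatT \<Longrightarrow> pos_part (q_add p q) = pos_part p * den_part q + pos_part q * den_part p"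
  "p \<Colon> RatT \<Longrightarrow> q \<Colon> RatT \<Longrightarrow> neg_part (q_add p q) = neg_part p * den_part q + neg_part q * den_part p"
  "p \<Colon> RatT \<Longrightarrow> q \<Colon> RatT \<Longrightarrow> den_part (q_add p q) = den_part p * den_part q"
  by (simp_all add: q_zero_def q_neg_def q_abs_def q_inv_def q_add_def one_suc)
    (simp_all add: pos_part_def neg_part_def den_part_def den_def)

lemma parts_sub [simp]:
  assumes "p \<Colon> RatT" "q \<Colon> RatT"
  shows "pos_part (q_sub p q) = pos_part p * den_part q + neg_part q * den_part p"
    "neg_part (q_sub p q) = neg_part p * den_part q + pos_part q * den_part p"
    "den_part (q_sub p q) = den_part p * den_part q"
  using assms by (simp_all add: q_sub_def)

definition ratrel :: "tm \<Rightarrow> tm \<Rightarrow> bool" where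
  "ratrel p q \<longleftrightarrow> p \<Colon> RatT \<and> q \<Colon> RatT \<and>
    pos_part p * den_part q + neg_part q * den_part p = pos_part q * den_part p + neg_part p * den_part q"

text \<open>
  The usual argument for fractions: the equations are cross-multiplied, and the
  denominator of \<open>q\<close> is cancelled.
\<close>

lemma ratrel_trans:
  assumes "ratrel p q" "ratrel q r"
  shows "ratrel p r"
proof -
  let ?a = "pos_part p" and ?b = "neg_part p" and ?c = "den_part p"
  let ?a' = "pos_part q" and ?b' = "neg_part q" and ?c' = "den_part q"
  let ?a'' = "pos_part r" and ?b'' = "neg_part r" and ?c'' = "den_part r"
  have 1: "?a * ?c' + ?b' * ?c = ?a' * ?c + ?b * ?c'" and 2: "?a' * ?c'' + ?b'' * ?c' = ?a'' * ?c' + ?b' * ?c''"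
    and t: "p \<Colon> RatT" "q \<Colon> RatT" "r \<Colon> RatT"
    using assms by (auto simp: ratrel_def)
  have "(?a * ?c' + ?b' * ?c) * ?c'' + (?a' * ?c'' + ?b'' * ?c') * ?c =
      (?a' * ?c + ?b * ?c') * ?c'' + (?a'' * ?c' + ?b' * ?c'') * ?c" by (simp only: 1 2)
  then have "((?a * ?c'' + ?b'' * ?c) * ?c') + (?b' * ?c * ?c'' + ?a' * ?c'' * ?c) =
    ((?a'' * ?c + ?b * ?c'') * ?c') + (?b' * ?c * ?c'' + ?a' * ?c'' * ?c)"
    by (simp only: algebra_simps)
  then have "(?a * ?c'' + ?b'' * ?c) * ?c' = (?a'' * ?c + ?b * ?c'') * ?c'" by simp
  then have "?a * ?c'' + ?b'' * ?c = ?a'' * ?c + ?b * ?c''"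
    unfolding den_part_suc[OF t(2)] by (rule nterm_mult_cancel)
  then show ?thesis using t by (simp add: ratrel_def)
qed

lemma part_equivp_ratrel: "part_equivp ratrel"
proof (rule part_equivpI)
  have "ratrel q_zero q_zero" by (simp add: ratrel_def)
  then show "\<exists>p. ratrel p p" ..
  show "symp ratrel" by (auto intro!: sympI simp: ratrel_def)
  show "transp ratrel" by (auto intro!: transpI intro: ratrel_trans)
qed

quotient_type qterm = tm / partial: ratrel
  by (rule part_equivp_ratrel)

instantiation qterm :: ab_group_add
begin

lift_definition zero_qterm :: qterm is q_zero by (simp add: ratrel_def)
lift_definition plus_qterm :: "qterm \<Rightarrow> qterm \<Rightarrow> qterm" is q_add
proof -
  fix p p' q q' assume 1: "ratrel p p'" and 2: "ratrel q q'"
  then have t: "p \<Colon> RatT" "p' \<Colon> RatT" "q \<Colon> RatT" "q' \<Colon> RatT" 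
    and e: "pos_part p * den_part p' + neg_part p' * den_part p = pos_part p' * den_part p + neg_part p * den_part p'"
    "pos_part q * den_part q' + neg_part q' * den_part q = pos_part q' * den_part q + neg_part q * den_part q'"
    by (simp_all add: ratrel_def)
  have "(pos_part p * den_part p' + neg_part p' * den_part p) * (den_part q * den_part q') +
      (pos_part q * den_part q' + neg_part q' * den_part q) * (den_part p * den_part p') = 
      (pos_part p' * den_part p + neg_part p * den_part p') * (den_part q * den_part q') +
      (pos_part q' * den_part q + neg_part q * den_part q') * (den_part p * den_part p')"
    by (simp only: e)
  then show "ratrel (q_add p q) (q_add p' q')"
    using t by (simp add: ratrel_def) (simp only: algebra_simps)
qed
lift_definition uminus_qterm :: "qterm \<Rightarrow> qterm" is q_neg
  by (simp add: ratrel_def add.commute)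
definition minus_qterm :: "qterm \<Rightarrow> qterm \<Rightarrow> qterm" where "minus_qterm p q = p + - q"

instance
proof
  fix p q r :: qterm
  show "p + q + r = p + (q + r)" by transfer (simp add: ratrel_def algebra_simps)
  show "p + q = q + p" by transfer (simp add: ratrel_def algebra_simps)
  show "0 + p = p" by transfer (simp add: ratrel_def algebra_simps)
  show "- p + p = 0" by transfer (simp add: ratrel_def algebra_simps)
qed (simp add: minus_qterm_def)

end

abbreviation rv :: "tm \<Rightarrow> qterm" where "rv \<equiv> abs_qterm"

lemma ratrel_refl [simp]: "ratrel p p \<longleftrightarrow> p \<Colon> RatT"
  by (auto simp: ratrel_def)

lemma rv_eq_iff: "p \<Colon> RatT \<Longrightarrow> q \<Colon> RatT \<Longrightarrow> rv p = rv q \<longleftrightarrow> ratrel p q"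
  using Quotient_rel[OF Quotient_qterm, of p q] by simp

lemma rv_cases: obtains p where "p \<Colon> RatT" "r = rv p"
  by (metis Quotient_abs_rep[OF Quotient_qterm] Quotient_rep_reflp[OF Quotient_qterm] ratrel_refl)

lemma rv_simps [simp]:
  "rv q_zero = 0"
  "p \<Colon> RatT \<Longrightarrow> rv (q_neg p) = - rv p"
  "p \<Colon> RatT \<Longrightarrow> q \<Colon> RatT \<Longrightarrow> rv (q_add p q) = rv p + rv q"
  "p \<Colon> RatT \<Longrightarrow> q \<Colon> RatT \<Longrightarrow> rv (q_sub p q) = rv p - rv q"
  by (simp_all add: zero_qterm_def uminus_qterm.abs_eq plus_qterm.abs_eq q_sub_def minus_qterm_def)

section \<open>Nonnegative and positive rationals in a world\<close>

lemma nonneg_respects: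
  assumes "ratrel p q" "hle H (neg_part p) (pos_part p)"
  shows "hle H (neg_part q) (pos_part q)"
proof -
  have t: "p \<Colon> RatT" "q \<Colon> RatT"
    and e: "pos_part p * den_part q + neg_part q * den_part p = pos_part q * den_part p + neg_part p * den_part q"
    using assms by (simp_all add: ratrel_def)
  have "hle H (neg_part p * den_part q + neg_part q * den_part p) (pos_part p * den_part q + neg_part q * den_part p)"
    using assms by (intro hle_add hle_mult_right) (auto dest: hle_good)
  then have "hle H (neg_part q * den_part p + neg_part p * den_part q) (pos_part q * den_part p + neg_part p * den_part q)"
    unfolding e by (simp only: add.commute)
  then have "hle H (neg_part q * den_part p) (pos_part q * den_part p)" by (rule hle_add_cancel)
  then show ?thesis unfolding den_part_suc[OF t(1)] by (rule hle_mult_cancel)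
qed

lemma pos_respects:
  assumes "ratrel p q" "hle H (suc (neg_part p)) (pos_part p)"
  shows "hle H (suc (neg_part q)) (pos_part q)"
proof (rule hle_by_contra)
  show "good H" using assms hle_good by blast
  fix K assume K: "H \<preceq> K" and "hle K (suc (pos_part q)) (suc (neg_part q))"
  then have c: "hle K (pos_part q) (neg_part q)" by (simp add: hle_def)
  have t: "p \<Colon> RatT" "q \<Colon> RatT"
    and e: "pos_part p * den_part q + neg_part q * den_part p = pos_part q * den_part p + neg_part p * den_part q"
    using assms by (simp_all add: ratrel_def)
  have "hle K (suc (neg_part p) * den_part q + neg_part q * den_part p) (pos_part p * den_part q + neg_part q * den_part p)"
    using hle_mono[OF assms(2) K] K by (intro hle_add hle_mult_right) auto
  also have "hle K (pos_part p * den_part q + neg_part q * den_part p) (neg_part q * den_part p + neg_part p * den_part q)"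
    unfolding e using c K by (intro hle_add hle_mult_right) auto
  finally have "hle K (neg_part q * den_part p + neg_part p * den_part q + suc (nv (dpred q))) 
      (neg_part q * den_part p + neg_part p * den_part q)"
    using t by (simp add: ac_simps den_part_suc)
  then show "K \<^bold>\<turnstile> Bot" by (rule hlt_irrefl)
qed

text \<open>
  As the denominator is positive, a fraction is nonnegative in \<open>H\<close> if \<open>H\<close> derives this for its
  numerator.  Both predicates are closed under sums, which is what later proofs by addition of inequalities rest on.
\<close>

lift_definition nonneg :: "fm set \<Rightarrow> qterm \<Rightarrow> bool" is
  "\<lambda>H p. hle H (neg_part p) (pos_part p)"
proof -
  fix H and p q assume a: "ratrel p q"
  then have "ratrel q p" by (simp add: ratrel_def)
  with a show "hle H (neg_part p) (pos_part p) = hle H (neg_part q) (pos_part q)"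
    using nonneg_respects by blast
qed

lift_definition positive :: "fm set \<Rightarrow> qterm \<Rightarrow> bool" is
  "\<lambda>H p. hle H (suc (neg_part p)) (pos_part p)"
proof -
  fix H and p q assume a: "ratrel p q"
  then have "ratrel q p" by (simp add: ratrel_def)
  with a show "hle H (suc (neg_part p)) (pos_part p) = hle H (suc (neg_part q)) (pos_part q)"
    using pos_respects by blast
qed

lemma nonneg_rv: "p \<Colon> RatT \<Longrightarrow> nonneg H (rv p) \<longleftrightarrow> hle H (neg_part p) (pos_part p)"
  by (simp add: nonneg.abs_eq)

lemma positive_rv: "p \<Colon> RatT \<Longrightarrow> positive H (rv p) \<longleftrightarrow> hle H (suc (neg_part p)) (pos_part p)"
  by (simp add: positive.abs_eq)

lemma q_le_iff: 
  assumes "good H" "p \<Colon> RatT" "q \<Colon> RatT"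
  shows "(H \<^bold>\<turnstile> q_le p q) \<longleftrightarrow> nonneg H (rv q - rv p)"
proof -
  have "nonneg H (rv q - rv p) \<longleftrightarrow> nonneg H (rv (q_sub q p))" using assms by simp
  also have "\<dots> \<longleftrightarrow> hle H (nv (pnum p \<^bold>* den q \<^bold>+ nnum q \<^bold>* den p)) (nv (pnum q \<^bold>* den p \<^bold>+ nnum p \<^bold>* den q))"
    unfolding nonneg_rv[OF ty_of_rat(8)[OF assms(3,2)]] using assms
    by (simp add: add.commute) (simp add: pos_part_def neg_part_def den_part_def)
  finally show ?thesis using assms by (simp add: hle_iff q_le_def del: nv_simps)
qed

lemma q_lt_iff: 
  assumes "good H" "p \<Colon> RatT" "q \<Colon> RatT"
  shows "(H \<^bold>\<turnstile> q_lt p q) \<longleftrightarrow> positive H (rv q - rv p)"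
proof -
  have "positive H (rv q - rv p) \<longleftrightarrow> positive H (rv (q_sub q p))" using assms by simp
  also have "\<dots> \<longleftrightarrow> hle H (suc (nv (pnum p \<^bold>* den q \<^bold>+ nnum q \<^bold>* den p))) (nv (pnum q \<^bold>* den p \<^bold>+ nnum p \<^bold>* den q))"
    unfolding positive_rv[OF ty_of_rat(8)[OF assms(3,2)]] using assms
    by (simp add: add.commute) (simp add: pos_part_def neg_part_def den_part_def)
  finally show ?thesis using assms by (simp add: hlt_iff q_lt_def del: nv_simps)
qed

lemma nonneg_good: "nonneg H r \<Longrightarrow> good H"
  by transfer (rule hle_good)

lemma nonneg_mono: "nonneg H r \<Longrightarrow> H \<preceq> K \<Longrightarrow> nonneg K r"
  by transfer (rule hle_mono)

lemma positive_mono: "positive H r \<Longrightarrow> H \<preceq> K \<Longrightarrow> positive K r"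
  by transfer (rule hle_mono)

lemma nonneg_zero [simp]: "nonneg H 0 \<longleftrightarrow> good H"
  by transfer simp

lemma positive_zero: "positive H 0 \<Longrightarrow> H \<^bold>\<turnstile> Bot"
  by transfer (metis hlt_irrefl parts_rat(1,2) add_0_left)

lemma positive_nonneg: "positive H r \<Longrightarrow> nonneg H r"
proof transfer
  fix H p assume "hle H (suc (neg_part p)) (pos_part p)"
  then have "hle H (neg_part p + 1) (pos_part p)" by (simp add: one_suc)
  then show "hle H (neg_part p) (pos_part p)"
    using hle_trans hle_add_same hle_good by blast
qed

lemma nonneg_add: "nonneg H r \<Longrightarrow> nonneg H r' \<Longrightarrow> nonneg H (r + r')"
  by transfer (auto intro!: hle_add hle_mult_right)

lemma positive_add: "positive H r \<Longrightarrow> nonneg H r' \<Longrightarrow> positive H (r + r')"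
proof transfer
  fix H p q assume t: "ratrel p p" "ratrel q q"
    and 1: "hle H (suc (neg_part p)) (pos_part p)" "hle H (neg_part q) (pos_part q)"
  have "hle H (suc (neg_part p * den_part q + neg_part q * den_part p)) 
      (suc (neg_part p * den_part q + neg_part q * den_part p) + nv (dpred q))"
    using 1 hle_good hle_add_same by blast
  also have "suc (neg_part p * den_part q + neg_part q * den_part p) + nv (dpred q) = 
     suc (neg_part p) * den_part q + neg_part q * den_part p"
    using t by (simp add: den_part_suc ac_simps)
  also have "hle H \<dots> (pos_part p * den_part q + pos_part q * den_part p)"
    using 1 by (intro hle_add hle_mult_right)
  finally show "hle H (suc (neg_part (q_add p q))) (pos_part (q_add p q))" using t by simp
qed

abbreviation Inv :: "tm \<Rightarrow> qterm" where "Inv k \<equiv> rv (q_inv k)"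

lemma positive_Inv: "good H \<Longrightarrow> k \<Colon> NatT \<Longrightarrow> positive H (Inv k)"
  by (simp add: positive_rv one_suc)

text \<open>
  The index of \<open>2 * n\<close> if \<open>k\<close> is the index of \<open>n\<close>.
\<close>

definition dbl :: "tm \<Rightarrow> tm" where
  "dbl k = Succ (k \<^bold>+ k)"

lemma ty_of_dbl [simp]: "ty_of (dbl k) \<Gamma> = (if ty_of k \<Gamma> = Some NatT then Some NatT else None)"
  by (simp add: dbl_def)

lemma inst_dbl [simp]: "inst_tm i u (dbl k) = dbl (inst_tm i u k)"
  by (simp add: dbl_def)

lemma Inv_dbl: "k \<Colon> NatT \<Longrightarrow> Inv (dbl k) + Inv (dbl k) = Inv k"
  by (simp add: dbl_def rv_eq_iff ratrel_def algebra_simps flip: rv_simps)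

text \<open>
  The numerator is at least 1, and \<open>dpred p\<close> is the index of the denominator.
\<close>

lemma Inv_le:
  assumes "p \<Colon> RatT" "positive H (rv p)"
  shows "nonneg H (rv p - Inv (dpred p))"
proof -
  have "hle H (suc (neg_part p) * den_part p) (pos_part p * den_part p)"
    using assms by (intro hle_mult_right) (simp add: positive_rv)
  then have "nonneg H (rv (q_sub p (q_inv (dpred p))))"
    using assms by (subst nonneg_rv) (simp_all add: den_part_suc[OF assms(1)] one_suc ac_simps)
  then show ?thesis using assms by simp
qed

lemma sign_cases:
  assumes "good H" 
    and "\<And>K. H \<preceq> K \<Longrightarrow> nonneg K r \<Longrightarrow> K \<^bold>\<turnstile> \<phi>"
    and "\<And>K. H \<preceq> K \<Longrightarrow> positive K (- r) \<Longrightarrow> K \<^bold>\<turnstile> \<phi>"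
  shows "H \<^bold>\<turnstile> \<phi>"
proof -
  obtain p where p: "p \<Colon> RatT" "r = rv p" by (rule rv_cases)
  show ?thesis
    using assms p nonneg_rv[of p] positive_rv[of "q_neg p"]
    by (intro hle_cases[of H "neg_part p" "pos_part p"]) simp_all
qed

lemma nonneg_by_contra:
  assumes "good H" and "\<And>K. H \<preceq> K \<Longrightarrow> positive K (- r) \<Longrightarrow> K \<^bold>\<turnstile> Bot"
  shows "nonneg H r"
proof -
  obtain p where p: "p \<Colon> RatT" "r = rv p" by (rule rv_cases)
  have "H \<^bold>\<turnstile> q_le q_zero p"
  proof (rule sign_cases)
    fix K assume K: "H \<preceq> K" 
    show "K \<^bold>\<turnstile> q_le q_zero p" if "nonneg K r" using that K p by (auto simp: q_le_iff)
    show "K \<^bold>\<turnstile> q_le q_zero p" if "positive K (- r)"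
      by (rule derives.botE[OF assms(2)[OF K that]]) (simp add: p)
  qed (rule assms(1))
  then show ?thesis using assms p by (simp add: q_le_iff)
qed

text \<open>
  If \<open>- r\<close> were positive, it would be at least \<open>Inv k\<close> for some \<open>k\<close>, by \<open>Inv_le\<close>, and then \<open>r + Inv (dbl k)\<close>
  would be negative.
\<close>

lemma archimedean:
  assumes g: "good H" and a: "\<And>k. k \<Colon> NatT \<Longrightarrow> nonneg H (r + Inv k)"
  shows "nonneg H r"
proof (rule nonneg_by_contra[OF g])
  fix K assume K: "H \<preceq> K" and neg: "positive K (- r)"
  obtain p where p: "p \<Colon> RatT" "- r = rv p" by (rule rv_cases)
  then have r: "r = - rv p" by (metis minus_minus)
  let ?k = "dpred p" let ?h = "dbl ?k"
  have "nonneg K (- r - Inv ?k)" using Inv_le neg p by simp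
  moreover have "nonneg K (r + Inv ?h)" using a[of ?h] p K nonneg_mono by auto
  ultimately have "nonneg K (- Inv ?h)"
    using nonneg_add[of K "- r - Inv ?k" "r + Inv ?h"] Inv_dbl[of ?k, symmetric] p by (simp add: r algebra_simps)
  then have "positive K (Inv ?h + - Inv ?h)"
    using positive_Inv[of K ?h] K p by (intro positive_add) auto
  then show "K \<^bold>\<turnstile> Bot" using positive_zero by simp
qed

lemma abs_ge:
  assumes "good H" "p \<Colon> RatT"
  shows "nonneg H (rv (q_abs p) - rv p)" "nonneg H (rv (q_abs p) + rv p)"
proof -
  let ?a = "pos_part p" and ?b = "neg_part p" and ?c = "den_part p"
  have 1: "(?a - ?b) + (?b - ?a) + ?b = ?a + ((?b - ?a) + (?b - ?a))"
    using nterm_max_commute[of ?b ?a] by (metis add.assoc add.commute)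
  have 2: "(?a - ?b) + (?b - ?a) + ?a = ?b + ((?a - ?b) + (?a - ?b))"
    using nterm_max_commute[of ?b ?a] by (metis add.assoc add.commute)
  have "nonneg H (rv (q_sub (q_abs p) p))"
    using assms 1 by (subst nonneg_rv) (simp_all add: hle_mult_right flip: distrib_right)
  then show "nonneg H (rv (q_abs p) - rv p)" using assms by simp
  have "nonneg H (rv (q_add (q_abs p) p))"
    using assms 2 by (subst nonneg_rv) (simp_all add: hle_mult_right flip: distrib_right)
  then show "nonneg H (rv (q_abs p) + rv p)" using assms by simp
qed

lemma abs_le_cases:
  assumes p: "p \<Colon> RatT"
  shows "nonneg H (rv p) \<Longrightarrow> nonneg H (rv p - rv (q_abs p))"
    and "nonneg H (- rv p) \<Longrightarrow> nonneg H (- rv p - rv (q_abs p))"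
proof -
  let ?a = "pos_part p" and ?b = "neg_part p" and ?c = "den_part p"
  have *: "hle H ((a - b) + (b - a) + b) a" if "hle H b a" for a b :: nterm
  proof -
    have "heq H ((b - a) + (b - a) + a) (0 + 0 + a)"
      using that hle_good by (intro heq_add) (auto simp: hle_def)
    moreover have "(a - b) + (b - a) + b = (b - a) + (b - a) + a"
      using nterm_max_commute[of b a] by (metis add.assoc add.commute)
    ultimately show ?thesis by (auto intro: heq_imp_hle)
  qed
  {
    assume "nonneg H (rv p)"
    then have "hle H (((?a - ?b) + (?b - ?a) + ?b) * ?c) (?a * ?c)"
      using p by (intro hle_mult_right *) (simp add: nonneg_rv)
    then have "nonneg H (rv (q_sub p (q_abs p)))"
      using p by (subst nonneg_rv) (simp_all add: distrib_right distrib_left ac_simps)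
    then show "nonneg H (rv p - rv (q_abs p))" using p by simp
  next
    assume "nonneg H (- rv p)"
    then have "hle H ?a ?b" using p nonneg_rv[of "q_neg p" H] by simp
    then have "hle H (((?b - ?a) + (?a - ?b) + ?a) * ?c) (?b * ?c)"
      by (intro hle_mult_right *)
    then have "nonneg H (rv (q_sub (q_neg p) (q_abs p)))"
      using p by (subst nonneg_rv) (simp_all add: distrib_right distrib_left ac_simps)
    then show "nonneg H (- rv p - rv (q_abs p))" using p by simp
  }
qed

lemma abs_le:
  assumes p: "p \<Colon> RatT" and 1: "nonneg H (r - rv p)" and 2: "nonneg H (r + rv p)"
  shows "nonneg H (r - rv (q_abs p))"
proof (rule nonneg_by_contra)
  show "good H" using 1 nonneg_good by blast
  fix K assume K: "H \<preceq> K" and neg: "positive K (- (r - rv (q_abs p)))"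
  show "K \<^bold>\<turnstile> Bot"
  proof (rule sign_cases[of K "rv p"])
    fix L assume L: "K \<preceq> L"
    then have HL: "H \<preceq> L" using K ext_of_trans by blast
    have n: "positive L (- (r - rv (q_abs p)))" using neg L by (rule positive_mono)
    show "L \<^bold>\<turnstile> Bot" if "nonneg L (rv p)"
      using positive_add[OF n nonneg_add[OF nonneg_mono[OF 1 HL] abs_le_cases(1)[OF p that]]]
      by (auto intro!: positive_zero)
    show "L \<^bold>\<turnstile> Bot" if "positive L (- rv p)"
      using positive_add[OF n nonneg_add[OF nonneg_mono[OF 2 HL] abs_le_cases(2)[OF p positive_nonneg[OF that]]]]
      by (auto intro!: positive_zero)
  qed (use K in auto)
qed

text \<open>
  Equality of rationals that depends on hypotheses is not visible in the quotient, but in the cone.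
\<close>

lemma nonneg_eq:
  assumes "H \<^bold>\<turnstile> p \<^bold>= q" "good H" "p \<Colon> RatT" "q \<Colon> RatT"
  shows "nonneg H (rv p - rv q)"
proof -
  have "H \<^bold>\<turnstile> q_le q q" using assms by (simp add: q_le_iff)
  then have "H \<^bold>\<turnstile> inst 0 p (q_le q (Bound 0))"
    using derives_subst[of H q p "q_le q (Bound 0)" RatT] derives_sym[of H p q RatT] assms by simp
  then show ?thesis using assms by (simp add: q_le_iff)
qed

lemma rv_eqI:
  assumes "{} \<^bold>\<turnstile> p \<^bold>= q" "p \<Colon> RatT" "q \<Colon> RatT"
  shows "rv p = rv q"
proof -
  have c: "nv (inst_tm 0 p c) = nv (inst_tm 0 q c)" if "ty_of c [RatT] = Some NatT" for c
  proof -
    have "{} \<^bold>\<turnstile> inst_tm 0 p c \<^bold>= inst_tm 0 q c" using cong_ctx[of "{}" p q RatT c NatT] assms that by simp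
    moreover have "inst_tm 0 p c \<Colon> NatT" "inst_tm 0 q c \<Colon> NatT"
      using assms that ty_of_inst[of c "[]" RatT NatT] by auto
    ultimately show ?thesis by (simp add: nv_eq_iff)
  qed
  have "pos_part p = pos_part q" "neg_part p = neg_part q" "den_part p = den_part q"
    using c[of "pnum (Bound 0)"] c[of "nnum (Bound 0)"] c[of "den (Bound 0)"]
    by (simp_all add: pos_part_def neg_part_def den_part_def)
  then show ?thesis using assms by (simp add: rv_eq_iff ratrel_def)
qed

definition q_nat :: "tm \<Rightarrow> tm" where
  "q_nat t = Tup t (Tup Zero Zero)"

lemma ty_of_q_nat [simp]: "ty_of t \<Gamma> = Some NatT \<Longrightarrow> ty_of (q_nat t) \<Gamma> = Some RatT"
  by (simp add: q_nat_def)

lemma inst_q_nat [simp]: "inst_tm k u (q_nat t) = q_nat (inst_tm k u t)"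
  by (simp add: q_nat_def)

lemma q_nat_mono: "hle H (nv s) (nv t) \<Longrightarrow> s \<Colon> NatT \<Longrightarrow> t \<Colon> NatT \<Longrightarrow> nonneg H (rv (q_nat t) - rv (q_nat s))"
  by (simp add: q_nat_def nonneg_rv flip: rv_simps(4))

lemma q_nat_nonneg: "good H \<Longrightarrow> t \<Colon> NatT \<Longrightarrow> nonneg H (rv (q_nat t))"
  by (simp add: q_nat_def nonneg_rv hle_def)

lemma q_nat_zero: "rv (q_nat Zero) = 0"
  by (simp add: q_nat_def flip: q_zero_def)

lemma q_nat_one: "q_nat (Succ Zero) = q_inv Zero"
  by (simp add: q_nat_def q_inv_def)

section \<open>Real numbers\<close>

declare RealT_def [simp] SeqT_def [simp]

lemma ty_of_real [simp]:
  "ty_of x \<Gamma> = Some RealT \<Longrightarrow> ty_of (r_abs x) \<Gamma> = Some RealT"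
  "ty_of x \<Gamma> = Some RealT \<Longrightarrow> ty_of y \<Gamma> = Some RealT \<Longrightarrow> ty_of (r_sub x y) \<Gamma> = Some RealT"
  "ty_of r_zero \<Gamma> = Some RealT"
  by (simp_all add: r_abs_def r_sub_def r_zero_def)

lemma inst_real [simp]:
  "inst_tm k u (r_abs x) = r_abs (inst_tm k u x)"
  "inst_tm k u (r_sub x y) = r_sub (inst_tm k u x) (inst_tm k u y)"
  "inst_tm k u r_zero = r_zero"
  by (simp_all add: r_abs_def r_sub_def r_zero_def)

lemma rv_r_abs: "x \<Colon> RealT \<Longrightarrow> k \<Colon> NatT \<Longrightarrow> rv (r_abs x \<^bold>\<cdot> k) = rv (q_abs (x \<^bold>\<cdot> k))"
  using beta2[of "q_abs (Bound 1 \<^bold>\<cdot> Bound 0)" NatT RealT RatT x k "{}"]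
  by (intro rv_eqI) (simp_all add: r_abs_def)

lemma rv_r_sub:
  assumes "x \<Colon> RealT" "y \<Colon> RealT" "k \<Colon> NatT"
  shows "rv (r_sub x y \<^bold>\<cdot> k) = rv (x \<^bold>\<cdot> dbl k) - rv (y \<^bold>\<cdot> dbl k)"
proof -
  let ?b = "q_sub (Bound 2 \<^bold>\<cdot> dbl (Bound 0)) (Bound 1 \<^bold>\<cdot> dbl (Bound 0))"
  let ?c = "q_sub (x \<^bold>\<cdot> dbl (Bound 0)) (y \<^bold>\<cdot> dbl (Bound 0))"
  have "{} \<^bold>\<turnstile> r_sub x y \<^bold>= Lam NatT ?c"
    using beta2[of "Lam NatT ?b" RealT RealT RealT x y "{}"] assms by (simp add: r_sub_def dbl_def)
  then have 1: "{} \<^bold>\<turnstile> r_sub x y \<^bold>\<cdot> k \<^bold>= Lam NatT ?c \<^bold>\<cdot> k"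
    using assms by (intro cong_app[of _ _ _ NatT RatT]) simp_all
  have 2: "{} \<^bold>\<turnstile> Lam NatT ?c \<^bold>\<cdot> k \<^bold>= q_sub (x \<^bold>\<cdot> dbl k) (y \<^bold>\<cdot> dbl k)"
    using beta1[of ?c NatT RatT k "{}"] assms by simp
  have "{} \<^bold>\<turnstile> r_sub x y \<^bold>\<cdot> k \<^bold>= q_sub (x \<^bold>\<cdot> dbl k) (y \<^bold>\<cdot> dbl k)"
    by (rule derives_trans[OF 1 2, of RatT]) (use assms in simp_all)
  then have "rv (r_sub x y \<^bold>\<cdot> k) = rv (q_sub (x \<^bold>\<cdot> dbl k) (y \<^bold>\<cdot> dbl k))"
    using assms by (intro rv_eqI) simp_all
  then show ?thesis using assms by simp
qed

lemma rv_r_zero: "k \<Colon> NatT \<Longrightarrow> rv (r_zero \<^bold>\<cdot> k) = 0"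
  using rv_eqI[of "r_zero \<^bold>\<cdot> k" q_zero] beta1[of q_zero NatT RatT k "{}"]
  by (simp add: r_zero_def)

text \<open>
  The absolute value disappears: it is bounded by \<open>Inv m + Inv n\<close> once the difference and its negative
  are, and these are exchanged by swapping \<open>m\<close> and \<open>n\<close>.
\<close>

lemma is_real_iff:
  assumes "good H" "x \<Colon> RealT"
  shows "(H \<^bold>\<turnstile> is_real x) \<longleftrightarrow>
    (\<forall>m n. m \<Colon> NatT \<longrightarrow> n \<Colon> NatT \<longrightarrow> nonneg H (Inv m + Inv n - (rv (x \<^bold>\<cdot> m) - rv (x \<^bold>\<cdot> n))))"
proof -
  have "(H \<^bold>\<turnstile> is_real x) \<longleftrightarrow>
    (\<forall>m n. m \<Colon> NatT \<longrightarrow> n \<Colon> NatT \<longrightarrow> nonneg H (Inv m + Inv n - rv (q_abs (q_sub (x \<^bold>\<cdot> m) (x \<^bold>\<cdot> n)))))"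
    using assms by (auto simp: is_real_def all_iff q_le_iff)
  also have "\<dots> \<longleftrightarrow> (\<forall>m n. m \<Colon> NatT \<longrightarrow> n \<Colon> NatT \<longrightarrow> nonneg H (Inv m + Inv n - (rv (x \<^bold>\<cdot> m) - rv (x \<^bold>\<cdot> n))))"
    (is "(\<forall>m n. _ \<longrightarrow> _ \<longrightarrow> ?A m n) \<longleftrightarrow> (\<forall>m n. _ \<longrightarrow> _ \<longrightarrow> ?B m n)")
  proof -
    have "?B m n" if "?A m n" "m \<Colon> NatT" "n \<Colon> NatT" for m n
      using nonneg_add[OF that(1) abs_ge(1)[of H "q_sub (x \<^bold>\<cdot> m) (x \<^bold>\<cdot> n)"]] assms that(2,3)
      by (simp add: algebra_simps)
    moreover have "?A m n" if "?B m n" "?B n m" "m \<Colon> NatT" "n \<Colon> NatT" for m n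
      using that assms by (intro abs_le) (simp_all add: algebra_simps)
    ultimately show ?thesis by blast
  qed
  finally show ?thesis .
qed

lemma rv_const: "q \<Colon> RatT \<Longrightarrow> k \<Colon> NatT \<Longrightarrow> rv (Lam NatT q \<^bold>\<cdot> k) = rv q"
  using beta1[of q NatT RatT k "{}"] by (intro rv_eqI) simp_all

lemma is_real_const: "good H \<Longrightarrow> q \<Colon> RatT \<Longrightarrow> H \<^bold>\<turnstile> is_real (Lam NatT q)"
  by (simp add: is_real_iff rv_const nonneg_add positive_nonneg positive_Inv)

lemma r_pos_const: 
  assumes "good H" "k \<Colon> NatT"
  shows "H \<^bold>\<turnstile> r_pos (Lam NatT (q_inv k))"
proof -
  have e: "Inv k - Inv (dbl k) = Inv (dbl k)" using Inv_dbl[of k] assms by (simp add: algebra_simps)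
  have "H \<^bold>\<turnstile> q_lt (q_inv (dbl k)) (Lam NatT (q_inv k) \<^bold>\<cdot> dbl k)"
    using assms e positive_Inv[of H "dbl k"] by (simp add: q_lt_iff rv_const)
  then show ?thesis
    unfolding r_pos_def using assms by (intro ex_intro[of _ "dbl k"]) simp_all
qed

section \<open>The two principles as conditions on worlds\<close>

text \<open>
  These formulas put their arguments under quantifiers without lifting.  A dangling index in an argument
  is thus counted from inside, which is why the instantiated index is raised; the definitions
  below give such arguments their indices accordingly.
\<close>

lemma inst_real_fm [simp]:
  "inst k u (is_real x) = is_real (inst_tm (Suc (Suc k)) u x)"
  "inst k u (r_pos x) = r_pos (inst_tm (Suc k) u x)"
  "inst k u (r_nonneg x) = r_nonneg (inst_tm (Suc k) u x)"
  "inst k u (r_le x y) = r_le (inst_tm (Suc k) u x) (inst_tm (Suc k) u y)"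
  "inst k u (r_lt x y) = r_lt (inst_tm (Suc k) u x) (inst_tm (Suc k) u y)"
  by (simp_all add: is_real_def r_pos_def r_nonneg_def r_le_def r_lt_def)

lemma wf_real_fm [simp]:
  "ty_of x (NatT # NatT # \<Gamma>) = Some RealT \<Longrightarrow> wf_fm \<Gamma> (is_real x)"
  "ty_of x (NatT # \<Gamma>) = Some RealT \<Longrightarrow> wf_fm \<Gamma> (r_pos x)"
  "ty_of x (NatT # \<Gamma>) = Some RealT \<Longrightarrow> wf_fm \<Gamma> (r_nonneg x)"
  "ty_of x (NatT # \<Gamma>) = Some RealT \<Longrightarrow> ty_of y (NatT # \<Gamma>) = Some RealT \<Longrightarrow> wf_fm \<Gamma> (r_le x y)"
  "ty_of x (NatT # \<Gamma>) = Some RealT \<Longrightarrow> ty_of y (NatT # \<Gamma>) = Some RealT \<Longrightarrow> wf_fm \<Gamma> (r_lt x y)"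
  by (simp_all add: is_real_def r_pos_def r_nonneg_def r_le_def r_lt_def)

lemma bind_rat [simp]:
  "bind_tm k n \<sigma> (q_neg p) = q_neg (bind_tm k n \<sigma> p)"
  "bind_tm k n \<sigma> (q_abs p) = q_abs (bind_tm k n \<sigma> p)"
  "bind_tm k n \<sigma> (q_add p q) = q_add (bind_tm k n \<sigma> p) (bind_tm k n \<sigma> q)"
  "bind_tm k n \<sigma> (q_sub p q) = q_sub (bind_tm k n \<sigma> p) (bind_tm k n \<sigma> q)"
  "bind_tm k n \<sigma> (q_inv m) = q_inv (bind_tm k n \<sigma> m)"
  "bind k n \<sigma> (q_le p q) = q_le (bind_tm k n \<sigma> p) (bind_tm k n \<sigma> q)"
  "bind k n \<sigma> (q_lt p q) = q_lt (bind_tm k n \<sigma> p) (bind_tm k n \<sigma> q)"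
  by (simp_all add: rat_defs bind_tm_arith le_def lt_def)

lemma bind_real [simp]:
  "bind_tm k n \<sigma> (r_abs x) = r_abs (bind_tm k n \<sigma> x)"
  "bind_tm k n \<sigma> (r_sub x y) = r_sub (bind_tm k n \<sigma> x) (bind_tm k n \<sigma> y)"
  "bind_tm k n \<sigma> r_zero = r_zero"
  by (simp_all add: r_abs_def r_sub_def r_zero_def q_zero_def bind_tm_arith)

lemma bind_fm [simp]:
  "bind k n \<sigma> (s \<^bold>\<le> t) = (bind_tm k n \<sigma> s \<^bold>\<le> bind_tm k n \<sigma> t)"
  "bind k n \<sigma> (s \<^bold>< t) = (bind_tm k n \<sigma> s \<^bold>< bind_tm k n \<sigma> t)"
  "bind k n \<sigma> (is_real x) = is_real (bind_tm (Suc (Suc k)) n \<sigma> x)"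
  "bind k n \<sigma> (r_pos x) = r_pos (bind_tm (Suc k) n \<sigma> x)"
  "bind k n \<sigma> (r_nonneg x) = r_nonneg (bind_tm (Suc k) n \<sigma> x)"
  "bind k n \<sigma> (r_le x y) = r_le (bind_tm (Suc k) n \<sigma> x) (bind_tm (Suc k) n \<sigma> y)"
  "bind k n \<sigma> (r_lt x y) = r_lt (bind_tm (Suc k) n \<sigma> x) (bind_tm (Suc k) n \<sigma> y)"
  by (simp_all add: le_def lt_def is_real_def r_pos_def r_nonneg_def r_le_def r_lt_def bind_tm_arith)

text \<open>
  The parts of the two principles with indices instead of named variables.  Unlike
  the named forms, they are correct for all closed terms \<open>x\<close>, including those that contain a
  parameter with the name of a bound variable.
\<close>

definition seq_real :: "tm \<Rightarrow> fm" where
  "seq_real x = All NatT (is_real (x \<^bold>\<cdot> Bound 2))"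

definition seq_nonneg :: "tm \<Rightarrow> fm" where
  "seq_nonneg x = All NatT (r_nonneg (x \<^bold>\<cdot> Bound 1))"

definition seq_decr :: "tm \<Rightarrow> fm" where
  "seq_decr x = All NatT (r_le (x \<^bold>\<cdot> Succ (Bound 1)) (x \<^bold>\<cdot> Bound 1))"

definition often_gt :: "tm \<Rightarrow> tm \<Rightarrow> fm" where
  "often_gt x \<epsilon> = Ex (NatT \<^bold>\<rightarrow> NatT) (All NatT (Bound 1 \<^bold>\<cdot> Bound 0 \<^bold>< Bound 1 \<^bold>\<cdot> Succ (Bound 0)) \<^bold>\<and>
     All NatT (r_lt \<epsilon> (r_abs (x \<^bold>\<cdot> (Bound 2 \<^bold>\<cdot> Bound 1)))))"

definition seq_neg_conv :: "tm \<Rightarrow> fm" where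
  "seq_neg_conv x = All RealT (is_real (Bound 2) \<^bold>\<longrightarrow> r_pos (Bound 1) \<^bold>\<longrightarrow> often_gt x (Bound 3) \<^bold>\<longrightarrow> Bot)"

definition eventually_le :: "tm \<Rightarrow> tm \<Rightarrow> fm" where
  "eventually_le x \<epsilon> = Ex NatT (All NatT (Bound 1 \<^bold>\<le> Bound 0 \<^bold>\<longrightarrow>
     r_le (r_abs (r_sub (x \<^bold>\<cdot> Bound 1) r_zero)) \<epsilon>))"

definition seq_conv :: "tm \<Rightarrow> fm" where
  "seq_conv x = All RealT (is_real (Bound 2) \<^bold>\<longrightarrow> r_pos (Bound 1) \<^bold>\<longrightarrow> eventually_le x (Bound 3))"

lemma inst_seq [simp]:
  "x \<Colon> SeqT \<Longrightarrow> inst k u (often_gt x \<epsilon>) = often_gt x (inst_tm (k + 3) u \<epsilon>)"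
  "x \<Colon> SeqT \<Longrightarrow> inst k u (eventually_le x \<epsilon>) = eventually_le x (inst_tm (k + 3) u \<epsilon>)"
  by (simp_all add: often_gt_def eventually_le_def numeral_eq_Suc)

lemma wf_seq [simp]:
  assumes "x \<Colon> SeqT"
  shows "wf_fm \<Gamma> (seq_real x)" "wf_fm \<Gamma> (seq_nonneg x)" "wf_fm \<Gamma> (seq_decr x)"
    "wf_fm \<Gamma> (seq_neg_conv x)" "wf_fm \<Gamma> (seq_conv x)"
    "ty_of \<epsilon> (NatT # NatT # (NatT \<^bold>\<rightarrow> NatT) # \<Gamma>) = Some RealT \<Longrightarrow> wf_fm \<Gamma> (often_gt x \<epsilon>)"
    "ty_of \<epsilon> (NatT # NatT # NatT # \<Gamma>) = Some RealT \<Longrightarrow> wf_fm \<Gamma> (eventually_le x \<epsilon>)"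
proof -
  have [simp]: "ty_of x \<Delta> = Some SeqT" for \<Delta> using ty_of_append[of x "[]" SeqT \<Delta>] assms by simp
  show "wf_fm \<Gamma> (seq_real x)" "wf_fm \<Gamma> (seq_nonneg x)" "wf_fm \<Gamma> (seq_decr x)"
    "wf_fm \<Gamma> (seq_neg_conv x)" "wf_fm \<Gamma> (seq_conv x)"
    "ty_of \<epsilon> (NatT # NatT # (NatT \<^bold>\<rightarrow> NatT) # \<Gamma>) = Some RealT \<Longrightarrow> wf_fm \<Gamma> (often_gt x \<epsilon>)"
    "ty_of \<epsilon> (NatT # NatT # NatT # \<Gamma>) = Some RealT \<Longrightarrow> wf_fm \<Gamma> (eventually_le x \<epsilon>)"
    by (simp_all add: seq_real_def seq_nonneg_def seq_decr_def seq_neg_conv_def seq_conv_def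
        often_gt_def eventually_le_def numeral_eq_Suc)
qed

lemma Decreasing_convergence_iff:
  assumes "good H"
  shows "(H \<^bold>\<turnstile> Decreasing_convergence) \<longleftrightarrow> (\<forall>x. x \<Colon> SeqT \<longrightarrow> (H \<^bold>\<turnstile> seq_real x \<^bold>\<longrightarrow> seq_nonneg x \<^bold>\<longrightarrow>
    seq_decr x \<^bold>\<longrightarrow> seq_neg_conv x \<^bold>\<longrightarrow> seq_conv x))"
proof -
  let ?X = "Par ''x'' SeqT"
  let ?b = "bind 0 ''x'' SeqT (is_real_seq ?X \<^bold>\<longrightarrow> nonneg_seq ?X \<^bold>\<longrightarrow> decreasing ?X \<^bold>\<longrightarrow>
    negatively_convergent_zero ?X \<^bold>\<longrightarrow> converges_to ?X r_zero)"
  have D: "Decreasing_convergence = All SeqT ?b"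
    by (simp add: Decreasing_convergence_def all_def)
  have "wf_fm [SeqT] ?b" using sentence_Decreasing_convergence unfolding sentence_def D by simp
  moreover have "inst 0 x ?b = (seq_real x \<^bold>\<longrightarrow> seq_nonneg x \<^bold>\<longrightarrow> seq_decr x \<^bold>\<longrightarrow> seq_neg_conv x \<^bold>\<longrightarrow> seq_conv x)" for x
    by (simp add: is_real_seq_def nonneg_seq_def decreasing_def negatively_convergent_zero_def
        converges_to_def strictly_increasing_def infinitely_often_gt_def all_def ex_def Neg_def
        seq_real_def seq_nonneg_def seq_decr_def seq_neg_conv_def seq_conv_def often_gt_def eventually_le_def
        numeral_eq_Suc)
  ultimately show ?thesis using assms unfolding D by (simp add: all_iff del: bind.simps inst.simps)
qed

definition Markov_for :: "tm \<Rightarrow> fm" where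
  "Markov_for a = (All NatT (a \<^bold>\<cdot> Bound 0 \<^bold>= Zero \<^bold>\<or> a \<^bold>\<cdot> Bound 0 \<^bold>= Succ Zero) \<^bold>\<longrightarrow>
     (All NatT (a \<^bold>\<cdot> Bound 0 \<^bold>= Zero) \<^bold>\<longrightarrow> Bot) \<^bold>\<longrightarrow> Ex NatT (a \<^bold>\<cdot> Bound 0 \<^bold>= Succ Zero))"

lemma Markov_principle_iff:
  assumes "good H"
  shows "(H \<^bold>\<turnstile> Markov_principle) \<longleftrightarrow> (\<forall>a. a \<Colon> NatT \<^bold>\<rightarrow> NatT \<longrightarrow> (H \<^bold>\<turnstile> Markov_for a))"
proof -
  have M: "Markov_principle = All (NatT \<^bold>\<rightarrow> NatT)
   (All NatT (Bound 1 \<^bold>\<cdot> Bound 0 \<^bold>= Zero \<^bold>\<or> Bound 1 \<^bold>\<cdot> Bound 0 \<^bold>= Succ Zero) \<^bold>\<longrightarrow>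
     (All NatT (Bound 1 \<^bold>\<cdot> Bound 0 \<^bold>= Zero) \<^bold>\<longrightarrow> Bot) \<^bold>\<longrightarrow> Ex NatT (Bound 1 \<^bold>\<cdot> Bound 0 \<^bold>= Succ Zero))"
    by (simp add: Markov_principle_def binary_def all_def ex_def Neg_def)
  show ?thesis unfolding M Markov_for_def using assms by (simp add: all_iff)
qed

lemma r_nonneg_iff:
  assumes "good H" "x \<Colon> RealT"
  shows "(H \<^bold>\<turnstile> r_nonneg x) \<longleftrightarrow> (\<forall>k. k \<Colon> NatT \<longrightarrow> nonneg H (rv (x \<^bold>\<cdot> k) + Inv k))"
  using assms by (simp add: r_nonneg_def all_iff q_le_iff)

lemma r_le_iff:
  assumes "good H" "x \<Colon> RealT" "y \<Colon> RealT"
  shows "(H \<^bold>\<turnstile> r_le x y) \<longleftrightarrow> (\<forall>k. k \<Colon> NatT \<longrightarrow> nonneg H (rv (y \<^bold>\<cdot> dbl k) - rv (x \<^bold>\<cdot> dbl k) + Inv k))"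
  using assms by (simp add: r_le_def r_nonneg_iff rv_r_sub)

lemma r_pos_elim:
  assumes "H \<^bold>\<turnstile> r_pos x" "good H" "x \<Colon> RealT"
    and "\<And>K k. H \<preceq> K \<Longrightarrow> k \<Colon> NatT \<Longrightarrow> positive K (rv (x \<^bold>\<cdot> k) - Inv k) \<Longrightarrow> K \<^bold>\<turnstile> \<phi>"
  shows "H \<^bold>\<turnstile> \<phi>"
proof (rule ex_elim[OF assms(1)[unfolded r_pos_def]])
  fix K k assume K: "H \<preceq> K" "k \<Colon> NatT" "K \<^bold>\<turnstile> inst 0 k (q_lt (q_inv (Bound 0)) (x \<^bold>\<cdot> Bound 0))"
  then show "K \<^bold>\<turnstile> \<phi>" using assms ext_ofD[OF K(1)] by (intro assms(4)) (simp_all add: q_lt_iff)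
qed (use assms in simp_all)

lemma r_pos_intro: 
  assumes "positive H (rv (x \<^bold>\<cdot> k) - Inv k)" "good H" "x \<Colon> RealT" "k \<Colon> NatT"
  shows "H \<^bold>\<turnstile> r_pos x"
  unfolding r_pos_def using assms by (intro ex_intro[of _ k]) (simp_all add: q_lt_iff)

lemma seq_real_iff: "good H \<Longrightarrow> x \<Colon> SeqT \<Longrightarrow> (H \<^bold>\<turnstile> seq_real x) \<longleftrightarrow> (\<forall>n. n \<Colon> NatT \<longrightarrow> (H \<^bold>\<turnstile> is_real (x \<^bold>\<cdot> n)))"
  by (simp add: seq_real_def all_iff numeral_eq_Suc)

lemma seq_nonneg_iff: "good H \<Longrightarrow> x \<Colon> SeqT \<Longrightarrow> (H \<^bold>\<turnstile> seq_nonneg x) \<longleftrightarrow> (\<forall>n. n \<Colon> NatT \<longrightarrow> (H \<^bold>\<turnstile> r_nonneg (x \<^bold>\<cdot> n)))"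
  by (simp add: seq_nonneg_def all_iff numeral_eq_Suc)

lemma seq_decr_iff: "good H \<Longrightarrow> x \<Colon> SeqT \<Longrightarrow> 
    (H \<^bold>\<turnstile> seq_decr x) \<longleftrightarrow> (\<forall>n. n \<Colon> NatT \<longrightarrow> (H \<^bold>\<turnstile> r_le (x \<^bold>\<cdot> Succ n) (x \<^bold>\<cdot> n)))"
  by (simp add: seq_decr_def all_iff numeral_eq_Suc)

lemma seq_neg_conv_iff:
  assumes "good H" "x \<Colon> SeqT"
  shows "(H \<^bold>\<turnstile> seq_neg_conv x) \<longleftrightarrow> (\<forall>\<epsilon> K. \<epsilon> \<Colon> RealT \<longrightarrow> H \<preceq> K \<longrightarrow> (K \<^bold>\<turnstile> is_real \<epsilon>) \<longrightarrow> (K \<^bold>\<turnstile> r_pos \<epsilon>) \<longrightarrow> 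
    (K \<^bold>\<turnstile> often_gt x \<epsilon>) \<longrightarrow> (K \<^bold>\<turnstile> Bot))"
proof -
  have "(H \<^bold>\<turnstile> seq_neg_conv x) \<longleftrightarrow> (\<forall>\<epsilon>. \<epsilon> \<Colon> RealT \<longrightarrow> (H \<^bold>\<turnstile> is_real \<epsilon> \<^bold>\<longrightarrow> r_pos \<epsilon> \<^bold>\<longrightarrow> often_gt x \<epsilon> \<^bold>\<longrightarrow> Bot))"
    using assms by (simp add: seq_neg_conv_def all_iff numeral_eq_Suc)
  also have "\<dots> \<longleftrightarrow> (\<forall>\<epsilon> K. \<epsilon> \<Colon> RealT \<longrightarrow> H \<preceq> K \<longrightarrow> (K \<^bold>\<turnstile> is_real \<epsilon>) \<longrightarrow> (K \<^bold>\<turnstile> r_pos \<epsilon>) \<longrightarrow> 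
    (K \<^bold>\<turnstile> often_gt x \<epsilon>) \<longrightarrow> (K \<^bold>\<turnstile> Bot))"
    using assms imp3_iff[of H] by auto
  finally show ?thesis .
qed

lemma seq_conv_iff:
  assumes "good H" "x \<Colon> SeqT"
  shows "(H \<^bold>\<turnstile> seq_conv x) \<longleftrightarrow> (\<forall>\<epsilon> K. \<epsilon> \<Colon> RealT \<longrightarrow> H \<preceq> K \<longrightarrow> (K \<^bold>\<turnstile> is_real \<epsilon>) \<longrightarrow> (K \<^bold>\<turnstile> r_pos \<epsilon>) \<longrightarrow> 
    (K \<^bold>\<turnstile> eventually_le x \<epsilon>))"
proof -
  have "(H \<^bold>\<turnstile> seq_conv x) \<longleftrightarrow> (\<forall>\<epsilon>. \<epsilon> \<Colon> RealT \<longrightarrow> (H \<^bold>\<turnstile> is_real \<epsilon> \<^bold>\<longrightarrow> r_pos \<epsilon> \<^bold>\<longrightarrow> eventually_le x \<epsilon>))"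
    using assms by (simp add: seq_conv_def all_iff numeral_eq_Suc)
  also have "\<dots> \<longleftrightarrow> (\<forall>\<epsilon> K. \<epsilon> \<Colon> RealT \<longrightarrow> H \<preceq> K \<longrightarrow> (K \<^bold>\<turnstile> is_real \<epsilon>) \<longrightarrow> (K \<^bold>\<turnstile> r_pos \<epsilon>) \<longrightarrow> 
    (K \<^bold>\<turnstile> eventually_le x \<epsilon>))"
    using assms imp2_iff[of H] by auto
  finally show ?thesis .
qed

section \<open>From Markov's principle to convergence\<close>

lemma seq_cong:
  assumes "H \<^bold>\<turnstile> n \<^bold>= n'" "good H" "x \<Colon> SeqT" "n \<Colon> NatT" "n' \<Colon> NatT" "k \<Colon> NatT"
  shows "nonneg H (rv (x \<^bold>\<cdot> n \<^bold>\<cdot> k) - rv (x \<^bold>\<cdot> n' \<^bold>\<cdot> k))"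
  using cong_ctx[of H n n' NatT "x \<^bold>\<cdot> Bound 0 \<^bold>\<cdot> k" RatT] assms by (intro nonneg_eq) simp_all

lemma r_lt_intro:
  assumes "good H" "x \<Colon> RealT" "y \<Colon> RealT" "k \<Colon> NatT"
    and "positive H (rv (y \<^bold>\<cdot> dbl k) - rv (x \<^bold>\<cdot> dbl k) - Inv k)"
  shows "H \<^bold>\<turnstile> r_lt x y"
  unfolding r_lt_def using assms by (intro r_pos_intro[of _ _ k]) (simp_all add: rv_r_sub)

lemma often_gt_intro:
  assumes "good H" "x \<Colon> SeqT" "\<epsilon> \<Colon> RealT" "\<nu> \<Colon> NatT \<^bold>\<rightarrow> NatT"
    and "\<And>j. j \<Colon> NatT \<Longrightarrow> H \<^bold>\<turnstile> \<nu> \<^bold>\<cdot> j \<^bold>< \<nu> \<^bold>\<cdot> Succ j"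
    and "\<And>j. j \<Colon> NatT \<Longrightarrow> H \<^bold>\<turnstile> r_lt \<epsilon> (r_abs (x \<^bold>\<cdot> (\<nu> \<^bold>\<cdot> j)))"
  shows "H \<^bold>\<turnstile> often_gt x \<epsilon>"
  unfolding often_gt_def using assms
  by (intro ex_intro[of _ \<nu>]) (simp_all add: conj_iff all_iff numeral_eq_Suc)

lemma often_gt_elim:
  assumes "H \<^bold>\<turnstile> often_gt x \<epsilon>" "good H" "x \<Colon> SeqT" "\<epsilon> \<Colon> RealT"
    and "\<And>K \<nu>. H \<preceq> K \<Longrightarrow> \<nu> \<Colon> NatT \<^bold>\<rightarrow> NatT \<Longrightarrow> (\<And>j. j \<Colon> NatT \<Longrightarrow> K \<^bold>\<turnstile> \<nu> \<^bold>\<cdot> j \<^bold>< \<nu> \<^bold>\<cdot> Succ j) \<Longrightarrow>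
      (\<And>j. j \<Colon> NatT \<Longrightarrow> K \<^bold>\<turnstile> r_lt \<epsilon> (r_abs (x \<^bold>\<cdot> (\<nu> \<^bold>\<cdot> j)))) \<Longrightarrow> K \<^bold>\<turnstile> \<phi>"
  shows "H \<^bold>\<turnstile> \<phi>"
proof (rule ex_elim[OF assms(1)[unfolded often_gt_def]])
  fix K \<nu> assume K: "H \<preceq> K" and \<nu>: "\<nu> \<Colon> NatT \<^bold>\<rightarrow> NatT" and
    "K \<^bold>\<turnstile> inst 0 \<nu> (All NatT (Bound 1 \<^bold>\<cdot> Bound 0 \<^bold>< Bound 1 \<^bold>\<cdot> Succ (Bound 0)) \<^bold>\<and>
     All NatT (r_lt \<epsilon> (r_abs (x \<^bold>\<cdot> (Bound 2 \<^bold>\<cdot> Bound 1)))))"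
  then show "K \<^bold>\<turnstile> \<phi>"
    using assms(3,4) ext_ofD[OF K] by (intro assms(5)[OF K \<nu>]) (simp_all add: conj_iff all_iff numeral_eq_Suc)
qed (use assms in \<open>simp_all add: numeral_eq_Suc\<close>)

lemma eventually_le_intro:
  assumes "good H" "x \<Colon> SeqT" "\<epsilon> \<Colon> RealT" "m \<Colon> NatT"
    and "\<And>K n. H \<preceq> K \<Longrightarrow> n \<Colon> NatT \<Longrightarrow> K \<^bold>\<turnstile> m \<^bold>\<le> n \<Longrightarrow> K \<^bold>\<turnstile> r_le (r_abs (r_sub (x \<^bold>\<cdot> n) r_zero)) \<epsilon>"
  shows "H \<^bold>\<turnstile> eventually_le x \<epsilon>"
  unfolding eventually_le_def using assms
  by (intro ex_intro[of _ m]) (simp_all add: all_iff imp_iff)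

lemma eventually_le_elim:
  assumes "H \<^bold>\<turnstile> eventually_le x \<epsilon>" "good H" "x \<Colon> SeqT" "\<epsilon> \<Colon> RealT"
    and "\<And>K m. H \<preceq> K \<Longrightarrow> m \<Colon> NatT \<Longrightarrow> K \<^bold>\<turnstile> r_le (r_abs (r_sub (x \<^bold>\<cdot> m) r_zero)) \<epsilon> \<Longrightarrow> K \<^bold>\<turnstile> \<phi>"
  shows "H \<^bold>\<turnstile> \<phi>"
proof (rule ex_elim[OF assms(1)[unfolded eventually_le_def]])
  fix K m assume K: "H \<preceq> K" and m: "m \<Colon> NatT" and
    "K \<^bold>\<turnstile> inst 0 m (All NatT (Bound 1 \<^bold>\<le> Bound 0 \<^bold>\<longrightarrow> r_le (r_abs (r_sub (x \<^bold>\<cdot> Bound 1) r_zero)) \<epsilon>))"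
  then have "K \<^bold>\<turnstile> m \<^bold>\<le> m \<^bold>\<longrightarrow> r_le (r_abs (r_sub (x \<^bold>\<cdot> m) r_zero)) \<epsilon>"
    using assms(3,4) ext_ofD[OF K] by (simp add: all_iff)
  moreover have "K \<^bold>\<turnstile> m \<^bold>\<le> m" using ext_ofD[OF K] m hle_iff[of K m m] by simp
  ultimately show "K \<^bold>\<turnstile> \<phi>" using assms(5)[OF K m] derives.impE by blast
qed (use assms in simp_all)

definition q_excess :: "tm \<Rightarrow> tm \<Rightarrow> tm" where
  "q_excess p q = (pnum p \<^bold>* den q \<^bold>+ nnum q \<^bold>* den p) \<^bold>- (pnum q \<^bold>* den p \<^bold>+ nnum p \<^bold>* den q)"

text \<open>
  The order of rationals asserts that \<open>q_excess p q\<close> is 0, so this is the characteristic function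
  of \<open>p \<le> q\<close>.
\<close>

definition le_bit :: "tm \<Rightarrow> tm \<Rightarrow> tm" where
  "le_bit p q = Succ Zero \<^bold>- q_excess p q"

lemma ty_of_le_bit [simp]:
  "ty_of p \<Gamma> = Some RatT \<Longrightarrow> ty_of q \<Gamma> = Some RatT \<Longrightarrow> ty_of (le_bit p q) \<Gamma> = Some NatT"
  by (simp add: le_bit_def q_excess_def)

lemma inst_le_bit [simp]: "inst_tm k u (le_bit p q) = le_bit (inst_tm k u p) (inst_tm k u q)"
  by (simp add: le_bit_def q_excess_def)

lemma q_le_heq:
  assumes "good H" "p \<Colon> RatT" "q \<Colon> RatT"
  shows "(H \<^bold>\<turnstile> q_le p q) \<longleftrightarrow> heq H (nv (q_excess p q)) 0"
  using assms heq_iff[of H "q_excess p q" Zero] by (simp add: q_excess_def q_le_def le_def)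

lemma heq_one_zero: "heq H 1 0 \<Longrightarrow> H \<^bold>\<turnstile> Bot"
  by (simp add: one_suc heq_suc_zero)

text \<open>
  The bit may be any term \<open>b\<close> with this value, for it is used in the form of a member \<open>a \<^bold>\<cdot> n\<close> of a
  sequence.
\<close>

lemma
  assumes g: "good H" and p: "p \<Colon> RatT" and q: "q \<Colon> RatT" and b: "b \<Colon> NatT" "nv b = nv (le_bit p q)"
  shows bit_cases: "H \<^bold>\<turnstile> b \<^bold>= Zero \<^bold>\<or> b \<^bold>= Succ Zero"
    and bit_one: "H \<^bold>\<turnstile> b \<^bold>= Succ Zero \<Longrightarrow> H \<^bold>\<turnstile> q_le p q"
    and bit_zero: "H \<^bold>\<turnstile> b \<^bold>= Zero \<Longrightarrow> H \<^bold>\<turnstile> q_lt q p"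
proof -
  let ?g = "nv (q_excess p q)"
  have ty: "q_excess p q \<Colon> NatT" using p q by (simp add: q_excess_def)
  have b': "nv b = 1 - ?g" using ty by (simp add: b le_bit_def one_suc)
  have one: "(K \<^bold>\<turnstile> b \<^bold>= Succ Zero) \<longleftrightarrow> heq K (1 - ?g) 1" and
    zero: "(K \<^bold>\<turnstile> b \<^bold>= Zero) \<longleftrightarrow> heq K (1 - ?g) 0" if "good K" for K
    using heq_iff[of K b "Succ Zero"] heq_iff[of K b Zero] that b b' by (simp_all add: one_suc)
  have 0: "heq K (1 - ?g) 1" if "heq K ?g 0" for K
    using heq_minus_left[OF that, of 1] by simp
  show "H \<^bold>\<turnstile> b \<^bold>= Zero \<^bold>\<or> b \<^bold>= Succ Zero"
  proof (rule hle_cases[OF g, of ?g 0])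
    fix K assume K: "H \<preceq> K"
    show "K \<^bold>\<turnstile> b \<^bold>= Zero \<^bold>\<or> b \<^bold>= Succ Zero" if "hle K ?g 0"
      using that 0[of K] one[OF ext_ofD[OF K]] b by (intro derives.disjI2) (auto simp: hle_def)
    show "K \<^bold>\<turnstile> b \<^bold>= Zero \<^bold>\<or> b \<^bold>= Succ Zero" if "hle K (suc 0) ?g"
      using that zero[OF ext_ofD[OF K]] b by (intro derives.disjI1) (auto simp: hle_def one_suc)
  qed
  show "H \<^bold>\<turnstile> q_le p q" if "H \<^bold>\<turnstile> b \<^bold>= Succ Zero"
  proof -
    have 1: "heq H (1 - ?g) 1" using that one g by simp
    have "hle H ?g 0"
    proof (rule hle_by_contra[OF g])
      fix K assume K: "H \<preceq> K" and "hle K (suc 0) ?g"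
      then have "heq K (1 - ?g) 0" by (simp add: hle_def one_suc)
      with heq_mono[OF 1 K] have "heq K 1 0" using heq_sym heq_trans by blast
      then show "K \<^bold>\<turnstile> Bot" by (rule heq_one_zero)
    qed
    then show ?thesis using g p q by (simp add: q_le_heq hle_def)
  qed
  show "H \<^bold>\<turnstile> q_lt q p" if "H \<^bold>\<turnstile> b \<^bold>= Zero"
  proof (rule sign_cases[OF g, of "rv q - rv p"])
    fix K assume K: "H \<preceq> K"
    then have k: "good K" by (rule ext_ofD)
    show "K \<^bold>\<turnstile> q_lt q p" if "positive K (- (rv q - rv p))"
      using that k p q by (simp add: q_lt_iff)
    show "K \<^bold>\<turnstile> q_lt q p" if "nonneg K (rv q - rv p)"
    proof -
      have "heq K (1 - ?g) 1" using that k p q by (intro 0) (simp add: q_le_iff flip: q_le_heq)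
      moreover have "heq K (1 - ?g) 0" using weaken[OF \<open>H \<^bold>\<turnstile> b \<^bold>= Zero\<close> K] zero[OF k] by simp
      ultimately have "heq K 1 0" using heq_sym heq_trans by blast
      then show ?thesis using p q by (intro derives.botE[OF heq_one_zero]) simp_all
    qed
  qed
qed

text \<open>
  A real number is at most \<open>c\<close> if each approximation with index \<open>k\<close> is at most \<open>c + Inv k\<close>.  One step down the sequence
  loses precision, but by an amount that the auxiliary index \<open>i\<close> makes arbitrarily small; hence the bound is
  recovered exactly by the Archimedean property, and the induction on \<open>d\<close> accumulates no error.
\<close>

lemma decreasing_bound:
  assumes g: "good H" and x: "x \<Colon> SeqT" and real: "H \<^bold>\<turnstile> seq_real x" and decr: "H \<^bold>\<turnstile> seq_decr x"
    and n: "n \<Colon> NatT" and c: "c \<Colon> RatT"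
    and bound: "\<And>k. k \<Colon> NatT \<Longrightarrow> nonneg H (rv c + Inv k - rv (x \<^bold>\<cdot> n \<^bold>\<cdot> k))"
    and d: "d \<Colon> NatT" and k: "k \<Colon> NatT"
  shows "nonneg H (rv c + Inv k - rv (x \<^bold>\<cdot> (n \<^bold>+ d) \<^bold>\<cdot> k))"
proof -
  let ?\<phi> = "All NatT (q_le (x \<^bold>\<cdot> (n \<^bold>+ Bound 1) \<^bold>\<cdot> Bound 0) (q_add c (q_inv (Bound 0))))"
  have phi: "(K \<^bold>\<turnstile> inst 0 u ?\<phi>) \<longleftrightarrow> (\<forall>k. k \<Colon> NatT \<longrightarrow> nonneg K (rv c + Inv k - rv (x \<^bold>\<cdot> (n \<^bold>+ u) \<^bold>\<cdot> k)))"
    if "good K" "u \<Colon> NatT" for K u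
    using that x n c by (simp add: all_iff q_le_iff)
  have "H \<^bold>\<turnstile> inst 0 d ?\<phi>"
  proof (rule derives_nat_induct)
    have "H \<^bold>\<turnstile> n \<^bold>= n \<^bold>+ Zero"
      using g n heq_iff[of H n "n \<^bold>+ Zero"] by simp
    then have "nonneg H (rv c + Inv k - rv (x \<^bold>\<cdot> (n \<^bold>+ Zero) \<^bold>\<cdot> k))" if "k \<Colon> NatT" for k
      using nonneg_add[OF bound[OF that] seq_cong[of H n "n \<^bold>+ Zero" x k]] g n x that by simp
    then show "H \<^bold>\<turnstile> inst 0 Zero ?\<phi>" using phi[OF g, of Zero] by simp
  next
    fix K u assume K: "H \<preceq> K" and u: "u \<Colon> NatT" and ih: "K \<^bold>\<turnstile> inst 0 u ?\<phi>"
    have gK: "good K" using K by (rule ext_ofD)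
    let ?u = "n \<^bold>+ u" let ?x = "\<lambda>v k. rv (x \<^bold>\<cdot> v \<^bold>\<cdot> k)"
    have step: "nonneg K (rv c + Inv k - ?x (Succ ?u) k)" if k: "k \<Colon> NatT" for k
    proof (rule archimedean[OF gK])
      fix l assume l: "l \<Colon> NatT"
      \<comment> \<open>The passage through the index \<open>dbl i\<close> costs \<open>Inv i + 2 * Inv (dbl i) = Inv l\<close>.\<close>
      define i where "i = dbl l"
      have i: "i \<Colon> NatT" "dbl i \<Colon> NatT" using l by (simp_all add: i_def)
      have 1: "nonneg K (rv c + Inv (dbl i) - ?x ?u (dbl i))"
        using ih phi[OF gK u] i by blast
      have 2: "nonneg K (?x ?u (dbl i) - ?x (Succ ?u) (dbl i) + Inv i)"
        using weaken[OF decr K] gK x n u i by (simp add: seq_decr_iff r_le_iff)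
      have 3: "nonneg K (Inv k + Inv (dbl i) - (?x (Succ ?u) k - ?x (Succ ?u) (dbl i)))"
        using weaken[OF real K] gK x n u i k by (simp add: seq_real_iff is_real_iff)
      note nonneg_add[OF nonneg_add[OF 1 2] 3]
      moreover have "Inv l = (Inv (dbl i) + Inv (dbl i)) + Inv i"
        using Inv_dbl[OF l] Inv_dbl[OF i(1)] by (simp add: i_def)
      ultimately show "nonneg K (rv c + Inv k - ?x (Succ ?u) k + Inv l)"
        by (simp add: algebra_simps)
    qed
    have "K \<^bold>\<turnstile> Succ ?u \<^bold>= n \<^bold>+ Succ u"
      using gK n u heq_iff[of K "Succ ?u" "n \<^bold>+ Succ u"] by simp
    then have "nonneg K (rv c + Inv k - ?x (n \<^bold>+ Succ u) k)" if "k \<Colon> NatT" for k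
      using nonneg_add[OF step[OF that] seq_cong[of K "Succ ?u" "n \<^bold>+ Succ u" x k]] gK n u x that by simp
    then show "K \<^bold>\<turnstile> inst 0 (Succ u) ?\<phi>" using phi[OF gK, of "Succ u"] u by simp
  qed (use g x n c d in simp_all)
  then show ?thesis using phi[OF g d] k by blast
qed

text \<open>
  Markov's principle is applied to the binary sequence that records for which \<open>n\<close> the approximation of
  \<open>x\<^sub>n\<close> with a fixed index lies safely below \<open>c\<close>.
\<close>

lemma Markov_small_term:
  fixes x c :: tm
  assumes g: "good H" and x: "x \<Colon> SeqT" and c: "c \<Colon> RatT"
    and mp: "H \<^bold>\<turnstile> Markov_principle" and neg: "H \<^bold>\<turnstile> seq_neg_conv x"
    and pos: "positive H (rv c)"
    and small: "\<And>K n m. H \<preceq> K \<Longrightarrow> n \<Colon> NatT \<Longrightarrow> m \<Colon> NatT \<Longrightarrow>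
      nonneg K (rv c - (rv (x \<^bold>\<cdot> n \<^bold>\<cdot> m) + Inv m)) \<Longrightarrow> K \<^bold>\<turnstile> \<phi>"
  shows "H \<^bold>\<turnstile> \<phi>"
proof -
  \<comment> \<open>\<open>c\<close> is at least \<open>Inv (dpred c) = 4 * Inv j\<close>.  A term of the sequence that is not small exceeds the real \<open>Inv j\<close> with witness \<open>j\<close>, that is, in the approximation with index \<open>dbl j\<close>.\<close>
  define j where "j = dbl (dbl (dpred c))"
  have j [simp]: "j \<Colon> NatT" and m: "dbl j \<Colon> NatT" using c by (simp_all add: j_def)
  have Inv_c: "Inv (dpred c) = (Inv j + Inv j) + (Inv j + Inv j)" and Inv_j: "Inv j = Inv (dbl j) + Inv (dbl j)"
    using Inv_dbl[of "dpred c"] Inv_dbl[of "dbl (dpred c)"] Inv_dbl[OF j] c by (simp_all add: j_def)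
  let ?p = "\<lambda>n. q_add (x \<^bold>\<cdot> n \<^bold>\<cdot> dbl j) (q_inv (dbl j))"
  define a where "a = Lam NatT (le_bit (?p (Bound 0)) c)"
  have a: "a \<Colon> NatT \<^bold>\<rightarrow> NatT" using x c m by (simp add: a_def)
  have p: "?p n \<Colon> RatT" if "n \<Colon> NatT" for n using x m that by simp
  have an: "nv (a \<^bold>\<cdot> n) = nv (le_bit (?p n) c)" if "n \<Colon> NatT" for n
    using that x c m a beta1[of "le_bit (?p (Bound 0)) c" NatT NatT n "{}"]
    by (subst nv_eq_iff) (simp_all add: a_def)
  have tan: "a \<^bold>\<cdot> n \<Colon> NatT" if "n \<Colon> NatT" for n using a that by simp
  have binary: "H \<^bold>\<turnstile> All NatT (a \<^bold>\<cdot> Bound 0 \<^bold>= Zero \<^bold>\<or> a \<^bold>\<cdot> Bound 0 \<^bold>= Succ Zero)"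
    using bit_cases[OF g p c tan an] g a by (simp add: all_iff)
  have not_zero: "H \<^bold>\<turnstile> All NatT (a \<^bold>\<cdot> Bound 0 \<^bold>= Zero) \<^bold>\<longrightarrow> Bot"
  proof (subst imp_iff[OF g])
    show "\<forall>K. H \<preceq> K \<longrightarrow> (K \<^bold>\<turnstile> All NatT (a \<^bold>\<cdot> Bound 0 \<^bold>= Zero)) \<longrightarrow> (K \<^bold>\<turnstile> Bot)"
    proof (intro HOL.allI HOL.impI)
      fix K assume K: "H \<preceq> K" and "K \<^bold>\<turnstile> All NatT (a \<^bold>\<cdot> Bound 0 \<^bold>= Zero)"
      then have gK: "good K" and zero: "K \<^bold>\<turnstile> a \<^bold>\<cdot> n \<^bold>= Zero" if "n \<Colon> NatT" for n
        using that a ext_ofD[OF K] by (simp_all add: all_iff)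
      have gK: "good K" using K by (rule ext_ofD)
      \<comment> \<open>Negative convergence is contradicted by the constant real \<open>Inv j\<close> and the identity.\<close>
      let ?d = "Lam NatT (q_inv j)" and ?\<nu> = "Lam NatT (Bound 0)"
      have d: "?d \<Colon> RealT" and \<nu>: "?\<nu> \<Colon> NatT \<^bold>\<rightarrow> NatT" using j by simp_all
      have large: "K \<^bold>\<turnstile> r_lt ?d (r_abs (x \<^bold>\<cdot> n))" if n: "n \<Colon> NatT" for n
      proof (rule r_lt_intro[OF gK d _ j])
        let ?x = "x \<^bold>\<cdot> n \<^bold>\<cdot> dbl j"
        have xt: "?x \<Colon> RatT" using x n m by simp
        have "K \<^bold>\<turnstile> q_lt c (?p n)" using bit_zero[OF gK p[OF n] c tan[OF n] an[OF n] zero[OF n]] .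
        then have 1: "positive K (rv ?x + Inv (dbl j) - rv c)" using gK c p[OF n] xt m by (simp add: q_lt_iff)
        have 2: "nonneg K (rv c - Inv (dpred c))" using Inv_le[OF c positive_mono[OF pos K]] .
        have 3: "nonneg K (rv (q_abs ?x) - rv ?x)" using abs_ge(1)[OF gK xt] .
        have 4: "nonneg K (Inv (dbl j) + Inv (dbl j) + Inv (dbl j))"
          using positive_nonneg[OF positive_Inv[OF gK m]] by (intro nonneg_add)
        have "positive K (rv (q_abs ?x) - Inv j - Inv j)"
          using positive_add[OF 1 nonneg_add[OF nonneg_add[OF 2 3] 4]]
          by (simp add: Inv_c Inv_j algebra_simps)
        then show "positive K (rv (r_abs (x \<^bold>\<cdot> n) \<^bold>\<cdot> dbl j) - rv (?d \<^bold>\<cdot> dbl j) - Inv j)"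
          using x n j m by (simp add: rv_r_abs rv_const)
      qed (use x n in simp)
      have \<nu>_eq: "nv (?\<nu> \<^bold>\<cdot> n) = nv n" if "n \<Colon> NatT" for n
        using that beta1[of "Bound 0" NatT NatT n "{}"] by (subst nv_eq_iff) simp_all
      have "K \<^bold>\<turnstile> often_gt x ?d"
      proof (rule often_gt_intro[OF gK x d \<nu>])
        fix i assume i: "i \<Colon> NatT"
        show "K \<^bold>\<turnstile> ?\<nu> \<^bold>\<cdot> i \<^bold>< ?\<nu> \<^bold>\<cdot> Succ i"
          using i gK \<nu>_eq[of i] \<nu>_eq[of "Succ i"] hlt_iff[of K "?\<nu> \<^bold>\<cdot> i" "?\<nu> \<^bold>\<cdot> Succ i"] by simp
        show "K \<^bold>\<turnstile> r_lt ?d (r_abs (x \<^bold>\<cdot> (?\<nu> \<^bold>\<cdot> i)))" using i by (intro large) simp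
      qed
      moreover have "K \<^bold>\<turnstile> is_real ?d" using gK by (intro is_real_const) simp_all
      moreover have "K \<^bold>\<turnstile> r_pos ?d" using gK by (intro r_pos_const) simp_all
      ultimately show "K \<^bold>\<turnstile> Bot"
        using neg[unfolded seq_neg_conv_iff[OF g x]] K d by blast
    qed
  qed (use a in simp)
  have "H \<^bold>\<turnstile> Markov_for a" using mp a g by (simp add: Markov_principle_iff)
  then have "H \<^bold>\<turnstile> Ex NatT (a \<^bold>\<cdot> Bound 0 \<^bold>= Succ Zero)"
    unfolding Markov_for_def using binary not_zero derives.impE by blast
  then show ?thesis
  proof (rule ex_elim[OF _ g])
    fix K n assume K: "H \<preceq> K" and n: "n \<Colon> NatT" and "K \<^bold>\<turnstile> inst 0 n (a \<^bold>\<cdot> Bound 0 \<^bold>= Succ Zero)"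
    then have "K \<^bold>\<turnstile> q_le (?p n) c"
      using bit_one[OF ext_ofD[OF K] p[OF n] c tan[OF n] an[OF n]] a by simp
    then show "K \<^bold>\<turnstile> \<phi>"
      using small[OF K n m] ext_ofD[OF K] p[OF n] c x n m by (simp add: q_le_iff)
  qed (use a in simp)
qed

text \<open>
  The rational \<open>c = \<epsilon>\<^sub>l - Inv l\<close> is positive by the choice of \<open>l\<close> and at most \<open>\<epsilon>\<close> by regularity.  The
  remaining precision in the definition of \<open>\<le>\<close> absorbs the errors of the approximations with indices
  \<open>dbl k\<close> and \<open>dbl (dbl k)\<close>.
\<close>

lemma convergence_from_Markov:
  assumes g: "good H" and mp: "H \<^bold>\<turnstile> Markov_principle" and x: "x \<Colon> SeqT"
    and real: "H \<^bold>\<turnstile> seq_real x" and nonn: "H \<^bold>\<turnstile> seq_nonneg x" and decr: "H \<^bold>\<turnstile> seq_decr x"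
    and neg: "H \<^bold>\<turnstile> seq_neg_conv x"
    and e: "\<epsilon> \<Colon> RealT" "H \<^bold>\<turnstile> is_real \<epsilon>" and l: "l \<Colon> NatT" and pos: "positive H (rv (\<epsilon> \<^bold>\<cdot> l) - Inv l)"
  shows "H \<^bold>\<turnstile> eventually_le x \<epsilon>"
proof -
  let ?c = "q_sub (\<epsilon> \<^bold>\<cdot> l) (q_inv l)"
  have c: "?c \<Colon> RatT" and c_val: "rv ?c = rv (\<epsilon> \<^bold>\<cdot> l) - Inv l" using e l by simp_all
  show ?thesis
  proof (rule Markov_small_term[OF g x c mp neg])
    show "positive H (rv ?c)" using pos c_val by simp
  next
    fix K n m assume K: "H \<preceq> K" and n: "n \<Colon> NatT" and m: "m \<Colon> NatT"
      and small: "nonneg K (rv ?c - (rv (x \<^bold>\<cdot> n \<^bold>\<cdot> m) + Inv m))"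
    have gK: "good K" using K by (rule ext_ofD)
    have base: "nonneg K (rv ?c + Inv k - rv (x \<^bold>\<cdot> n \<^bold>\<cdot> k))" if k: "k \<Colon> NatT" for k
    proof -
      have "nonneg K (Inv k + Inv m - (rv (x \<^bold>\<cdot> n \<^bold>\<cdot> k) - rv (x \<^bold>\<cdot> n \<^bold>\<cdot> m)))"
        using weaken[OF real K] gK x n k m by (simp add: seq_real_iff is_real_iff)
      from nonneg_add[OF small this] show ?thesis by (simp add: algebra_simps del: rv_simps)
    qed
    show "K \<^bold>\<turnstile> eventually_le x \<epsilon>"
    proof (rule eventually_le_intro[OF gK x e(1) n])
      fix L n' assume L: "K \<preceq> L" and n': "n' \<Colon> NatT" and le: "L \<^bold>\<turnstile> n \<^bold>\<le> n'"
      have gL: "good L" using L by (rule ext_ofD)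
      have HL: "H \<preceq> L" using K L by (rule ext_of_trans)
      have "heq L (nv n + (nv n' - nv n)) (nv n')"
        using le hle_iff[OF gL n n'] by (intro heq_add_diff) simp
      then have shift: "L \<^bold>\<turnstile> n \<^bold>+ (n' \<^bold>- n) \<^bold>= n'"
        using heq_iff[OF gL, of "n \<^bold>+ (n' \<^bold>- n)" n'] n n' by simp
      have bound: "nonneg L (rv ?c + Inv k - rv (x \<^bold>\<cdot> n' \<^bold>\<cdot> k))" if k: "k \<Colon> NatT" for k
      proof -
        have "nonneg L (rv ?c + Inv k - rv (x \<^bold>\<cdot> (n \<^bold>+ (n' \<^bold>- n)) \<^bold>\<cdot> k))"
          using base nonneg_mono[OF _ L] n n'
          by (intro decreasing_bound[OF gL x weaken[OF real HL] weaken[OF decr HL] n c _ _ k]) simp_all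
        moreover have "nonneg L (rv (x \<^bold>\<cdot> (n \<^bold>+ (n' \<^bold>- n)) \<^bold>\<cdot> k) - rv (x \<^bold>\<cdot> n' \<^bold>\<cdot> k))"
          using seq_cong[OF shift gL x _ n' k] n n' by simp
        ultimately show ?thesis using nonneg_add by fastforce
      qed
      let ?y = "r_sub (x \<^bold>\<cdot> n') r_zero"
      have y: "?y \<Colon> RealT" using x n' by simp
      show "L \<^bold>\<turnstile> r_le (r_abs ?y) \<epsilon>"
        unfolding r_le_iff[OF gL ty_of_real(1)[OF y] e(1)]
      proof (intro HOL.allI HOL.impI)
        fix k assume k: "k \<Colon> NatT"
        let ?k = "dbl k" let ?kk = "dbl ?k" let ?r = "rv (\<epsilon> \<^bold>\<cdot> ?k) + Inv k"
        have kk: "?k \<Colon> NatT" "?kk \<Colon> NatT" using k by simp_all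
        have y_val: "rv (?y \<^bold>\<cdot> ?k) = rv (x \<^bold>\<cdot> n' \<^bold>\<cdot> ?kk)"
          using x n' kk by (simp add: rv_r_sub rv_r_zero)
        have I1: "Inv k = Inv ?k + Inv ?k" and I2: "Inv ?k = Inv ?kk + Inv ?kk"
          using Inv_dbl[OF k] Inv_dbl[OF kk(1)] by simp_all
        have "nonneg L (Inv l + Inv ?k - (rv (\<epsilon> \<^bold>\<cdot> l) - rv (\<epsilon> \<^bold>\<cdot> ?k)))"
          using weaken[OF e(2) HL] gL e(1) l kk by (simp add: is_real_iff)
        then have r: "nonneg L (?r - (rv ?c + Inv ?k))"
          by (simp add: c_val I1 algebra_simps del: rv_simps)
        have Ikk: "nonneg L (Inv ?kk)" using positive_nonneg[OF positive_Inv[OF gL kk(2)]] .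
        have 1: "nonneg L (?r - rv (?y \<^bold>\<cdot> ?k))"
          using nonneg_add[OF nonneg_add[OF r bound[OF kk(2)]] Ikk]
          by (simp add: y_val I2 algebra_simps del: rv_simps)
        have "nonneg L (rv (x \<^bold>\<cdot> n' \<^bold>\<cdot> ?kk) + Inv ?kk)"
          using weaken[OF nonn HL] gL x n' kk by (simp add: seq_nonneg_iff r_nonneg_iff)
        moreover have "nonneg L (rv ?c)"
          using positive_nonneg[OF positive_mono[OF pos HL]] c_val by simp
        ultimately have 2: "nonneg L (?r + rv (?y \<^bold>\<cdot> ?k))"
          using nonneg_add[OF nonneg_add[OF nonneg_add[OF r Ikk]]]
          by (fastforce simp: y_val I2 algebra_simps simp del: rv_simps)
        have "nonneg L (?r - rv (q_abs (?y \<^bold>\<cdot> ?k)))"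
          using y kk by (intro abs_le 1 2) simp
        then show "nonneg L (rv (\<epsilon> \<^bold>\<cdot> ?k) - rv (r_abs ?y \<^bold>\<cdot> ?k) + Inv k)"
          using rv_r_abs[OF y kk(1)] by (simp add: algebra_simps)
      qed
    qed
  qed
qed

lemma Markov_imp_Decreasing:
  assumes g: "good H"
  shows "H \<^bold>\<turnstile> Markov_principle \<^bold>\<longrightarrow> Decreasing_convergence"
proof (subst imp_iff[OF g])
  show "wf_fm [] Markov_principle" using sentence_Markov_principle by (simp add: sentence_def)
  show "\<forall>K. H \<preceq> K \<longrightarrow> (K \<^bold>\<turnstile> Markov_principle) \<longrightarrow> (K \<^bold>\<turnstile> Decreasing_convergence)"
  proof (intro HOL.allI HOL.impI)
    fix K assume "H \<preceq> K" and mp: "K \<^bold>\<turnstile> Markov_principle"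
    then have gK: "good K" by auto
    show "K \<^bold>\<turnstile> Decreasing_convergence"
      unfolding Decreasing_convergence_iff[OF gK]
    proof (intro HOL.allI HOL.impI)
      fix x assume x: "x \<Colon> SeqT"
      have "L \<^bold>\<turnstile> seq_neg_conv x \<^bold>\<longrightarrow> seq_conv x"
        if L: "K \<preceq> L" and hyps: "L \<^bold>\<turnstile> seq_real x" "L \<^bold>\<turnstile> seq_nonneg x" "L \<^bold>\<turnstile> seq_decr x" for L
      proof -
        have gL: "good L" using L by auto
        have "M \<^bold>\<turnstile> seq_conv x" if M: "L \<preceq> M" and neg: "M \<^bold>\<turnstile> seq_neg_conv x" for M
          unfolding seq_conv_iff[OF ext_ofD[OF M] x]
        proof (intro HOL.allI HOL.impI)
          fix \<epsilon> N assume e: "\<epsilon> \<Colon> RealT" and N: "M \<preceq> N" and re: "N \<^bold>\<turnstile> is_real \<epsilon>" and "N \<^bold>\<turnstile> r_pos \<epsilon>"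
          then show "N \<^bold>\<turnstile> eventually_le x \<epsilon>"
          proof (elim r_pos_elim)
            fix P l assume P: "N \<preceq> P" and l: "l \<Colon> NatT" and pos: "positive P (rv (\<epsilon> \<^bold>\<cdot> l) - Inv l)"
            have MP: "M \<preceq> P" using N P ext_of_trans by blast
            have LP: "L \<preceq> P" using M MP ext_of_trans by blast
            have KP: "K \<preceq> P" using L LP ext_of_trans by blast
            show "P \<^bold>\<turnstile> eventually_le x \<epsilon>"
              using convergence_from_Markov[OF ext_ofD[OF P] weaken[OF mp KP] x weaken[OF hyps(1) LP]
                  weaken[OF hyps(2) LP] weaken[OF hyps(3) LP] weaken[OF neg MP] e weaken[OF re P] l pos] .
          qed (use N in auto)
        qed
        then show ?thesis using gL x by (simp add: imp_iff)
      qed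
      then show "K \<^bold>\<turnstile> seq_real x \<^bold>\<longrightarrow> seq_nonneg x \<^bold>\<longrightarrow> seq_decr x \<^bold>\<longrightarrow> seq_neg_conv x \<^bold>\<longrightarrow> seq_conv x"
        using gK x by (simp add: imp3_iff)
    qed
  qed
qed

section \<open>From convergence to Markov's principle\<close>

text \<open>
  For binary \<open>a\<close>, the value is 1 as long as \<open>a\<close> has taken only the value 0 below \<open>n\<close>, and 0 from then on.
\<close>

definition flag :: "tm \<Rightarrow> tm \<Rightarrow> tm" where
  "flag a n = Rec (Succ Zero) (Lam NatT (Lam NatT (Bound 0 \<^bold>- a \<^bold>\<cdot> Bound 1))) n"

definition flag_seq :: "tm \<Rightarrow> tm" where
  "flag_seq a = Lam NatT (Lam NatT (q_nat (flag a (Bound 1))))"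

context
  fixes a :: tm
  assumes a [simp]: "a \<Colon> NatT \<^bold>\<rightarrow> NatT"
begin

lemma ty_of_flag [simp]: "ty_of n \<Gamma> = Some NatT \<Longrightarrow> ty_of (flag a n) \<Gamma> = Some NatT"
  by (simp add: flag_def)

lemma inst_flag [simp]: "inst_tm k u (flag a n) = flag a (inst_tm k u n)"
  by (simp add: flag_def)

lemma flag_seq_typed [simp]: "flag_seq a \<Colon> SeqT"
  by (simp add: flag_seq_def)

lemma nv_flag:
  "nv (flag a Zero) = 1"
  "n \<Colon> NatT \<Longrightarrow> nv (flag a (Succ n)) = nv (flag a n) - nv (a \<^bold>\<cdot> n)"
  using nv_rec(1)[of "Succ Zero" "Bound 0 \<^bold>- a \<^bold>\<cdot> Bound 1"]
    nv_rec(2)[of "Succ Zero" "Bound 0 \<^bold>- a \<^bold>\<cdot> Bound 1" n]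
  by (simp_all add: flag_def one_suc)

lemma rv_flag_seq: "n \<Colon> NatT \<Longrightarrow> k \<Colon> NatT \<Longrightarrow> rv (flag_seq a \<^bold>\<cdot> n \<^bold>\<cdot> k) = rv (q_nat (flag a n))"
  using beta2[of "q_nat (flag a (Bound 1))" NatT NatT RatT n k "{}"]
  by (intro rv_eqI) (simp_all add: flag_seq_def)

lemma flag_antimono:
  assumes "hle H (nv m) (nv n)" "m \<Colon> NatT" "n \<Colon> NatT"
  shows "hle H (nv (flag a n)) (nv (flag a m))"
proof -
  have g: "good H" using assms hle_good by blast
  have "H \<^bold>\<turnstile> inst 0 (n \<^bold>- m) (flag a (m \<^bold>+ Bound 0) \<^bold>\<le> flag a m)"
  proof (rule derives_nat_induct[OF g])
    have "nv (m \<^bold>+ Zero) = nv m" using assms by simp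
    then have "H \<^bold>\<turnstile> m \<^bold>+ Zero \<^bold>= m" using g assms heq_iff[of H "m \<^bold>+ Zero" m] by simp
    then have "H \<^bold>\<turnstile> flag a (m \<^bold>+ Zero) \<^bold>= flag a m"
      using cong_ctx[of H "m \<^bold>+ Zero" m NatT "flag a (Bound 0)" NatT] assms by simp
    then have "heq H (nv (flag a (m \<^bold>+ Zero))) (nv (flag a m))" 
      using g assms by (subst heq_iff) simp_all
    then have "hle H (nv (flag a (m \<^bold>+ Zero))) (nv (flag a m))" by (rule heq_imp_hle)
    then show "H \<^bold>\<turnstile> inst 0 Zero (flag a (m \<^bold>+ Bound 0) \<^bold>\<le> flag a m)"
      using g assms by (simp add: hle_iff)
  next
    fix K t assume K: "H \<preceq> K" and t: "t \<Colon> NatT" and ih: "K \<^bold>\<turnstile> inst 0 t (flag a (m \<^bold>+ Bound 0) \<^bold>\<le> flag a m)"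
    have gK: "good K" using K by (rule ext_ofD)
    have "nv (m \<^bold>+ Succ t) = nv (Succ (m \<^bold>+ t))" using assms t by simp
    then have "K \<^bold>\<turnstile> m \<^bold>+ Succ t \<^bold>= Succ (m \<^bold>+ t)"
      using gK assms t heq_iff[of K "m \<^bold>+ Succ t" "Succ (m \<^bold>+ t)"] by simp
    then have "K \<^bold>\<turnstile> flag a (m \<^bold>+ Succ t) \<^bold>= flag a (Succ (m \<^bold>+ t))"
      using cong_ctx[of K "m \<^bold>+ Succ t" "Succ (m \<^bold>+ t)" NatT "flag a (Bound 0)" NatT] assms t by simp
    then have "heq K (nv (flag a (m \<^bold>+ Succ t))) (nv (flag a (Succ (m \<^bold>+ t))))" 
      using gK assms t by (subst heq_iff) simp_all
    then have "hle K (nv (flag a (m \<^bold>+ Succ t))) (nv (flag a (Succ (m \<^bold>+ t))))" by (rule heq_imp_hle)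
    also have "hle K (nv (flag a (Succ (m \<^bold>+ t)))) (nv (flag a (m \<^bold>+ t)))"
      using gK assms t by (simp add: nv_flag hle_minus)
    also have "hle K (nv (flag a (m \<^bold>+ t))) (nv (flag a m))"
      using ih gK assms t by (simp add: hle_iff)
    finally show "K \<^bold>\<turnstile> inst 0 (Succ t) (flag a (m \<^bold>+ Bound 0) \<^bold>\<le> flag a m)"
      using gK assms t by (simp add: hle_iff)
  qed (use assms in simp_all)
  then have 1: "hle H (nv (flag a (m \<^bold>+ (n \<^bold>- m)))) (nv (flag a m))"
    using g assms by (simp add: hle_iff)
  have "H \<^bold>\<turnstile> m \<^bold>+ (n \<^bold>- m) \<^bold>= n"
    using heq_add_diff[OF assms(1)] g assms heq_iff[of H "m \<^bold>+ (n \<^bold>- m)" n] by simp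
  then have "H \<^bold>\<turnstile> flag a (m \<^bold>+ (n \<^bold>- m)) \<^bold>= flag a n"
    using cong_ctx[of H "m \<^bold>+ (n \<^bold>- m)" n NatT "flag a (Bound 0)" NatT] assms by simp
  then have "heq H (nv (flag a (m \<^bold>+ (n \<^bold>- m)))) (nv (flag a n))"
    using g assms by (subst heq_iff) simp_all
  then show ?thesis using hle_trans[OF heq_imp_hle[OF heq_sym] 1] by simp
qed

text \<open>
  The search is an induction on \<open>n\<close>: when the flag falls to 0 in the step to \<open>Succ t\<close>, it was 0 before, or
  \<open>t\<close> is the wanted index.
\<close>

lemma flag_zero_imp_one:
  assumes g: "good H" and bin: "\<And>n. n \<Colon> NatT \<Longrightarrow> H \<^bold>\<turnstile> a \<^bold>\<cdot> n \<^bold>= Zero \<^bold>\<or> a \<^bold>\<cdot> n \<^bold>= Succ Zero"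
    and n: "n \<Colon> NatT" and z: "H \<^bold>\<turnstile> flag a n \<^bold>= Zero"
  shows "H \<^bold>\<turnstile> Ex NatT (a \<^bold>\<cdot> Bound 0 \<^bold>= Succ Zero)"
proof -
  let ?E = "Ex NatT (a \<^bold>\<cdot> Bound 0 \<^bold>= Succ Zero)"
  have "H \<^bold>\<turnstile> inst 0 n (flag a (Bound 0) \<^bold>= Zero \<^bold>\<longrightarrow> ?E)"
  proof (rule derives_nat_induct[OF g])
    have "K \<^bold>\<turnstile> ?E" if "H \<preceq> K" "K \<^bold>\<turnstile> flag a Zero \<^bold>= Zero" for K
    proof (rule derives.botE[OF heq_one_zero])
      show "heq K 1 0" using that heq_iff[of K "flag a Zero" Zero] by (auto simp: nv_flag)
    qed simp
    then show "H \<^bold>\<turnstile> inst 0 Zero (flag a (Bound 0) \<^bold>= Zero \<^bold>\<longrightarrow> ?E)" using g by (simp add: imp_iff)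
  next
    fix K t assume K: "H \<preceq> K" and t: "t \<Colon> NatT" and ih: "K \<^bold>\<turnstile> inst 0 t (flag a (Bound 0) \<^bold>= Zero \<^bold>\<longrightarrow> ?E)"
    have gK: "good K" using K by (rule ext_ofD)
    have "L \<^bold>\<turnstile> ?E" if L: "K \<preceq> L" and z: "L \<^bold>\<turnstile> flag a (Succ t) \<^bold>= Zero" for L
    proof (rule disj_elim[OF weaken[OF bin[OF t] ext_of_trans[OF K L]]])
      fix M assume M: "L \<preceq> M"
      show "M \<^bold>\<turnstile> ?E" if "M \<^bold>\<turnstile> a \<^bold>\<cdot> t \<^bold>= Succ Zero"
        using that t by (intro ex_intro[of _ t]) simp_all
      show "M \<^bold>\<turnstile> ?E" if "M \<^bold>\<turnstile> a \<^bold>\<cdot> t \<^bold>= Zero"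
      proof -
        have gM: "good M" using M by (rule ext_ofD)
        have "heq M (nv (a \<^bold>\<cdot> t)) 0" using that gM t heq_iff[of M "a \<^bold>\<cdot> t" Zero] by simp
        then have "heq M (nv (flag a t) - nv (a \<^bold>\<cdot> t)) (nv (flag a t) - 0)" by (rule heq_minus_left)
        moreover have "heq M (nv (flag a t) - nv (a \<^bold>\<cdot> t)) 0"
          using weaken[OF z M] gM t heq_iff[of M "flag a (Succ t)" Zero] by (simp add: nv_flag)
        ultimately have "heq M (nv (flag a t) - 0) 0" using heq_trans[OF heq_sym] by blast
        then have "heq M (nv (flag a t)) 0" by simp
        then have "M \<^bold>\<turnstile> flag a t \<^bold>= Zero" using gM t heq_iff[of M "flag a t" Zero] by simp
        moreover have "M \<^bold>\<turnstile> flag a t \<^bold>= Zero \<^bold>\<longrightarrow> ?E"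
          using weaken[OF ih ext_of_trans[OF L M]] by simp
        ultimately show ?thesis using derives.impE by blast
      qed
    qed (use L t in auto)
    then show "K \<^bold>\<turnstile> inst 0 (Succ t) (flag a (Bound 0) \<^bold>= Zero \<^bold>\<longrightarrow> ?E)" using gK t by (simp add: imp_iff)
  qed (use n in simp_all)
  then show ?thesis using z derives.impE by simp
qed

lemma flag_seq_real:
  assumes "good H"
  shows "H \<^bold>\<turnstile> seq_real (flag_seq a)"
  unfolding seq_real_iff[OF assms flag_seq_typed]
proof (intro HOL.allI HOL.impI)
  fix n assume "n \<Colon> NatT"
  then show "H \<^bold>\<turnstile> is_real (flag_seq a \<^bold>\<cdot> n)"
    using assms flag_seq_typed
    by (subst is_real_iff) (simp_all add: rv_flag_seq nonneg_add positive_nonneg positive_Inv)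
qed

lemma flag_seq_nonneg:
  assumes "good H"
  shows "H \<^bold>\<turnstile> seq_nonneg (flag_seq a)"
  unfolding seq_nonneg_iff[OF assms flag_seq_typed]
proof (intro HOL.allI HOL.impI)
  fix n assume "n \<Colon> NatT"
  then show "H \<^bold>\<turnstile> r_nonneg (flag_seq a \<^bold>\<cdot> n)"
    using assms flag_seq_typed
    by (subst r_nonneg_iff) (simp_all add: rv_flag_seq nonneg_add q_nat_nonneg positive_nonneg positive_Inv)
qed

lemma flag_seq_decr:
  assumes "good H"
  shows "H \<^bold>\<turnstile> seq_decr (flag_seq a)"
  unfolding seq_decr_iff[OF assms flag_seq_typed]
proof (intro HOL.allI HOL.impI)
  fix n assume n: "n \<Colon> NatT"
  have "nonneg H (rv (q_nat (flag a n)) - rv (q_nat (flag a (Succ n))))"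
    using assms n by (intro q_nat_mono) (simp_all add: nv_flag hle_minus)
  then show "H \<^bold>\<turnstile> r_le (flag_seq a \<^bold>\<cdot> Succ n) (flag_seq a \<^bold>\<cdot> n)"
    using assms n flag_seq_typed
    by (subst r_le_iff) (simp_all add: rv_flag_seq nonneg_add positive_nonneg positive_Inv)
qed

text \<open>
  For a term of the sequence that is 0, being larger than \<open>\<epsilon>\<close> means that an approximation of \<open>\<epsilon>\<close> is too negative for the
  regularity of \<open>\<epsilon>\<close>, as another approximation shows that \<open>\<epsilon>\<close> is positive.
\<close>

lemma not_gt_of_flag_zero:
  assumes g: "good H" and e: "\<epsilon> \<Colon> RealT" "H \<^bold>\<turnstile> is_real \<epsilon>" "H \<^bold>\<turnstile> r_pos \<epsilon>" and n: "n \<Colon> NatT"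
    and zero: "hle H (nv (flag a n)) 0" and gt: "H \<^bold>\<turnstile> r_lt \<epsilon> (r_abs (flag_seq a \<^bold>\<cdot> n))"
  shows "H \<^bold>\<turnstile> Bot"
proof -
  let ?x = "flag_seq a \<^bold>\<cdot> n"
  have x: "?x \<Colon> RealT" using n flag_seq_typed by simp
  show ?thesis
  proof (rule r_pos_elim[OF e(3) g e(1)])
    fix K l assume K: "H \<preceq> K" and l: "l \<Colon> NatT" and 1: "positive K (rv (\<epsilon> \<^bold>\<cdot> l) - Inv l)"
    have gK: "good K" using K by (rule ext_ofD)
    show "K \<^bold>\<turnstile> Bot"
    proof (rule r_pos_elim[OF weaken[OF gt K, unfolded r_lt_def] gK])
      fix L j assume L: "K \<preceq> L" and j: "j \<Colon> NatT"
        and "positive L (rv (r_sub (r_abs ?x) \<epsilon> \<^bold>\<cdot> j) - Inv j)"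
      then have 2: "positive L (rv (q_abs (?x \<^bold>\<cdot> dbl j)) - rv (\<epsilon> \<^bold>\<cdot> dbl j) - Inv j)"
        using x e j rv_r_abs[OF x, of "dbl j"] rv_r_sub[of "r_abs ?x" \<epsilon> j] by simp
      have gL: "good L" using L by (rule ext_ofD)
      have HL: "H \<preceq> L" using K L by (rule ext_of_trans)
      have 3: "nonneg L (Inv l + Inv (dbl j) - (rv (\<epsilon> \<^bold>\<cdot> l) - rv (\<epsilon> \<^bold>\<cdot> dbl j)))"
        using weaken[OF e(2) HL] gL e(1) l j by (simp add: is_real_iff)
      let ?e = "rv (q_nat (flag a n))" and ?p = "?x \<^bold>\<cdot> dbl j"
      have p: "?p \<Colon> RatT" and p_val: "rv ?p = ?e" using x n j by (simp_all add: rv_flag_seq)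
      have 4: "nonneg L ?e" using gL n by (simp add: q_nat_nonneg)
      have "nonneg L (rv (q_nat Zero) - ?e)"
        using hle_mono[OF zero HL] n by (intro q_nat_mono) simp_all
      then have "nonneg L (- rv ?p)" by (simp add: q_nat_zero p_val)
      then have 5: "nonneg L (- ?e - rv (q_abs ?p))" using abs_le_cases(2)[OF p] p_val by simp
      have 6: "nonneg L (Inv (dbl j))" using gL j by (simp add: positive_nonneg positive_Inv)
      have "positive L 0"
        using positive_add[OF positive_mono[OF 1 L] nonneg_add[OF nonneg_add[OF nonneg_add[OF nonneg_add[OF
          positive_nonneg[OF 2] 3] 4] 5] 6]] Inv_dbl[OF j, symmetric] by (simp add: algebra_simps)
      then show "L \<^bold>\<turnstile> Bot" by (rule positive_zero)
    qed (use x e in simp)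
  qed
qed

text \<open>
  If \<open>a\<^sub>k\<close> were 1, the flag would be 0 from \<open>Succ k\<close> on.  A strictly increasing \<open>\<nu>\<close> has \<open>\<nu> j \<ge> j\<close>, so it would visit this
  range at \<open>j = Succ k\<close>.  Hence \<open>a\<close> is 0 everywhere, which is excluded.
\<close>

lemma flag_seq_neg_conv:
  assumes g: "good H" and bin: "\<And>n. n \<Colon> NatT \<Longrightarrow> H \<^bold>\<turnstile> a \<^bold>\<cdot> n \<^bold>= Zero \<^bold>\<or> a \<^bold>\<cdot> n \<^bold>= Succ Zero"
    and not_zero: "H \<^bold>\<turnstile> All NatT (a \<^bold>\<cdot> Bound 0 \<^bold>= Zero) \<^bold>\<longrightarrow> Bot"
  shows "H \<^bold>\<turnstile> seq_neg_conv (flag_seq a)"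
  unfolding seq_neg_conv_iff[OF g flag_seq_typed]
proof (intro HOL.allI HOL.impI)
  fix \<epsilon> K assume e: "\<epsilon> \<Colon> RealT" and K: "H \<preceq> K" and re: "K \<^bold>\<turnstile> is_real \<epsilon>" and pos: "K \<^bold>\<turnstile> r_pos \<epsilon>"
    and often: "K \<^bold>\<turnstile> often_gt (flag_seq a) \<epsilon>"
  show "K \<^bold>\<turnstile> Bot"
  proof (rule often_gt_elim[OF often ext_ofD[OF K] flag_seq_typed e])
    fix L \<nu> assume L: "K \<preceq> L" and \<nu>: "\<nu> \<Colon> NatT \<^bold>\<rightarrow> NatT"
      and incr: "\<And>j. j \<Colon> NatT \<Longrightarrow> L \<^bold>\<turnstile> \<nu> \<^bold>\<cdot> j \<^bold>< \<nu> \<^bold>\<cdot> Succ j"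
      and gt: "\<And>j. j \<Colon> NatT \<Longrightarrow> L \<^bold>\<turnstile> r_lt \<epsilon> (r_abs (flag_seq a \<^bold>\<cdot> (\<nu> \<^bold>\<cdot> j)))"
    have gL: "good L" using L by (rule ext_ofD)
    have HL: "H \<preceq> L" using K L by (rule ext_of_trans)
    have grow: "hle L (nv k) (nv (\<nu> \<^bold>\<cdot> k))" if k: "k \<Colon> NatT" for k
    proof -
      have "L \<^bold>\<turnstile> inst 0 k (Bound 0 \<^bold>\<le> \<nu> \<^bold>\<cdot> Bound 0)"
      proof (rule derives_nat_induct[OF gL])
        show "L \<^bold>\<turnstile> inst 0 Zero (Bound 0 \<^bold>\<le> \<nu> \<^bold>\<cdot> Bound 0)"
          using \<nu> gL hle_iff[of L Zero "\<nu> \<^bold>\<cdot> Zero"] by (simp add: hle_def)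
        fix M t assume M: "L \<preceq> M" and t: "t \<Colon> NatT" and "M \<^bold>\<turnstile> inst 0 t (Bound 0 \<^bold>\<le> \<nu> \<^bold>\<cdot> Bound 0)"
        then have "hle M (nv t) (nv (\<nu> \<^bold>\<cdot> t))"
          using \<nu> ext_ofD[OF M] hle_iff[of M t "\<nu> \<^bold>\<cdot> t"] by simp
        then have "hle M (suc (nv t)) (suc (nv (\<nu> \<^bold>\<cdot> t)))" by (simp add: hle_def)
        also have "hle M (suc (nv (\<nu> \<^bold>\<cdot> t))) (nv (\<nu> \<^bold>\<cdot> Succ t))"
          using weaken[OF incr[OF t] M] \<nu> t ext_ofD[OF M] hlt_iff[of M "\<nu> \<^bold>\<cdot> t" "\<nu> \<^bold>\<cdot> Succ t"] by simp
        finally show "M \<^bold>\<turnstile> inst 0 (Succ t) (Bound 0 \<^bold>\<le> \<nu> \<^bold>\<cdot> Bound 0)"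
          using \<nu> t ext_ofD[OF M] hle_iff[of M "Succ t" "\<nu> \<^bold>\<cdot> Succ t"] by simp
      qed (use \<nu> k in simp_all)
      then show ?thesis using \<nu> k gL hle_iff[of L k "\<nu> \<^bold>\<cdot> k"] by simp
    qed
    have "L \<^bold>\<turnstile> a \<^bold>\<cdot> k \<^bold>= Zero" if k: "k \<Colon> NatT" for k
    proof (rule disj_elim[OF weaken[OF bin[OF k] HL] gL])
      fix M assume M: "L \<preceq> M" and one: "M \<^bold>\<turnstile> a \<^bold>\<cdot> k \<^bold>= Succ Zero"
      have gM: "good M" using M by (rule ext_ofD)
      have KM: "K \<preceq> M" using L M by (rule ext_of_trans)
      let ?n = "\<nu> \<^bold>\<cdot> Succ k"
      have n: "?n \<Colon> NatT" using \<nu> k by simp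
      have "hle M (nv (flag a ?n)) (nv (flag a (Succ k)))"
        using hle_mono[OF grow[of "Succ k"] M] k n by (intro flag_antimono) simp_all
      also have "heq M (nv (a \<^bold>\<cdot> k)) 1" 
        using one gM k heq_iff[of M "a \<^bold>\<cdot> k" "Succ Zero"] by (simp add: one_suc)
      then have "heq M (nv (flag a (Succ k))) (nv (flag a k) - 1)"
        using k by (simp add: nv_flag heq_minus_left)
      then have "hle M (nv (flag a (Succ k))) (nv (flag a k) - 1)" by (rule heq_imp_hle)
      also have "hle M (nv (flag a k)) 1"
        using flag_antimono[of M Zero k] k gM by (simp add: nv_flag hle_def)
      then have "hle M (nv (flag a k) - 1) 0" unfolding hle_def by simp
      finally have "M \<^bold>\<turnstile> Bot"
        by (intro not_gt_of_flag_zero[OF gM e weaken[OF re KM] weaken[OF pos KM] n] weaken[OF gt M]) (simp_all add: k)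
      then show "M \<^bold>\<turnstile> a \<^bold>\<cdot> k \<^bold>= Zero" by (rule derives.botE) (use k in simp)
    qed (use k in simp_all)
    then have "L \<^bold>\<turnstile> All NatT (a \<^bold>\<cdot> Bound 0 \<^bold>= Zero)" using gL by (simp add: all_iff)
    then show "L \<^bold>\<turnstile> Bot" using weaken[OF not_zero HL] derives.impE by blast
  qed
qed

text \<open>
  Convergence is used for \<open>\<epsilon> = 1 / 2\<close> only, and read with a precision of \<open>1 / 4\<close>: a flag of 1 would then
  be at most \<open>3 / 4\<close>.
\<close>

lemma Markov_from_Decreasing:
  assumes g: "good H" and dc: "H \<^bold>\<turnstile> Decreasing_convergence"
    and bin: "H \<^bold>\<turnstile> All NatT (a \<^bold>\<cdot> Bound 0 \<^bold>= Zero \<^bold>\<or> a \<^bold>\<cdot> Bound 0 \<^bold>= Succ Zero)"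
    and not_zero: "H \<^bold>\<turnstile> All NatT (a \<^bold>\<cdot> Bound 0 \<^bold>= Zero) \<^bold>\<longrightarrow> Bot"
  shows "H \<^bold>\<turnstile> Ex NatT (a \<^bold>\<cdot> Bound 0 \<^bold>= Succ Zero)"
proof -
  have bin': "H \<^bold>\<turnstile> a \<^bold>\<cdot> n \<^bold>= Zero \<^bold>\<or> a \<^bold>\<cdot> n \<^bold>= Succ Zero" if "n \<Colon> NatT" for n
    using bin g that by (simp add: all_iff)
  have "H \<^bold>\<turnstile> seq_real (flag_seq a) \<^bold>\<longrightarrow> seq_nonneg (flag_seq a) \<^bold>\<longrightarrow>
    seq_decr (flag_seq a) \<^bold>\<longrightarrow> seq_neg_conv (flag_seq a) \<^bold>\<longrightarrow> seq_conv (flag_seq a)"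
    using dc g flag_seq_typed by (simp add: Decreasing_convergence_iff)
  then have conv: "H \<^bold>\<turnstile> seq_conv (flag_seq a)"
    using flag_seq_real[OF g] flag_seq_nonneg[OF g] flag_seq_decr[OF g]
      flag_seq_neg_conv[OF g bin' not_zero] derives.impE by blast
  \<comment> \<open>The index 1 must have the form \<open>dbl Zero\<close> for \<open>Inv_dbl\<close> to apply.\<close>
  let ?j = "dbl Zero" let ?e = "Lam NatT (q_inv ?j)"
  have e: "?e \<Colon> RealT" by simp
  have "H \<^bold>\<turnstile> is_real ?e" "H \<^bold>\<turnstile> r_pos ?e" using g by (intro is_real_const r_pos_const; simp)+
  then have "H \<^bold>\<turnstile> eventually_le (flag_seq a) ?e"
    using conv[unfolded seq_conv_iff[OF g flag_seq_typed]] e ext_of_refl[of H] g by blast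
  then show ?thesis
  proof (rule eventually_le_elim[OF _ g flag_seq_typed e])
    fix K m assume K: "H \<preceq> K" and m: "m \<Colon> NatT"
      and le: "K \<^bold>\<turnstile> r_le (r_abs (r_sub (flag_seq a \<^bold>\<cdot> m) r_zero)) ?e"
    have gK: "good K" using K by (rule ext_ofD)
    let ?y = "r_sub (flag_seq a \<^bold>\<cdot> m) r_zero" and ?k = "dbl ?j"
    have y: "?y \<Colon> RealT" using m flag_seq_typed by simp
    have y_val: "rv (?y \<^bold>\<cdot> dbl ?k) = rv (q_nat (flag a m))"
      using m flag_seq_typed rv_r_sub[of "flag_seq a \<^bold>\<cdot> m" r_zero "dbl ?k"]
      by (simp add: rv_flag_seq rv_r_zero)
    have "nonneg K (rv (?e \<^bold>\<cdot> dbl ?k) - rv (r_abs ?y \<^bold>\<cdot> dbl ?k) + Inv ?k)"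
      using le gK y e r_le_iff[of K "r_abs ?y" ?e] by simp
    then have 1: "nonneg K (Inv ?j - rv (q_abs (?y \<^bold>\<cdot> dbl ?k)) + Inv ?k)"
      using rv_r_abs[OF y, of "dbl ?k"] rv_const[of "q_inv ?j" "dbl ?k"] by simp
    have 2: "nonneg K (rv (q_abs (?y \<^bold>\<cdot> dbl ?k)) - rv (q_nat (flag a m)))"
      using abs_ge(1)[of K "?y \<^bold>\<cdot> dbl ?k"] gK y by (simp add: y_val)
    have "hle K (nv (flag a m)) 0"
    proof (rule hle_by_contra[OF gK])
      fix L assume L: "K \<preceq> L" and "hle L (suc 0) (nv (flag a m))"
      then have "nonneg L (rv (q_nat (flag a m)) - rv (q_nat (Succ Zero)))"
        using m by (intro q_nat_mono) simp_all
      then have 3: "nonneg L (rv (q_nat (flag a m)) - Inv Zero)" by (simp add: q_nat_one)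
      have "positive L (Inv ?k)" using ext_ofD[OF L] by (simp add: positive_Inv)
      then have "positive L 0"
        using positive_add[OF _ nonneg_add[OF nonneg_mono[OF nonneg_add[OF 1 2] L] 3]]
          Inv_dbl[of Zero] Inv_dbl[of ?j] by (fastforce simp: algebra_simps)
      then show "L \<^bold>\<turnstile> Bot" by (rule positive_zero)
    qed
    then have "K \<^bold>\<turnstile> flag a m \<^bold>= Zero" using gK m heq_iff[of K "flag a m" Zero] by (simp add: hle_def)
    then show "K \<^bold>\<turnstile> Ex NatT (a \<^bold>\<cdot> Bound 0 \<^bold>= Succ Zero)"
      using weaken[OF bin' K] by (intro flag_zero_imp_one[OF gK _ m]) simp_all
  qed
qed

end

lemma Decreasing_imp_Markov:
  assumes g: "good H"
  shows "H \<^bold>\<turnstile> Decreasing_convergence \<^bold>\<longrightarrow> Markov_principle"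
proof (subst imp_iff[OF g])
  show "wf_fm [] Decreasing_convergence" using sentence_Decreasing_convergence by (simp add: sentence_def)
  show "\<forall>K. H \<preceq> K \<longrightarrow> (K \<^bold>\<turnstile> Decreasing_convergence) \<longrightarrow> (K \<^bold>\<turnstile> Markov_principle)"
  proof (intro HOL.allI HOL.impI)
    fix K assume "H \<preceq> K" and dc: "K \<^bold>\<turnstile> Decreasing_convergence"
    then have gK: "good K" by auto
    have "K \<^bold>\<turnstile> Markov_for a" if a: "a \<Colon> NatT \<^bold>\<rightarrow> NatT" for a
      unfolding Markov_for_def using Markov_from_Decreasing[OF a _ weaken[OF dc]] gK a
      by (subst imp2_iff) auto
    then show "K \<^bold>\<turnstile> Markov_principle" using gK by (simp add: Markov_principle_iff)
  qed
qed

section \<open>The equivalence\<close>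

theorem proposition6:
  fixes T :: "fm set"
  assumes "\<forall>\<phi>\<in>T. sentence \<phi>"
  shows "T \<^bold>\<turnstile> Markov_principle \<^bold>\<longleftrightarrow> Decreasing_convergence"
proof -
  have "good T" using assms by (simp add: good_def sentence_def)
  then show ?thesis
    unfolding Iff_def using Markov_imp_Decreasing Decreasing_imp_Markov by (intro derives.conjI)
qed

end
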